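(* Let $k\ge1$ be an odd integer, and let $\chi_1,\chi_2$ be primitive Dirichlet characters modulo $p$ and $q$ respectively, such that either both are non-principal even characters or both are odd characters. Let $a,x>0$. Then \begin{align*} \sum_{n=1}^\infty \sigma_{k,\chi_1,\chi_2}(n) K_0(a\sqrt{nx})= \frac{1}{2}c_{k,\chi_1,\chi_2} +\frac{ (-1)^{ \frac{k-1}{2}}k!\, p^k }{2(2 \pi)^{k+1}} \tau(\chi_1) \tau(\chi_2) \sum_{n=1}^\infty \sigma_{k,\bar{ \chi }_2,\bar{ \chi }_1}(n)\left(\frac{1}{n^{k+1}}-\frac{1}{(n+ \frac{a^2pqx}{16\pi^2} )^{k+1} } \right), \end{align*} where $c_{k,\chi_1,\chi_2}=L(-k,\chi_1)L'(0,\chi_2)$ if both $\chi_1,\chi_2$ are even, and $c_{k,\chi_1,\chi_2}=L'(-k,\chi_1)L(0,\chi_2)$ if both are odd.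
   Context: For Dirichlet characters $\chi_1,\chi_2$ and $z\in\mathbb{C}$: $\sigma_{z,\chi_1,\chi_2}(n)=\sum_{d\mid n}d^z\chi_1(d)\chi_2(n/d)$. $\tau(\chi)=\sum_{h=1}^q\chi(h)e^{2\pi i h/q}$ is the Gauss sum, $L(s,\chi)$ the Dirichlet $L$-function, and $K_0$ the modified Bessel function of the second kind of order $0$. *)

theory Defs
  imports "HOL-Analysis.Analysis"
begin

definition dirichlet_char :: "nat \<Rightarrow> (nat \<Rightarrow> complex) \<Rightarrow> bool" where
  "dirichlet_char q chi \<longleftrightarrow> q > 0 \<and>
     (\<forall>m n. chi (m * n) = chi m * chi n) \<and>
     (\<forall>n. chi (n + q) = chi n) \<and>
     (\<forall>n. chi n = 0 \<longleftrightarrow> \<not> coprime n q)"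

definition principal_char :: "nat \<Rightarrow> (nat \<Rightarrow> complex) \<Rightarrow> bool" where
  "principal_char q chi \<longleftrightarrow> (\<forall>n. coprime n q \<longrightarrow> chi n = 1)"

text \<open>Primitive: not induced by any character of smaller modulus d dividing q,
  i.e. for every proper divisor d of q there is a with a = 1 mod d, (a,q)=1, chi(a) ~= 1.\<close>
definition primitive_char :: "nat \<Rightarrow> (nat \<Rightarrow> complex) \<Rightarrow> bool" where
  "primitive_char q chi \<longleftrightarrow> dirichlet_char q chi \<and>
     (\<forall>d. d dvd q \<and> d < q \<longrightarrow> (\<exists>a. a mod d = 1 mod d \<and> coprime a q \<and> chi a \<noteq> 1))"

text \<open>Parity: chi(-1) = chi(q-1).\<close>
definition even_char :: "nat \<Rightarrow> (nat \<Rightarrow> complex) \<Rightarrow> bool" where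
  "even_char q chi \<longleftrightarrow> chi (q - 1) = 1"

definition odd_char :: "nat \<Rightarrow> (nat \<Rightarrow> complex) \<Rightarrow> bool" where
  "odd_char q chi \<longleftrightarrow> chi (q - 1) = -1"

definition gauss_sum :: "nat \<Rightarrow> (nat \<Rightarrow> complex) \<Rightarrow> complex" where
  "gauss_sum q chi = (\<Sum>h=1..q. chi h * exp (2 * pi * \<i> * of_nat h / of_nat q))"

definition sigma_chi :: "complex \<Rightarrow> (nat \<Rightarrow> complex) \<Rightarrow> (nat \<Rightarrow> complex) \<Rightarrow> nat \<Rightarrow> complex" where
  "sigma_chi z chi1 chi2 n = (\<Sum>d | d dvd n. of_nat d powr z * chi1 d * chi2 (n div d))"

text \<open>Dirichlet L-function of a non-principal character: the entire function agreeing
  with the Dirichlet series sum_{n>=1} chi(n) n^{-s} on Re s > 1 (analytic continuation).\<close>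
definition dirichlet_L :: "(nat \<Rightarrow> complex) \<Rightarrow> complex \<Rightarrow> complex" where
  "dirichlet_L chi = (THE f. f holomorphic_on UNIV \<and>
     (\<forall>s. Re s > 1 \<longrightarrow> (\<lambda>n. chi (Suc n) / of_nat (Suc n) powr s) sums f s))"

definition bessel_K0 :: "real \<Rightarrow> real" where
  "bessel_K0 x = integral {0..} (\<lambda>t. exp (- x * cosh t))"

end

theory Submission
  imports Defs "HOL-Number_Theory.Residues" "HOL-Complex_Analysis.Complex_Analysis"
begin

text \<open>
  Write \<open>F y = (\<Sum>n. \<sigma> n * exp (- n y))\<close> for the divisor function on the left-hand side and \<open>F'\<close>
  for the one on the right. Since \<open>2 K\<^sub>0(2 sqrt (\<alpha> n))\<close> is the integral of
  \<open>exp (- \<alpha> / y - n y)\<close> against \<open>dy / y\<close>, the Bessel series is half the integral of \<open>exp (- \<alpha> / y) F y\<close>.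
  Three facts then give the formula.

  First, \<open>F\<close> is an Eisenstein series of weight \<open>k + 1\<close> without constant term, so that
  \<open>F y = \<kappa> y^(-k-1) F' (4 \<pi>\<^sup>2 / (p q y))\<close>. All odd \<open>k\<close> are treated at once: with \<open>\<lambda>\<^sub>\<chi> w = (\<Sum>d. \<chi> d exp (- d w))\<close>,
  a rational function of \<open>exp (- w)\<close>, the residues of \<open>\<lambda>\<^sub>\<chi>\<^sub>1 (z y + w)\<close> times the corresponding function of
  \<open>2 \<pi> i z / q\<close> for the conjugate of \<open>\<chi>\<^sub>2\<close> add up to zero, because both factors decay exponentially on
  large rectangles, and the coefficient of \<open>w^k\<close> in this relation is the modular equation.

  Second, \<open>F\<close> therefore decays rapidly at \<open>0\<close> and at infinity, its Mellin transform is entire, and it equals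
  \<open>\<Gamma>(s) L(s - k, \<chi>\<^sub>1) L(s, \<chi>\<^sub>2)\<close>; at \<open>s = 0\<close> this is the derivative of the product of the two
  L-functions, one of whose terms vanishes by a trivial zero.

  Third, the remaining integral of \<open>(1 - exp (- \<alpha> / y)) F y\<close> is evaluated term by term after inserting the
  modular equation, where the series converges absolutely.
\<close>

section \<open>Primitive characters and Gauss sums\<close>

text \<open>The shift w replaces k-fold differentiation, which would create poles of order k + 1. It
  also moves one family of poles off the integers, so that every residue comes from a simple pole
  and a single contour argument serves all k. Two facts about the characters shape the result. Both
  moduli exceed 1, so both characters vanish at 0; hence the origin contributes no residue and the
  modular equation has no constant term. Both characters have the same sign e at -1; after n and -n
  are paired, only odd powers of w survive, which is why k is odd. The factor exp (- \<alpha> / y)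
  is split as 1 - (1 - exp (- \<alpha> / y)) because the divisor function grows at least like n^k
  along suitable bounds, so the series with weights n^(-k-1) has no absolutely convergent majorant
  of this kind. The difference gains one more power of n, and weights n^(-k-2) are the common
  majorant for every exchange of sum and integral. The values L(0) and L(-k) lie outside the
  half-plane of the Dirichlet series; an explicit entire continuation is therefore built
  first.\<close>

abbreviation two_pi_i :: complex where "two_pi_i \<equiv> 2 * of_real pi * \<i>"

definition unity :: "nat \<Rightarrow> nat \<Rightarrow> complex" where
  "unity q j = exp (2 * pi * \<i> * of_nat j / of_nat q)"

text \<open>The bound on the modulus excludes the constant character modulo 1. Its effect is
  \<open>chi 0 = 0\<close>, on which the absence of a residue at the origin and the decay of
  \<open>lam\<close> in both directions rest.\<close>

locale primitive_character =
  fixes q :: nat and chi :: "nat \<Rightarrow> complex"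
  assumes primitive: "primitive_char q chi" and modulus_gt_1: "q > 1"
begin

lemma mult: "chi (m * n) = chi m * chi n"
  and add_modulus: "chi (n + q) = chi n"
  and eq_0_iff: "chi n = 0 \<longleftrightarrow> \<not> coprime n q"
  using primitive by (auto simp: primitive_char_def dirichlet_char_def)

lemma zero [simp]: "chi 0 = 0"
  using modulus_gt_1 by (simp add: eq_0_iff)

lemma add_multiple: "chi (n + j * q) = chi n"
proof (induction j)
  case (Suc j)
  then show ?case using add_modulus[of "n + j * q"] by (simp add: algebra_simps)
qed auto

lemma mod_modulus: "chi (n mod q) = chi n"
  using add_multiple[of "n mod q" "n div q"] by simp

lemma cong_eq: "m mod q = n mod q \<Longrightarrow> chi m = chi n"
  using mod_modulus by metis

lemma one [simp]: "chi 1 = 1"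
  using mult[of 1 1] eq_0_iff[of 1] by simp

lemma power: "chi (n ^ j) = chi n ^ j"
  using one by (induction j) (simp_all add: mult)

lemma norm_coprime:
  assumes "coprime n q" shows "norm (chi n) = 1"
proof -
  have "[n ^ totient q = 1] (mod q)"
    using assms by (rule euler_theorem)
  hence "chi n ^ totient q = 1"
    using cong_eq[of "n ^ totient q" 1] one by (simp add: power cong_def)
  moreover have "totient q > 0" using modulus_gt_1 by simp
  ultimately show ?thesis
    using power_eq_1_iff[of "chi n" "totient q"] by auto
qed

lemma norm_le_1: "norm (chi n) \<le> 1"
  using norm_coprime[of n] eq_0_iff[of n] by (cases "coprime n q") auto

lemma mult_cnj: "coprime n q \<Longrightarrow> chi n * cnj (chi n) = 1"
  using norm_coprime[of n] by (simp add: complex_norm_square [symmetric])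

lemma bij_betw_mult:
  assumes "coprime a q"
  shows "bij_betw (\<lambda>r. a * r mod q) {..<q} {..<q}"
proof -
  have "inj_on (\<lambda>r. a * r mod q) {..<q}"
  proof (rule inj_onI)
    fix r s assume "r \<in> {..<q}" "s \<in> {..<q}" "a * r mod q = a * s mod q"
    hence "[r = s] (mod q)"
      using assms cong_mult_lcancel_nat[of a q r s] by (simp add: cong_def)
    then show "r = s" using \<open>r \<in> _\<close> \<open>s \<in> _\<close> by (simp add: cong_def)
  qed
  moreover have "(\<lambda>r. a * r mod q) ` {..<q} \<subseteq> {..<q}"
    using modulus_gt_1 by auto
  ultimately show ?thesis
    by (metis bij_betw_def endo_inj_surj finite_lessThan)
qed

lemma unity_add: "unity q (i + j) = unity q i * unity q j"
  by (simp add: unity_def exp_add [symmetric] add_divide_distrib ring_distribs)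

lemma unity_multiple: "unity q (j * q) = 1"
proof -
  have "unity q (j * q) = exp (of_nat j * two_pi_i)"
    using modulus_gt_1 by (simp add: unity_def field_simps)
  then show ?thesis by (simp only: exp_of_nat_mult exp_two_pi_i power_one)
qed

lemma unity_mod: "unity q (j mod q) = unity q j"
  using unity_add[of "j mod q" "j div q * q"] unity_multiple[of "j div q"] by simp

lemma sum_drop_zero: "(\<Sum>r=1..<q. chi r * g r) = (\<Sum>r<q. chi r * g r)"
proof -
  have "{..<q} = insert 0 {1..<q}" using modulus_gt_1 by auto
  then show ?thesis by simp
qed

lemma gauss_sum_eq: "gauss_sum q chi = (\<Sum>r<q. chi r * unity q r)"
proof -
  have "{1..q} = insert q {1..<q}" using modulus_gt_1 by auto
  moreover have "chi q = 0" using modulus_gt_1 by (simp add: eq_0_iff)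
  ultimately have "gauss_sum q chi = (\<Sum>r=1..<q. chi r * unity q r)"
    by (simp add: gauss_sum_def unity_def)
  then show ?thesis by (simp only: sum_drop_zero)
qed

text \<open>For n coprime to q the substitution r -> n r proves the claim. Otherwise both sides
  vanish: primitivity yields a unit a with \<open>chi a \<noteq> 1\<close> such that r -> a r leaves
  every root of unity in the sum unchanged, so the sum equals \<open>chi a\<close> times
  itself.\<close>

lemma gauss_sum_separable:
  "(\<Sum>r<q. chi r * unity q (r * n)) = cnj (chi n) * gauss_sum q chi"
proof (cases "coprime n q")
  case True
  have "chi n * (\<Sum>r<q. chi r * unity q (r * n)) = (\<Sum>r<q. chi (n * r mod q) * unity q (n * r mod q))"
    by (simp add: sum_distrib_left mod_modulus unity_mod mult mult_ac)
  also have "\<dots> = (\<Sum>r<q. chi r * unity q r)"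
    by (rule sum.reindex_bij_betw[OF bij_betw_mult[OF True]])
  finally have "chi n * (\<Sum>r<q. chi r * unity q (r * n)) = gauss_sum q chi"
    by (simp add: gauss_sum_eq)
  then show ?thesis
    using mult_cnj[OF True] by (metis mult.assoc mult.commute mult_1)
next
  case False
  define d where "d = q div gcd n q"
  have g: "gcd n q > 1"
    using False modulus_gt_1 by (metis coprime_iff_gcd_eq_1 gcd_eq_0_iff less_one linorder_neqE_nat not_one_less_zero)
  have dg: "d * gcd n q = q" by (simp add: d_def)
  have "d > 0" using dg modulus_gt_1 by (cases d) auto
  have "d < q" using n_less_n_mult_m[OF \<open>d > 0\<close>, of "gcd n q"] g dg by simp
  moreover have "d dvd q" using dg by (metis dvd_triv_left)
  ultimately obtain a where a: "a mod d = 1 mod d" "coprime a q" "chi a \<noteq> 1"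
    using primitive by (auto simp: primitive_char_def)
  \<comment> \<open>From a = 1 modulo \<open>q div gcd n q\<close>, multiplication by
    \<open>gcd n q\<close>, and then by the cofactor of n, gives the congruence modulo q.\<close>
  have an: "(a * n) mod q = n mod q"
  proof -
    have "[a * gcd n q = 1 * gcd n q] (mod (d * gcd n q))"
      using a(1) by (simp add: cong_def mult_mod_left [symmetric])
    hence "[a * gcd n q = gcd n q] (mod q)" by (simp add: dg)
    hence "[a * gcd n q * (n div gcd n q) = gcd n q * (n div gcd n q)] (mod q)"
      by (rule cong_scalar_right)
    then show ?thesis by (simp add: cong_def mult.assoc)
  qed
  define T where "T = (\<Sum>r<q. chi r * unity q (r * n))"
  have E: "unity q ((a * r mod q) * n) = unity q (r * n)" for r
  proof -
    have "(a * r mod q) * n mod q = r * ((a * n) mod q) mod q"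
      by (simp add: mod_simps mult_ac)
    also have "\<dots> = r * n mod q" by (simp add: an mod_simps)
    finally show ?thesis by (metis unity_mod)
  qed
  have "T = (\<Sum>r<q. chi (a * r mod q) * unity q ((a * r mod q) * n))"
    unfolding T_def by (rule sum.reindex_bij_betw[OF bij_betw_mult[OF a(2)], symmetric])
  also have "\<dots> = chi a * T"
    unfolding E by (simp add: mod_modulus mult T_def sum_distrib_left mult.assoc)
  finally have "T = 0" using a(3) by simp
  moreover have "chi n = 0" using False by (simp add: eq_0_iff)
  ultimately show ?thesis by (simp add: T_def)
qed

lemma reflect:
  assumes "r \<le> q" shows "chi (q - r) = chi (q - 1) * chi r"
proof (rule trans[OF cong_eq mult])
  \<comment> \<open>The two numbers differ by (r - 1) q, which is negative for r = 0; hence the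
    detour through the integers.\<close>
  have "int ((q - 1) * r) mod int q = int (q - r) mod int q"
  proof -
    have "int ((q - 1) * r) = int (q - r) + (int r - 1) * int q"
      using assms modulus_gt_1 by (simp add: of_nat_diff algebra_simps)
    then show ?thesis by (metis mod_mult_self1)
  qed
  then show "(q - r) mod q = (q - 1) * r mod q"
    by (metis of_nat_eq_iff of_nat_mod)
qed

lemma cnj_primitive: "primitive_character q (cnj \<circ> chi)"
  using primitive modulus_gt_1
  by (auto simp: primitive_character_def primitive_char_def dirichlet_char_def)

lemma unity_diff: assumes "r \<le> q" shows "unity q ((q - r) * n) = inverse (unity q (r * n))"
proof -
  have "unity q ((q - r) * n) * unity q (r * n) = unity q (n * q)"
    using assms by (simp add: unity_add [symmetric] algebra_simps diff_mult_distrib2)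
  then show ?thesis by (simp add: unity_multiple unity_def field_simps)
qed

lemma sum_reflect: "(\<Sum>r=1..<q. g (q - r)) = (\<Sum>r=1..<q. g r)"
  by (rule sum.reindex_bij_witness[of _ "\<lambda>r. q - r" "\<lambda>r. q - r"]) auto

lemma gauss_sum_separable_inverse:
  "(\<Sum>r<q. chi r * inverse (unity q (r * n))) = chi (q - 1) * cnj (chi n) * gauss_sum q chi"
proof -
  have "(\<Sum>r<q. chi r * inverse (unity q (r * n))) = (\<Sum>r=1..<q. chi r * inverse (unity q (r * n)))"
    by (rule sum_drop_zero [symmetric])
  also have "\<dots> = (\<Sum>r=1..<q. chi (q - r) * inverse (unity q ((q - r) * n)))"
    by (rule sum_reflect [symmetric])
  also have "\<dots> = (\<Sum>r=1..<q. chi r * (chi (q - 1) * unity q (r * n)))"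
  proof (intro sum.cong refl)
    fix r assume "r \<in> {1..<q}"
    then show "chi (q - r) * inverse (unity q ((q - r) * n)) = chi r * (chi (q - 1) * unity q (r * n))"
      using reflect[of r] unity_diff[of r n] by simp
  qed
  also have "\<dots> = chi (q - 1) * (\<Sum>r<q. chi r * unity q (r * n))"
    by (simp only: sum_drop_zero) (simp add: sum_distrib_left mult_ac)
  finally show ?thesis by (simp add: gauss_sum_separable)
qed

text \<open>Orthogonality of the additive characters: a geometric sum whose ratio is a q-th root of
  unity. The ratio is 1 only for r = 1, as r is taken below q.\<close>

lemma sum_unity:
  assumes "r < q"
  shows "(\<Sum>n<q. unity q (r * n) * inverse (unity q n)) = (if r = 1 then of_nat q else 0)"
proof (cases "r = 1")
  case True
  have "unity q n \<noteq> 0" for n by (simp add: unity_def)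
  then show ?thesis using True by simp
next
  case False
  define w where "w = unity q r * inverse (unity q 1)"
  have p: "unity q (i * n) = unity q i ^ n" for i n
    by (induction n) (simp_all add: unity_add, simp add: unity_def)
  have pow: "unity q (r * n) * inverse (unity q n) = w ^ n" for n
    using p[of 1 n] by (simp add: p[of r] w_def power_mult_distrib power_inverse)
  have "w \<noteq> 1"
  proof
    assume "w = 1"
    hence "unity q r = unity q 1" by (simp add: w_def unity_def field_simps)
    hence "exp (2 * pi * \<i> * of_nat r / of_nat q) = exp (2 * pi * \<i> * of_nat 1 / of_nat q)"
      by (simp add: unity_def)
    hence "r mod q = 1 mod q"
      using complex_root_unity_eq[of q r 1] modulus_gt_1 by (simp add: cong_def mult_ac)
    then show False using assms False modulus_gt_1 by simp
  qed
  moreover have "w ^ q = 1"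
    using unity_multiple[of r] unity_multiple[of 1] by (simp add: pow[symmetric])
  ultimately show ?thesis using False by (simp add: pow geometric_sum)
qed

text \<open>The sum of \<open>cnj (chi n) * gauss_sum q chi\<close> against inverse roots of unity
  is evaluated twice: directly, it is a product of two Gauss sums; by separability and orthogonality
  it collapses to the term r = 1. This later turns a Gauss sum of the conjugate in a denominator
  into one of the character itself in the numerator.\<close>

lemma gauss_sum_mult_cnj:
  "gauss_sum q chi * gauss_sum q (cnj \<circ> chi) = chi (q - 1) * of_nat q"
proof -
  interpret c: primitive_character q "cnj \<circ> chi" by (rule cnj_primitive)
  have e2: "chi (q - 1) * cnj (chi (q - 1)) = 1"
    using modulus_gt_1 by (intro mult_cnj) (metis coprime_diff_one_left_nat gcd_nat.extremum not_one_less_zero bot_nat_0.not_eq_extremum)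
  have "gauss_sum q chi * (\<Sum>n<q. cnj (chi n) * inverse (unity q n))
      = (\<Sum>n<q. (\<Sum>r<q. chi r * unity q (r * n)) * inverse (unity q n))"
    unfolding gauss_sum_separable by (simp add: sum_distrib_left mult_ac)
  also have "\<dots> = (\<Sum>n<q. \<Sum>r<q. chi r * (unity q (r * n) * inverse (unity q n)))"
    by (simp add: sum_distrib_right mult.assoc)
  also have "\<dots> = (\<Sum>r<q. \<Sum>n<q. chi r * (unity q (r * n) * inverse (unity q n)))"
    by (rule sum.swap)
  also have "\<dots> = (\<Sum>r<q. chi r * (if r = 1 then of_nat q else 0))"
    by (intro sum.cong refl) (simp add: sum_unity flip: sum_distrib_left)
  also have "\<dots> = (\<Sum>r<q. if r = 1 then of_nat q else 0)"
    using one by (intro sum.cong refl) simp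
  also have "\<dots> = of_nat q" using modulus_gt_1 by simp
  also have "(\<Sum>n<q. cnj (chi n) * inverse (unity q n)) = cnj (chi (q - 1)) * gauss_sum q (cnj \<circ> chi)"
    using c.gauss_sum_separable_inverse[of 1] one by simp
  finally have "gauss_sum q chi * gauss_sum q (cnj \<circ> chi) * cnj (chi (q - 1)) = of_nat q"
    by (simp add: mult_ac)
  hence "chi (q - 1) * of_nat q = gauss_sum q chi * gauss_sum q (cnj \<circ> chi) * (chi (q - 1) * cnj (chi (q - 1)))"
    by (metis mult.assoc mult.commute)
  then show ?thesis unfolding e2 by simp
qed

end

section \<open>The generating function of a character\<close>

text \<open>The closed form of the generating series, obtained by summing over residue classes.
  Unlike the series it makes sense in both half-planes, with possible poles only at the multiples of
  2 pi i / q.\<close>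

definition lam :: "nat \<Rightarrow> (nat \<Rightarrow> complex) \<Rightarrow> complex \<Rightarrow> complex" where
  "lam q c w = (\<Sum>r<q. c r * exp (- (of_nat r * w))) / (1 - exp (- (of_nat q * w)))"

context primitive_character
begin

lemma lam_sums:
  assumes "Re w > 0"
  shows "(\<lambda>d. chi d * exp (- (of_nat d * w))) sums lam q chi w"
proof -
  define f where "f = (\<lambda>d. chi d * exp (- (of_nat d * w)))"
  define b where "b = (\<Sum>r<q. chi r * exp (- (of_nat r * w)))"
  have ex: "exp (- (of_nat d * w)) = exp (- w) ^ d" for d
    by (simp add: exp_of_nat_mult [symmetric])
  have nm: "norm (exp (- w)) < 1" using assms by simp
  have "summable f"
  proof (rule summable_comparison_test')
    show "summable (\<lambda>d. norm (exp (- w)) ^ d)" using nm by (intro summable_geometric) simp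
    show "norm (f d) \<le> norm (exp (- w)) ^ d" if "d \<ge> 0" for d
      using mult_right_mono[OF norm_le_1[of d], of "norm (exp (- w) ^ d)"]
      unfolding f_def ex norm_mult by (simp add: norm_power)
  qed
  then obtain s where s: "f sums s" by (auto simp: summable_def)
  have "(\<lambda>n. sum f {n * q..<n * q + q}) sums s"
    using s modulus_gt_1 by (intro sums_group) auto
  also have "(\<lambda>n. sum f {n * q..<n * q + q}) = (\<lambda>n. b * (exp (- w) ^ q) ^ n)"
  proof
    fix n
    have "sum f {n * q..<n * q + q} = (\<Sum>r<q. f (r + n * q))"
      using sum.shift_bounds_nat_ivl[of f 0 "n * q" q] by (simp add: atLeast0LessThan add.commute)
    also have "\<dots> = b * (exp (- w) ^ q) ^ n"
    proof -
      have "exp (- w) ^ (r + n * q) = exp (- w) ^ r * (exp (- w) ^ q) ^ n" for r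
        by (simp add: power_add power_mult [symmetric] mult.commute)
      then show ?thesis
        unfolding f_def add_multiple b_def ex by (simp add: sum_distrib_right mult.assoc)
    qed
    finally show "sum f {n * q..<n * q + q} = b * (exp (- w) ^ q) ^ n" .
  qed
  finally have "(\<lambda>n. b * (exp (- w) ^ q) ^ n) sums s" .
  moreover have "norm (exp (- w) ^ q) < 1"
    unfolding norm_power using nm modulus_gt_1 by (intro power_less_one_iff[THEN iffD2]) auto
  hence "(\<lambda>n. b * (exp (- w) ^ q) ^ n) sums (b * (1 / (1 - exp (- w) ^ q)))"
    by (intro sums_mult geometric_sums)
  ultimately have "s = b / (1 - exp (- w) ^ q)" by (simp add: sums_unique2)
  then show ?thesis using s unfolding f_def lam_def b_def ex by simp
qed

text \<open>Reversing r -> q - r in the numerator produces the factor exp (q w), which the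
  denominator produces as well. So \<open>lam\<close> is an odd function for even characters and an
  even one for odd characters.\<close>

lemma lam_minus: "lam q chi (- w) = - chi (q - 1) * lam q chi w"
proof -
  have "(\<Sum>r<q. chi r * exp (- (of_nat r * (- w)))) = (\<Sum>r=1..<q. chi r * exp (of_nat r * w))"
    unfolding sum_drop_zero by simp
  also have "\<dots> = (\<Sum>r=1..<q. chi (q - r) * exp (of_nat (q - r) * w))"
    by (rule sum_reflect [symmetric])
  also have "\<dots> = (\<Sum>r=1..<q. chi r * (chi (q - 1) * exp (of_nat q * w) * exp (- (of_nat r * w))))"
  proof (intro sum.cong refl)
    fix r assume r: "r \<in> {1..<q}"
    hence "exp (of_nat (q - r) * w) = exp (of_nat q * w) * exp (- (of_nat r * w))"
      by (simp add: of_nat_diff left_diff_distrib exp_diff exp_minus field_simps)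
    then show "chi (q - r) * exp (of_nat (q - r) * w)
        = chi r * (chi (q - 1) * exp (of_nat q * w) * exp (- (of_nat r * w)))"
      using r reflect[of r] by simp
  qed
  also have "\<dots> = chi (q - 1) * exp (of_nat q * w) * (\<Sum>r<q. chi r * exp (- (of_nat r * w)))"
    unfolding sum_drop_zero by (simp add: sum_distrib_left mult_ac)
  finally have num: "(\<Sum>r<q. chi r * exp (- (of_nat r * (- w))))
      = chi (q - 1) * exp (of_nat q * w) * (\<Sum>r<q. chi r * exp (- (of_nat r * w)))" .
  have den: "1 - exp (- (of_nat q * (- w))) = - exp (of_nat q * w) * (1 - exp (- (of_nat q * w)))"
    by (simp add: algebra_simps exp_minus)
  show ?thesis unfolding lam_def num den by simp
qed

text \<open>The term r = 0 is absent, so all exponents in the numerator lie strictly between 0 and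
  q. Each is therefore smaller by at least exp (- \<bar>Re w\<bar>) than the larger of the two terms
  1 and exp (- q Re w) in the denominator. The hypothesis quantifies the distance from the
  poles.\<close>

lemma norm_lam_le:
  assumes "k > 0" and "norm (1 - exp (- (of_nat q * w))) \<ge> k * max 1 (exp (- (real q * Re w)))"
  shows "norm (lam q chi w) \<le> real q / k * exp (- \<bar>Re w\<bar>)"
proof -
  define m where "m = max 1 (exp (- (real q * Re w)))"
  have m: "m > 0" by (simp add: m_def)
  have "norm (\<Sum>r<q. chi r * exp (- (of_nat r * w))) \<le> (\<Sum>r<q. m * exp (- \<bar>Re w\<bar>))"
  proof (rule sum_norm_le)
    fix r assume "r \<in> {..<q}"
    show "norm (chi r * exp (- (of_nat r * w))) \<le> m * exp (- \<bar>Re w\<bar>)"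
    proof (cases "r = 0")
      case True
      then show ?thesis using m by simp
    next
      case False
      have "norm (chi r * exp (- (of_nat r * w))) \<le> exp (- (real r * Re w))"
        using mult_right_mono[OF norm_le_1[of r], of "exp (- (real r * Re w))"] by (simp add: norm_mult)
      also have "\<dots> \<le> m * exp (- \<bar>Re w\<bar>)"
      proof (cases "Re w \<ge> 0")
        case True
        have "1 * Re w \<le> real r * Re w" using False True by (intro mult_right_mono) auto
        hence "exp (- (real r * Re w)) \<le> 1 * exp (- \<bar>Re w\<bar>)" using True by simp
        also have "\<dots> \<le> m * exp (- \<bar>Re w\<bar>)" by (intro mult_right_mono) (auto simp: m_def)
        finally show ?thesis .
      next
        case neg: False
        have "real r + 1 \<le> real q" using \<open>r \<in> {..<q}\<close> by simp
        hence "(real r + 1) * (- Re w) \<le> real q * (- Re w)" using neg by (intro mult_right_mono) auto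
        hence "exp (- (real r * Re w)) \<le> exp (- (real q * Re w)) * exp (- \<bar>Re w\<bar>)"
          using neg by (simp add: exp_add [symmetric] algebra_simps)
        also have "\<dots> \<le> m * exp (- \<bar>Re w\<bar>)" by (intro mult_right_mono) (auto simp: m_def)
        finally show ?thesis .
      qed
      finally show ?thesis .
    qed
  qed
  hence "norm (lam q chi w) \<le> (real q * (m * exp (- \<bar>Re w\<bar>))) / norm (1 - exp (- (of_nat q * w)))"
    unfolding lam_def norm_divide by (intro divide_right_mono) auto
  also have "\<dots> \<le> (real q * (m * exp (- \<bar>Re w\<bar>))) / (k * m)"
  proof (intro divide_left_mono)
    have "0 < k * m" using assms(1) m by simp
    also have "k * m \<le> norm (1 - exp (- (of_nat q * w)))" using assms(2) by (simp add: m_def)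
    finally show "0 < norm (1 - exp (- (of_nat q * w))) * (k * m)" using assms(1) m by simp
  qed (use assms m in \<open>auto simp: m_def\<close>)
  also have "\<dots> = real q / k * exp (- \<bar>Re w\<bar>)" using m by simp
  finally show ?thesis .
qed

text \<open>This is the situation halfway between two neighbouring poles: the two terms of the
  denominator add up without cancellation.\<close>

lemma norm_lam_le_exp_neg:
  assumes "exp (- (of_nat q * w)) = - of_real (exp (- (real q * Re w)))"
  shows "norm (lam q chi w) \<le> real q * exp (- \<bar>Re w\<bar>)"
proof -
  have "norm (1 - exp (- (of_nat q * w))) = 1 + exp (- (real q * Re w))"
  proof -
    have "1 - exp (- (of_nat q * w)) = of_real (1 + exp (- (real q * Re w)))"
      by (simp add: assms)
    then show ?thesis by (simp only: norm_of_real) simp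
  qed
  hence "norm (1 - exp (- (of_nat q * w))) \<ge> 1 * max 1 (exp (- (real q * Re w)))"
    by (simp add: max_def)
  from norm_lam_le[OF _ this] show ?thesis by simp
qed

lemma norm_lam_le_far:
  assumes "\<bar>Re w\<bar> \<ge> d" "d > 0"
  shows "norm (lam q chi w) \<le> real q / (1 - exp (- d)) * exp (- \<bar>Re w\<bar>)"
proof (rule norm_lam_le)
  show "1 - exp (- d) > 0" using assms by simp
  define t where "t = real q * Re w"
  have nt: "norm (exp (- (of_nat q * w))) = exp (- t)" by (simp add: t_def)
  have "d \<le> \<bar>t\<bar>"
    using mult_mono[of 1 "real q" d "\<bar>Re w\<bar>"] assms modulus_gt_1 by (simp add: t_def abs_mult)
  have "(1 - exp (- d)) * max 1 (exp (- t)) \<le> \<bar>1 - exp (- t)\<bar>"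
  proof (cases "t \<ge> 0")
    case True
    then show ?thesis using \<open>d \<le> \<bar>t\<bar>\<close> by (simp add: max_def)
  next
    case False
    have "exp (- t) * exp t \<le> exp (- t) * exp (- d)"
      using False \<open>d \<le> \<bar>t\<bar>\<close> by (intro mult_left_mono) auto
    hence "(1 - exp (- d)) * exp (- t) \<le> exp (- t) - 1"
      by (simp add: exp_minus field_simps)
    then show ?thesis using False by (simp add: max_def)
  qed
  also have "\<dots> \<le> norm (1 - exp (- (of_nat q * w)))"
    using norm_triangle_ineq3[of 1 "exp (- (of_nat q * w))"] nt by simp
  finally show "(1 - exp (- d)) * max 1 (exp (- (real q * Re w))) \<le> norm (1 - exp (- (of_nat q * w)))"
    by (simp add: t_def)
qed

end

section \<open>Residue sums and edge estimates on rectangles\<close>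

lemma contour_integral_rectpath_simple_zeros:
  assumes "open S" "connected S" "cbox a b \<subseteq> S" "Re a < Re b" "Im a < Im b"
    and num: "num holomorphic_on S" and den: "den holomorphic_on S"
    and P: "finite P" "P \<subseteq> box a b" "\<And>z. z \<in> S \<Longrightarrow> den z = 0 \<longleftrightarrow> z \<in> P"
    and den': "\<And>z. z \<in> P \<Longrightarrow> (den has_field_derivative den' z) (at z)" "\<And>z. z \<in> P \<Longrightarrow> den' z \<noteq> 0"
  shows "contour_integral (rectpath a b) (\<lambda>z. num z / den z) = 2 * pi * \<i> * (\<Sum>z\<in>P. num z / den' z)"
proof -
  have sub: "path_image (rectpath a b) \<subseteq> cbox a b"
    using assms by (intro path_image_rectpath_subset_cbox) auto
  have dis: "path_image (rectpath a b) \<inter> box a b = {}"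
    using assms by (intro path_image_rectpath_inter_box) auto
  have "contour_integral (rectpath a b) (\<lambda>z. num z / den z) =
      2 * pi * \<i> * (\<Sum>z\<in>P. winding_number (rectpath a b) z * residue (\<lambda>z. num z / den z) z)"
  proof (rule Residue_theorem[OF assms(1,2) P(1)])
    show "(\<lambda>z. num z / den z) holomorphic_on S - P"
      using P by (intro holomorphic_intros holomorphic_on_subset[OF num] holomorphic_on_subset[OF den]) auto
    show "path_image (rectpath a b) \<subseteq> S - P" using sub dis P assms by blast
    show "\<forall>z. z \<notin> S \<longrightarrow> winding_number (rectpath a b) z = 0"
      using assms by (auto intro!: winding_number_rectpath_outside)
  qed auto
  also have "(\<Sum>z\<in>P. winding_number (rectpath a b) z * residue (\<lambda>z. num z / den z) z)
      = (\<Sum>z\<in>P. num z / den' z)"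
  proof (intro sum.cong refl)
    fix z assume z: "z \<in> P"
    hence zS: "z \<in> S" "z \<in> box a b" using P assms(3) box_subset_cbox by blast+
    show "winding_number (rectpath a b) z * residue (\<lambda>z. num z / den z) z = num z / den' z"
    proof (cases "num z = 0")
      case False
      have "residue (\<lambda>z. num z / den z) z = num z / den' z"
        using z zS P den' by (intro residue_simple_pole_deriv[OF num den assms(1,2) zS(1)] False) auto
      then show ?thesis using winding_number_rectpath[OF zS(2)] by simp
    next
      \<comment> \<open>The numerator may vanish at a zero of the denominator, as it does at
        integers not coprime to the modulus. The singularity is then removable, and the residue 0
        agrees with the formula.\<close>
      case True
      have "open (S - (P - {z}))" using P assms(1) by (intro open_Diff finite_imp_closed) auto
      then obtain e where e: "e > 0" "ball z e \<subseteq> S - (P - {z})"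
        using zS open_contains_ball[of "S - (P - {z})"] by auto
      have "residue (\<lambda>z. num z / den z) z = 0"
      proof (rule residue_simple')
        show "open (ball z e)" "z \<in> ball z e" using e by auto
        show "(\<lambda>z. num z / den z) holomorphic_on ball z e - {z}"
          using P e by (intro holomorphic_intros holomorphic_on_subset[OF num] holomorphic_on_subset[OF den]) auto
        have "((\<lambda>w. num w * inverse ((den w - den z) / (w - z))) \<longlongrightarrow> num z * inverse (den' z)) (at z)"
          using den'[OF z] num assms(1) zS
          by (intro tendsto_intros)
             (auto simp: has_field_derivative_iff holomorphic_on_imp_continuous_on
                continuous_on_eq_continuous_at isCont_def dest!: holomorphic_on_imp_continuous_on)
        moreover have "den z = 0" using P z zS by auto
        ultimately show "((\<lambda>w. num w / den w * (w - z)) \<longlongrightarrow> 0) (at z)"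
          using True by (simp add: divide_inverse mult_ac)
      qed
      then show ?thesis using True by simp
    qed
  qed
  finally show ?thesis .
qed

lemma continuous_on_rectpath_simple_zeros:
  assumes "cbox a b \<subseteq> S" "Re a \<le> Re b" "Im a \<le> Im b"
    and "num holomorphic_on S" "den holomorphic_on S"
    and "P \<subseteq> box a b" "\<And>z. z \<in> S \<Longrightarrow> den z = 0 \<longleftrightarrow> z \<in> P"
  shows "continuous_on (path_image (rectpath a b)) (\<lambda>z. num z / den z)"
proof -
  have sub: "path_image (rectpath a b) \<subseteq> S - P"
    using path_image_rectpath_subset_cbox[OF assms(2,3)] path_image_rectpath_inter_box[OF assms(2,3)] assms by blast
  show ?thesis using sub assms
    by (intro continuous_intros holomorphic_on_imp_continuous_on) (auto intro: holomorphic_on_subset)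
qed

lemma contour_integrable_rectpath_edges:
  assumes "continuous_on (path_image (rectpath a b)) f"
  shows "f contour_integrable_on linepath a (Complex (Re b) (Im a))"
    "f contour_integrable_on linepath (Complex (Re b) (Im a)) b"
    "f contour_integrable_on linepath b (Complex (Re a) (Im b))"
    "f contour_integrable_on linepath (Complex (Re a) (Im b)) a"
proof -
  have pi: "path_image (rectpath a b) = closed_segment a (Complex (Re b) (Im a))
      \<union> closed_segment (Complex (Re b) (Im a)) b \<union> closed_segment b (Complex (Re a) (Im b))
      \<union> closed_segment (Complex (Re a) (Im b)) a"
    by (simp add: rectpath_def Let_def path_image_join Un_assoc)
  show "f contour_integrable_on linepath a (Complex (Re b) (Im a))"
    "f contour_integrable_on linepath (Complex (Re b) (Im a)) b"
    "f contour_integrable_on linepath b (Complex (Re a) (Im b))"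
    "f contour_integrable_on linepath (Complex (Re a) (Im b)) a"
    using assms unfolding pi
    by (auto intro!: contour_integrable_continuous_linepath intro: continuous_on_subset)
qed

lemma contour_integral_rectpath:
  assumes "continuous_on (path_image (rectpath a b)) f"
  shows "contour_integral (rectpath a b) f =
    contour_integral (linepath a (Complex (Re b) (Im a))) f
    + contour_integral (linepath (Complex (Re b) (Im a)) b) f
    + contour_integral (linepath b (Complex (Re a) (Im b))) f
    + contour_integral (linepath (Complex (Re a) (Im b)) a) f"
  using contour_integrable_rectpath_edges[OF assms]
  by (simp add: rectpath_def Let_def contour_integrable_joinI)

lemma contour_integral_rectpath_tendsto:
  assumes "eventually (\<lambda>N. continuous_on (path_image (rectpath (a N) (b N))) f) F"
    and "((\<lambda>N. contour_integral (linepath (a N) (Complex (Re (b N)) (Im (a N)))) f) \<longlongrightarrow> l1) F"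
    and "((\<lambda>N. contour_integral (linepath (Complex (Re (b N)) (Im (a N))) (b N)) f) \<longlongrightarrow> l2) F"
    and "((\<lambda>N. contour_integral (linepath (b N) (Complex (Re (a N)) (Im (b N)))) f) \<longlongrightarrow> l3) F"
    and "((\<lambda>N. contour_integral (linepath (Complex (Re (a N)) (Im (b N))) (a N)) f) \<longlongrightarrow> l4) F"
  shows "((\<lambda>N. contour_integral (rectpath (a N) (b N)) f) \<longlongrightarrow> l1 + l2 + l3 + l4) F"
proof (rule Lim_transform_eventually)
  show "((\<lambda>N. contour_integral (linepath (a N) (Complex (Re (b N)) (Im (a N)))) f
      + contour_integral (linepath (Complex (Re (b N)) (Im (a N))) (b N)) f
      + contour_integral (linepath (b N) (Complex (Re (a N)) (Im (b N)))) f
      + contour_integral (linepath (Complex (Re (a N)) (Im (b N))) (a N)) f) \<longlongrightarrow> l1 + l2 + l3 + l4) F"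
    by (intro tendsto_add assms)
  show "eventually (\<lambda>N. contour_integral (linepath (a N) (Complex (Re (b N)) (Im (a N)))) f
      + contour_integral (linepath (Complex (Re (b N)) (Im (a N))) (b N)) f
      + contour_integral (linepath (b N) (Complex (Re (a N)) (Im (b N)))) f
      + contour_integral (linepath (Complex (Re (a N)) (Im (b N))) (a N)) f = contour_integral (rectpath (a N) (b N)) f) F"
    using assms(1) by eventually_elim (simp add: contour_integral_rectpath)
qed

lemma exp_odd_multiple_pi:
  assumes "s = 1 \<or> s = - 1"
  shows "exp (\<i> * of_real (- (s * (2 * pi * real n + pi)))) = - 1"
proof -
  have "cos (2 * pi * real n + pi) = - 1" "sin (2 * pi * real n + pi) = 0"
    using cos_2npi[of n] sin_2npi[of n] by (simp_all add: mult_ac)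
  then show ?thesis
    using assms by (auto simp: exp_eq_polar complex_eq_iff cos_minus[of "2 * pi * real n + pi", symmetric]
        sin_minus[of "2 * pi * real n + pi", symmetric] simp del: minus_add_distrib)
qed

lemma exp_minus_2pi_i_eq_1_iff: "exp (- (two_pi_i * z)) = 1 \<longleftrightarrow> (\<exists>m::int. z = of_int m)"
proof
  assume "exp (- (two_pi_i * z)) = 1"
  then obtain n :: int where n: "2 * pi * Im z = 0" "- (2 * pi * Re z) = of_int (2 * n) * pi"
    by (auto simp: exp_eq_1)
  have "pi * (Re z + n) = 0" using n(2) by (simp add: algebra_simps)
  hence "z = of_int (- n)" using n(1) by (auto simp: complex_eq_iff)
  then show "\<exists>m::int. z = of_int m" ..
next
  assume "\<exists>m::int. z = of_int m"
  then obtain m :: int where "z = of_int m" ..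
  then show "exp (- (two_pi_i * z)) = 1"
    by (auto simp: exp_eq_1 intro!: exI[of _ "- m"])
qed

section \<open>The kernel with poles at the integers\<close>

locale parity_character = primitive_character +
  fixes e :: real
  assumes parity: "chi (q - 1) = of_real e" and e_sq: "e * e = 1"
begin

sublocale conj: primitive_character q "cnj \<circ> chi" by (rule cnj_primitive)

abbreviation "tau_conj \<equiv> gauss_sum q (cnj \<circ> chi)"

lemma q_pos: "real q > 0" using modulus_gt_1 by simp

definition dual_num :: "complex \<Rightarrow> complex" where
  "dual_num z = (\<Sum>r<q. cnj (chi r) * exp (- (of_nat r * (two_pi_i * z / of_nat q))))"

text \<open>The factor 2 pi i / q moves the poles of \<open>lam\<close> to the integers. The
  conjugate character is taken because separability of its Gauss sum returns \<open>chi\<close>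
  itself there, see \<open>dual_num_int\<close>.\<close>

definition dual_kernel :: "complex \<Rightarrow> complex" where
  "dual_kernel z = lam q (cnj \<circ> chi) (two_pi_i * z / of_nat q)"

lemma dual_kernel_eq: "dual_kernel z = dual_num z / (1 - exp (- (two_pi_i * z)))"
  using modulus_gt_1 by (simp add: dual_kernel_def dual_num_def lam_def)

lemma holomorphic_dual_num: "dual_num holomorphic_on A"
  unfolding dual_num_def using modulus_gt_1 by (intro holomorphic_intros) auto

lemma dual_num_int:
  "dual_num (of_nat n) = of_real e * chi n * tau_conj" "dual_num (- of_nat n) = chi n * tau_conj"
proof -
  have "exp (- (of_nat r * (two_pi_i * of_nat n / of_nat q))) = inverse (unity q (r * n))" for r
    by (simp add: unity_def exp_minus mult_ac)
  moreover have "exp (- (of_nat r * (two_pi_i * - of_nat n / of_nat q))) = unity q (r * n)" for r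
    by (simp add: unity_def mult_ac)
  ultimately show "dual_num (of_nat n) = of_real e * chi n * tau_conj" "dual_num (- of_nat n) = chi n * tau_conj"
    using conj.gauss_sum_separable[of n] conj.gauss_sum_separable_inverse[of n] parity
    unfolding dual_num_def by simp_all
qed

lemma dual_kernel_minus: "dual_kernel (- z) = - of_real e * dual_kernel z"
  using conj.lam_minus[of "two_pi_i * z / of_nat q"] parity by (simp add: dual_kernel_def)

lemma Re_dual_arg: "Re (two_pi_i * z / of_nat q) = - (2 * pi / real q * Im z)"
  by (simp add: Re_divide_of_nat)

text \<open>On vertical lines through half-integers exp (- 2 pi i z) is a negative real number, so
  the bound needs no distance from the real axis.\<close>

lemma norm_dual_kernel_half:
  assumes "Re z = s * (real n + 1 / 2)" "s = 1 \<or> s = - 1"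
  shows "norm (dual_kernel z) \<le> real q * exp (- (2 * pi / real q * \<bar>Im z\<bar>))"
proof -
  have "norm (dual_kernel z) \<le> real q * exp (- \<bar>Re (two_pi_i * z / of_nat q)\<bar>)"
    unfolding dual_kernel_def
  proof (rule conj.norm_lam_le_exp_neg)
    have eq: "- (of_nat q * (two_pi_i * z / of_nat q)) =
         of_real (2 * pi * Im z) + \<i> * of_real (- (s * (2 * pi * real n + pi)))"
      using modulus_gt_1 assms(1) by (simp add: complex_eq_iff algebra_simps)
    have "exp (\<i> * of_real (- (s * (2 * pi * real n + pi)))) = - 1"
      using assms(2) by (rule exp_odd_multiple_pi)
    moreover have "real q * Re (two_pi_i * z / of_nat q) = - (2 * pi * Im z)"
      using modulus_gt_1 by (simp add: Re_divide_of_nat)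
    ultimately show "exp (- (of_nat q * (two_pi_i * z / of_nat q)))
        = - of_real (exp (- (real q * Re (two_pi_i * z / of_nat q))))"
      unfolding eq exp_add by (simp only: exp_of_real mult_minus_right mult_1_right minus_minus)
  qed
  then show ?thesis unfolding Re_dual_arg using q_pos by (simp add: abs_mult)
qed

lemma norm_dual_kernel_far:
  assumes "d \<le> 2 * pi / real q * \<bar>Im z\<bar>" "d > 0"
  shows "norm (dual_kernel z) \<le> real q / (1 - exp (- d)) * exp (- (2 * pi / real q * \<bar>Im z\<bar>))"
proof -
  have re: "\<bar>Re (two_pi_i * z / of_nat q)\<bar> = 2 * pi / real q * \<bar>Im z\<bar>"
    unfolding Re_dual_arg using q_pos by (simp add: abs_mult)
  show ?thesis
    using conj.norm_lam_le_far[of d "two_pi_i * z / of_nat q"] assms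
    unfolding re dual_kernel_def by blast
qed

end

section \<open>Residues of a product of two generating functions\<close>

lemma norm_contour_integral_rectpath_le:
  assumes cont: "continuous_on (path_image (rectpath a b)) f" and ab: "Re a \<le> Re b" "Im a \<le> Im b"
    and hor: "\<And>z. Im z = Im a \<or> Im z = Im b \<Longrightarrow> Re z \<in> {Re a..Re b} \<Longrightarrow> norm (f z) \<le> B1"
    and ver: "\<And>z. Re z = Re a \<or> Re z = Re b \<Longrightarrow> Im z \<in> {Im a..Im b} \<Longrightarrow> norm (f z) \<le> B2"
  shows "norm (contour_integral (rectpath a b) f) \<le> 2 * B1 * (Re b - Re a) + 2 * B2 * (Im b - Im a)"
proof -
  let ?a2 = "Complex (Re b) (Im a)" and ?a4 = "Complex (Re a) (Im b)"
  note int = contour_integrable_rectpath_edges[OF cont]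
  have B1: "0 \<le> B1" using hor[of a] ab by (auto intro: order_trans[OF norm_ge_zero])
  have B2: "0 \<le> B2" using ver[of a] ab by (auto intro: order_trans[OF norm_ge_zero])
  have n1: "norm (?a2 - a) = Re b - Re a" "norm (b - ?a2) = Im b - Im a"
           "norm (?a4 - b) = Re b - Re a" "norm (a - ?a4) = Im b - Im a"
    using ab by (simp_all add: cmod_def)
  have s1: "closed_segment a ?a2 = {z. Re z \<in> {Re a..Re b} \<and> Im z = Im a}"
    using closed_segment_same_Im[of a ?a2] ab by (auto simp add: closed_segment_eq_real_ivl)
  have s2: "closed_segment ?a2 b = {z. Re z = Re b \<and> Im z \<in> {Im a..Im b}}"
    using closed_segment_same_Re[of ?a2 b] ab by (auto simp add: closed_segment_eq_real_ivl)
  have s3: "closed_segment b ?a4 = {z. Re z \<in> {Re a..Re b} \<and> Im z = Im b}"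
    using closed_segment_same_Im[of b ?a4] ab by (auto simp add: closed_segment_eq_real_ivl)
  have s4: "closed_segment ?a4 a = {z. Re z = Re a \<and> Im z \<in> {Im a..Im b}}"
    using closed_segment_same_Re[of ?a4 a] ab by (auto simp add: closed_segment_eq_real_ivl)
  have i: "norm (contour_integral (linepath a ?a2) f) \<le> B1 * (Re b - Re a)"
    using contour_integral_bound_linepath[OF int(1) B1] hor unfolding s1 n1 by auto
  have ii: "norm (contour_integral (linepath ?a2 b) f) \<le> B2 * (Im b - Im a)"
    using contour_integral_bound_linepath[OF int(2) B2] ver unfolding s2 n1 by auto
  have iii: "norm (contour_integral (linepath b ?a4) f) \<le> B1 * (Re b - Re a)"
    using contour_integral_bound_linepath[OF int(3) B1] hor unfolding s3 n1 by auto
  have iv: "norm (contour_integral (linepath ?a4 a) f) \<le> B2 * (Im b - Im a)"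
    using contour_integral_bound_linepath[OF int(4) B2] ver unfolding s4 n1 by auto
  have tri: "norm (u + v + s + t) \<le> norm u + norm v + norm s + norm t" for u v s t :: complex
    using norm_triangle_ineq[of "u + v + s" t] norm_triangle_ineq[of "u + v" s] norm_triangle_ineq[of u v]
    by linarith
  show ?thesis
    unfolding contour_integral_rectpath[OF cont]
    by (rule order_trans[OF tri]) (use i ii iii iv in linarith)
qed

lemma linear_times_exp_neg_tendsto_0:
  fixes A B c :: real
  assumes "c > 0"
  shows "(\<lambda>N. (A + B * real N) * exp (- (c * real N))) \<longlonglongrightarrow> 0"
proof -
  have e: "exp (- (c * real N)) = exp (- c) ^ N" for N
    by (simp add: exp_of_nat_mult [symmetric] mult.commute)
  have "(\<lambda>N. exp (- c) ^ N) \<longlonglongrightarrow> 0" "(\<lambda>N. real N * exp (- c) ^ N) \<longlonglongrightarrow> 0"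
    using assms by (auto intro!: LIMSEQ_realpow_zero powser_times_n_limit_0)
  hence "(\<lambda>N. A * exp (- c) ^ N + B * (real N * exp (- c) ^ N)) \<longlonglongrightarrow> A * 0 + B * 0"
    by (intro tendsto_add tendsto_mult_left)
  then show ?thesis unfolding e by (simp add: algebra_simps)
qed

lemma sum_from_1_eq:
  fixes g :: "nat \<Rightarrow> 'a :: comm_monoid_add"
  assumes "g 0 = 0" shows "(\<Sum>n=1..K. g n) = (\<Sum>n<Suc K. g n)"
proof -
  have "{..<Suc K} = insert 0 {1..K}" by auto
  then show ?thesis using assms by simp
qed

lemma sum_int_symmetric:
  fixes g :: "int \<Rightarrow> 'a :: ab_group_add"
  shows "(\<Sum>m\<in>{- int M..int M}. g m) = g 0 + (\<Sum>m=1..M. g (int m) + g (- int m))"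
proof (induction M)
  case (Suc M)
  have "{- int (Suc M)..int (Suc M)} = insert (int (Suc M)) (insert (- int (Suc M)) {- int M..int M})"
    by auto
  then show ?case using Suc by (simp add: algebra_simps)
qed auto

lemma abs_of_int_less_iff:
  assumes "0 < c" "c < 1"
  shows "\<bar>real_of_int m\<bar> < real K + c \<longleftrightarrow> m \<in> {- int K..int K}"
proof -
  have "\<bar>real_of_int m\<bar> < real K + c \<longleftrightarrow> \<bar>m\<bar> \<le> int K"
  proof
    assume "\<bar>real_of_int m\<bar> < real K + c"
    hence "real_of_int \<bar>m\<bar> < real_of_int (int K + 1)" using assms by simp
    then show "\<bar>m\<bar> \<le> int K" by (simp only: of_int_less_iff)
  next
    assume "\<bar>m\<bar> \<le> int K"
    hence "real_of_int \<bar>m\<bar> \<le> real_of_int (int K)" by (simp only: of_int_le_iff)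
    then show "\<bar>real_of_int m\<bar> < real K + c" using assms by simp
  qed
  then show ?thesis by auto
qed

text \<open>Both characters share the sign \<open>e\<close>, their value at -1. Even and odd pairs
  thus go through the same calculation, in which only \<open>e * e = 1\<close> matters.\<close>

locale character_pair =
  c1: parity_character p chi1 e + c2: parity_character q chi2 e
  for p q :: nat and chi1 chi2 :: "nat \<Rightarrow> complex" and e :: real
begin

lemmas parity = c1.parity c2.parity and e_sq = c1.e_sq

abbreviation "tau1 \<equiv> gauss_sum p chi1"
abbreviation "tau2 \<equiv> gauss_sum q chi2"
abbreviation "tau2c \<equiv> gauss_sum q (cnj \<circ> chi2)"

lemma p_pos: "real p > 0" and q_pos: "real q > 0"
  using c1.modulus_gt_1 c2.modulus_gt_1 by simp_all

abbreviation "num2 \<equiv> c2.dual_num"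
abbreviation "ker2 \<equiv> c2.dual_kernel"

definition num1 :: "complex \<Rightarrow> complex" where
  "num1 w = (\<Sum>r<p. chi1 r * exp (- (of_nat r * w)))"

lemmas num2_int = c2.dual_num_int

lemma num1_int:
  "num1 (two_pi_i * of_nat n / of_nat p) = of_real e * cnj (chi1 n) * tau1"
  "num1 (- (two_pi_i * of_nat n / of_nat p)) = cnj (chi1 n) * tau1"
proof -
  have "exp (- (of_nat r * (two_pi_i * of_nat n / of_nat p))) = inverse (unity p (r * n))" for r
    by (simp add: unity_def exp_minus mult_ac)
  moreover have "exp (- (of_nat r * - (two_pi_i * of_nat n / of_nat p))) = unity p (r * n)" for r
    by (simp add: unity_def mult_ac)
  ultimately show "num1 (two_pi_i * of_nat n / of_nat p) = of_real e * cnj (chi1 n) * tau1"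
    "num1 (- (two_pi_i * of_nat n / of_nat p)) = cnj (chi1 n) * tau1"
    using c1.gauss_sum_separable[of n] c1.gauss_sum_separable_inverse[of n] parity
    unfolding num1_def by simp_all
qed

context
  fixes y w :: real
  assumes y: "y > 0" and w: "w > 0" "w < y / 2"
begin

abbreviation "arg1 z \<equiv> z * of_real y + of_real w"

definition kernel :: "complex \<Rightarrow> complex" where
  "kernel z = lam p chi1 (arg1 z) * ker2 z"

definition den :: "complex \<Rightarrow> complex" where
  "den z = (1 - exp (- (of_nat p * (arg1 z)))) * (1 - exp (- (two_pi_i * z)))"

text \<open>These are the zeros of the first denominator factor. Since 0 < w < y / 2, they lie on a
  vertical line strictly between -1/2 and 0 and never meet the integers, the zeros of the second
  factor; so all zeros of \<open>den\<close> are simple.\<close>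

definition pole :: "int \<Rightarrow> complex" where
  "pole n = (two_pi_i * of_int n / of_nat p - of_real w) / of_real y"

lemma kernel_eq: "kernel z = num1 (arg1 z) * num2 z / den z"
  by (simp add: kernel_def num1_def c2.dual_kernel_eq den_def lam_def)

lemma pole_Re_Im: "Re (pole n) = - w / y" "Im (pole n) = 2 * pi * of_int n / (real p * y)"
  by (simp_all add: pole_def Re_divide Im_divide power2_eq_square)

lemma den1_eq_0_iff:
  "exp (- (of_nat p * (arg1 z))) = 1 \<longleftrightarrow> (\<exists>n::int. z = pole n)"
proof
  assume "exp (- (of_nat p * (arg1 z))) = 1"
  then obtain n :: int where n: "real p * (Re z * y + w) = 0" "- (real p * (Im z * y)) = of_int (2 * n) * pi"
    by (auto simp: exp_eq_1)
  have "Re z = - w / y" using n(1) p_pos y by (intro eq_divide_imp) auto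
  moreover have "Im z = - (2 * pi * of_int n) / (real p * y)"
    using n(2) p_pos y by (intro eq_divide_imp) (auto simp: algebra_simps)
  ultimately have "z = pole (- n)"
    by (simp add: complex_eq_iff pole_Re_Im)
  then show "\<exists>n::int. z = pole n" ..
next
  assume "\<exists>n::int. z = pole n"
  then obtain n :: int where n: "z = pole n" ..
  have "of_nat p * (arg1 z) = two_pi_i * of_int n"
    using y p_pos unfolding n pole_def by simp
  then show "exp (- (of_nat p * (arg1 z))) = 1"
    by (auto simp: exp_eq_1 intro!: exI[of _ "- n"])
qed

lemma pole_neq_int: "pole n \<noteq> of_int m"
proof
  assume "pole n = of_int m"
  hence "- w / y = of_int m" using pole_Re_Im(1)[of n] by simp
  moreover have "- 1 < - w / y" "- w / y < 0" using y w by (simp_all add: field_simps)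
  ultimately have "- 1 < real_of_int m" "real_of_int m < 0" by simp_all
  hence "- 1 < m" "m < 0"
    using of_int_less_iff[of "- 1" m, where 'a = real] by auto
  then show False by simp
qed

lemma inj_pole: "inj pole"
  using y p_pos by (intro injI) (auto simp: pole_def)

text \<open>The vertical edges run through half-integers. As T = 2 pi (p N + 1/2) / (p y), the
  horizontal edges run midway between two consecutive members of the other family of poles. The
  rectangle therefore contains exactly the integers up to q N and the poles up to index p N in
  absolute value.\<close>

lemma contour_integral_kernel:
  fixes N :: nat
  defines "T \<equiv> (2 * pi * real N + pi / real p) / y"
  defines "X \<equiv> real q * real N + 1 / 2"
  shows "contour_integral (rectpath (Complex (- X) (- T)) (Complex X T)) kernel
    = 2 * pi * \<i> * ((\<Sum>m\<in>{- int (q * N)..int (q * N)}.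
            lam p chi1 (of_int m * of_real y + of_real w) * num2 (of_int m) / two_pi_i)
        + (\<Sum>n\<in>{- int (p * N)..int (p * N)}.
            num1 (two_pi_i * of_int n / of_nat p) / (of_nat p * of_real y)
            * ker2 (pole n)))" (is ?residues)
    and "continuous_on (path_image (rectpath (Complex (- X) (- T)) (Complex X T))) kernel"
proof -
  \<comment> \<open>An open box slightly larger than the rectangle, reaching to p N + 3/4 and q N +
    3/4 in units of the two pole spacings, so that it contains the same poles.\<close>
  define T' where "T' = (2 * pi * real N + 3 * pi / (2 * real p)) / y"
  define S where "S = box (Complex (- (X + 1/4)) (- T')) (Complex (X + 1/4) T')"
  define A where "A = (of_int ` {- int (q * N)..int (q * N)} :: complex set)"
  define B where "B = pole ` {- int (p * N)..int (p * N)}"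
  \<comment> \<open>The product rule; at each zero of \<open>den\<close> one factor vanishes and
    only one summand survives, see \<open>den'A\<close> and \<open>den'B\<close>.\<close>
  define den' where "den' = (\<lambda>z. (of_nat p * of_real y * exp (- (of_nat p * (arg1 z)))) * (1 - exp (- (two_pi_i * z)))
      + (two_pi_i * exp (- (two_pi_i * z))) * (1 - exp (- (of_nat p * (arg1 z)))))"
  have "T < T'" using y p_pos by (simp add: T_def T'_def field_simps)
  have "T > 0" using y p_pos by (simp add: T_def add_nonneg_pos)
  have "X > 0" by (simp add: X_def add_nonneg_pos)
  have AB: "A \<inter> B = {}" using pole_neq_int by (auto simp: A_def B_def) (metis pole_neq_int)
  have inA: "of_int m \<in> S \<longleftrightarrow> m \<in> {- int (q * N)..int (q * N)}" for m
  proof -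
    have "of_int m \<in> S \<longleftrightarrow> \<bar>real_of_int m\<bar> < real (q * N) + 3 / 4"
      using \<open>T < T'\<close> \<open>T > 0\<close> by (auto simp: S_def in_box_complex_iff X_def)
    also have "\<dots> \<longleftrightarrow> m \<in> {- int (q * N)..int (q * N)}" by (rule abs_of_int_less_iff) auto
    finally show ?thesis .
  qed
  have inB: "pole n \<in> S \<longleftrightarrow> n \<in> {- int (p * N)..int (p * N)}" for n
  proof -
    have "\<bar>Re (pole n)\<bar> < 1 / 2" using y w by (simp add: pole_Re_Im field_simps)
    moreover have "1 / 2 \<le> X" by (simp add: X_def)
    ultimately have "pole n \<in> S \<longleftrightarrow> \<bar>Im (pole n)\<bar> < T'"
      unfolding S_def in_box_complex_iff by auto
    also have "Im (pole n) = 2 * pi * of_int n / (real p * y)" by (rule pole_Re_Im)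
    also have "\<bar>2 * pi * of_int n / (real p * y)\<bar> = 2 * pi / (real p * y) * \<bar>of_int n\<bar>"
      using y p_pos by (simp add: abs_mult)
    also have "T' = 2 * pi / (real p * y) * (real (p * N) + 3 / 4)"
      using y p_pos by (simp add: T'_def field_simps)
    also have "2 * pi / (real p * y) * \<bar>of_int n\<bar> < 2 * pi / (real p * y) * (real (p * N) + 3 / 4)
        \<longleftrightarrow> \<bar>real_of_int n\<bar> < real (p * N) + 3 / 4"
      using y p_pos by (intro mult_less_cancel_left_pos) simp
    also have "\<dots> \<longleftrightarrow> n \<in> {- int (p * N)..int (p * N)}" by (rule abs_of_int_less_iff) auto
    finally show ?thesis .
  qed
  have Asub: "A \<subseteq> box (Complex (- X) (- T)) (Complex X T)"
  proof -
    have "\<bar>real_of_int m\<bar> < X" if "m \<in> {- int (q * N)..int (q * N)}" for m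
      using abs_of_int_less_iff[of "1/2" m "q * N"] that by (simp add: X_def)
    then show ?thesis using \<open>T > 0\<close> by (force simp: A_def in_box_complex_iff)
  qed
  have Bsub: "B \<subseteq> box (Complex (- X) (- T)) (Complex X T)"
  proof -
    have "pole n \<in> box (Complex (- X) (- T)) (Complex X T)" if "n \<in> {- int (p * N)..int (p * N)}" for n
    proof -
      have "\<bar>real_of_int n\<bar> < real (p * N) + 1/2" using that by (subst abs_of_int_less_iff) auto
      hence "2 * pi / (real p * y) * \<bar>of_int n\<bar> < 2 * pi / (real p * y) * (real (p * N) + 1 / 2)"
        using y p_pos by (intro mult_strict_left_mono) auto
      also have "\<dots> = T" using y p_pos by (simp add: T_def field_simps)
      finally have "\<bar>Im (pole n)\<bar> < T"
        using y p_pos by (simp add: abs_mult pole_Re_Im)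
      moreover have "\<bar>Re (pole n)\<bar> < 1 / 2" using y w by (simp add: pole_Re_Im field_simps)
      moreover have "1 / 2 \<le> X" by (simp add: X_def)
      ultimately show ?thesis
        unfolding in_box_complex_iff by auto
    qed
    then show ?thesis by (auto simp: B_def)
  qed
  have deriv: "(den has_field_derivative den' z) (at z)" for z
    unfolding den_def den'_def by (auto intro!: derivative_eq_intros simp: algebra_simps)
  have den'A: "den' (of_int m) = two_pi_i * (1 - exp (- (of_nat p * (of_int m * of_real y + of_real w))))" for m
  proof -
    have "exp (- (two_pi_i * of_int m)) = 1" using exp_minus_2pi_i_eq_1_iff by blast
    then show ?thesis by (simp add: den'_def)
  qed
  have den'B: "den' (pole n) = of_nat p * of_real y * (1 - exp (- (two_pi_i * pole n)))" for n
  proof -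
    have "exp (- (of_nat p * (pole n * of_real y + of_real w))) = 1" using den1_eq_0_iff by blast
    then show ?thesis by (simp add: den'_def)
  qed
  have Ssub: "cbox (Complex (- X) (- T)) (Complex X T) \<subseteq> S"
    using \<open>T < T'\<close> by (auto simp: S_def in_box_complex_iff in_cbox_complex_iff)
  have ABsub: "A \<union> B \<subseteq> box (Complex (- X) (- T)) (Complex X T)" using Asub Bsub by blast
  have zeros: "den z = 0 \<longleftrightarrow> z \<in> A \<union> B" if "z \<in> S" for z
  proof -
    have "den z = 0 \<longleftrightarrow> (\<exists>n::int. z = pole n) \<or> (\<exists>m::int. z = of_int m)"
      unfolding den_def mult_eq_0_iff right_minus_eq
      using den1_eq_0_iff[of z] exp_minus_2pi_i_eq_1_iff[of z] by metis
    also have "\<dots> \<longleftrightarrow> z \<in> A \<union> B" using that inA inB by (auto simp: A_def B_def)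
    finally show ?thesis .
  qed
  have kernel_fun: "(\<lambda>z. num1 (arg1 z) * num2 z / den z) = kernel"
    by (simp add: kernel_eq fun_eq_iff)
  have num: "(\<lambda>z. num1 (arg1 z) * num2 z) holomorphic_on S"
    unfolding num1_def by (intro holomorphic_intros c2.holomorphic_dual_num)
  have den: "den holomorphic_on S" unfolding den_def by (auto intro!: holomorphic_intros)
  show "continuous_on (path_image (rectpath (Complex (- X) (- T)) (Complex X T))) kernel"
    unfolding kernel_fun[symmetric] using \<open>T > 0\<close> \<open>X > 0\<close>
    by (intro continuous_on_rectpath_simple_zeros[OF Ssub _ _ num den ABsub zeros]) auto
  have "contour_integral (rectpath (Complex (- X) (- T)) (Complex X T))
          (\<lambda>z. num1 (arg1 z) * num2 z / den z)
    = 2 * pi * \<i> * (\<Sum>z\<in>A \<union> B. num1 (arg1 z) * num2 z / den' z)"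
  proof (rule contour_integral_rectpath_simple_zeros[where S = S])
    show "open S" "connected S" by (auto simp: S_def open_box convex_connected)
    show "cbox (Complex (- X) (- T)) (Complex X T) \<subseteq> S"
      by (rule Ssub)
    show "Re (Complex (- X) (- T)) < Re (Complex X T)" "Im (Complex (- X) (- T)) < Im (Complex X T)"
      using \<open>T > 0\<close> \<open>X > 0\<close> by auto
    show "(\<lambda>z. num1 (arg1 z) * num2 z) holomorphic_on S" by (rule num)
    show "den holomorphic_on S" by (rule den)
    show "finite (A \<union> B)" by (auto simp: A_def B_def)
    show "A \<union> B \<subseteq> box (Complex (- X) (- T)) (Complex X T)" using Asub Bsub by blast
    show "den z = 0 \<longleftrightarrow> z \<in> A \<union> B" if "z \<in> S" for z using that by (rule zeros)
    show "(den has_field_derivative den' z) (at z)" for z by (rule deriv)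
    show "den' z \<noteq> 0" if "z \<in> A \<union> B" for z
    proof -
      have "(\<exists>m::int. z = of_int m) \<or> (\<exists>n. z = pole n)" using that by (auto simp: A_def B_def)
      then consider m :: int where "z = of_int m" | n where "z = pole n" by blast
      then show ?thesis
      proof cases
        case 1
        have "exp (- (of_nat p * (arg1 z))) \<noteq> 1"
          unfolding den1_eq_0_iff using 1 by (metis pole_neq_int)
        then show ?thesis unfolding 1 den'A by simp
      next
        case 2
        have "exp (- (two_pi_i * z)) \<noteq> 1"
          unfolding exp_minus_2pi_i_eq_1_iff using 2 by (metis pole_neq_int)
        then show ?thesis unfolding 2 den'B using y p_pos by simp
      qed
    qed
  qed
  also note kernel_fun
  also have "(\<Sum>z\<in>A \<union> B. num1 (arg1 z) * num2 z / den' z) =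
      (\<Sum>z\<in>A. num1 (arg1 z) * num2 z / den' z) + (\<Sum>z\<in>B. num1 (arg1 z) * num2 z / den' z)"
    using AB by (intro sum.union_disjoint) (auto simp: A_def B_def)
  also have "(\<Sum>z\<in>A. num1 (arg1 z) * num2 z / den' z) = (\<Sum>m\<in>{- int (q * N)..int (q * N)}.
            lam p chi1 (of_int m * of_real y + of_real w) * num2 (of_int m) / two_pi_i)"
    unfolding A_def by (subst sum.reindex) (auto simp: inj_on_def den'A lam_def num1_def mult_ac)
  also have "(\<Sum>z\<in>B. num1 (arg1 z) * num2 z / den' z) = (\<Sum>n\<in>{- int (p * N)..int (p * N)}.
            num1 (two_pi_i * of_int n / of_nat p) / (of_nat p * of_real y)
            * ker2 (pole n))"
  proof -
    have "pole n * of_real y + of_real w = two_pi_i * of_int n / of_nat p" for n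
      using y by (simp add: pole_def)
    then show ?thesis
      unfolding B_def by (subst sum.reindex) (auto simp: inj_on_subset[OF inj_pole] den'B c2.dual_kernel_eq)
  qed
  finally show ?residues .
qed

text \<open>On each pair of edges one factor is bounded, because the edge passes halfway between its
  poles, while the other one decays exponentially: \<open>ker2\<close> on the horizontal edges, the
  factor of \<open>chi1\<close> on the vertical ones. The edge lengths grow only linearly in
  N.\<close>

lemma contour_integral_kernel_tendsto_0:
  defines "T \<equiv> \<lambda>N::nat. (2 * pi * real N + pi / real p) / y"
  defines "X \<equiv> \<lambda>N::nat. real q * real N + 1 / 2"
  shows "(\<lambda>N. contour_integral (rectpath (Complex (- X N) (- T N)) (Complex (X N) (T N))) kernel) \<longlonglongrightarrow> 0"
proof -
  \<comment> \<open>The numbers y / 2 - w and \<open>d2\<close> are the values at N = 0 of the lower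
    bounds on the real parts in the two \<open>lam\<close> factors; \<open>b2\<close> and q y are
    the rates at which these bounds grow with N.\<close>
  define C1 where "C1 = real p / (1 - exp (- (y / 2 - w)))"
  define d2 where "d2 = 2 * pi * (pi / real p / y) / real q"
  define C2 where "C2 = real q / (1 - exp (- d2))"
  define b2 where "b2 = 4 * pi\<^sup>2 / (real q * y)"
  have d2: "d2 > 0" using p_pos q_pos y by (simp add: d2_def)
  have C1: "C1 \<ge> 0" using w p_pos by (simp add: C1_def)
  have C2: "C2 \<ge> 0" using d2 q_pos by (simp add: C2_def)
  have T0: "T N \<ge> 0" for N using y p_pos by (simp add: T_def)
  have X0: "X N \<ge> 0" for N by (simp add: X_def)
  have hor: "norm (kernel z) \<le> real p * (C2 * exp (- (b2 * real N)))" if "\<bar>Im z\<bar> = T N" for z N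
  proof -
    define s where "s = sgn (Im z)"
    have "T N > 0" using y p_pos by (auto simp: T_def intro!: divide_pos_pos add_nonneg_pos)
    hence s: "Im z = s * T N" "s = 1 \<or> s = - 1" using that by (auto simp: s_def sgn_if abs_if split: if_splits)
    have "norm (lam p chi1 (arg1 z)) \<le> real p * exp (- \<bar>Re (arg1 z)\<bar>)"
    proof (rule c1.norm_lam_le_exp_neg)
      have "real p * (Im z * y) = s * (2 * pi * real (p * N) + pi)"
        using y p_pos unfolding s T_def by (simp add: field_simps)
      hence eq: "- (of_nat p * (arg1 z)) =
           of_real (- (real p * Re (arg1 z))) + \<i> * of_real (- (s * (2 * pi * real (p * N) + pi)))"
        by (simp add: complex_eq_iff)
      have "exp (\<i> * of_real (- (s * (2 * pi * real (p * N) + pi)))) = - 1"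
        using s(2) by (rule exp_odd_multiple_pi)
      then show "exp (- (of_nat p * (arg1 z))) = - of_real (exp (- (real p * Re (arg1 z))))"
        unfolding eq exp_add by (simp only: exp_of_real mult_minus_right mult_1_right)
    qed
    also have "\<dots> \<le> real p" using p_pos by simp
    finally have l1: "norm (lam p chi1 (arg1 z)) \<le> real p" .
    have T: "2 * pi / real q * T N = b2 * real N + d2"
      using y p_pos q_pos by (simp add: T_def b2_def d2_def field_simps power2_eq_square)
    have "b2 \<ge> 0" using y q_pos by (simp add: b2_def)
    have "norm (ker2 z) \<le> C2 * exp (- (2 * pi / real q * \<bar>Im z\<bar>))"
      unfolding C2_def
    proof (rule c2.norm_dual_kernel_far)
      show "d2 \<le> 2 * pi / real q * \<bar>Im z\<bar>"
        unfolding that T using \<open>b2 \<ge> 0\<close> by simp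
    qed (rule d2)
    also have "\<dots> \<le> C2 * exp (- (b2 * real N))"
      unfolding that T using C2 d2 by (intro mult_left_mono) auto
    finally show ?thesis unfolding kernel_def norm_mult by (intro mult_mono l1) auto
  qed
  have ver: "norm (kernel z) \<le> C1 * exp (- (real q * y * real N)) * real q" if "\<bar>Re z\<bar> = X N" for z N
  proof -
    define s where "s = sgn (Re z)"
    have "X N > 0" by (simp add: X_def add_nonneg_pos)
    hence s: "Re z = s * X N" "s = 1 \<or> s = - 1" using that by (auto simp: s_def sgn_if abs_if split: if_splits)
    have "norm (ker2 z) \<le> real q * exp (- (2 * pi / real q * \<bar>Im z\<bar>))"
      using s by (intro c2.norm_dual_kernel_half[where s = s and n = "q * N"]) (auto simp: X_def)
    also have "\<dots> \<le> real q" using q_pos by simp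
    finally have l2: "norm (ker2 z) \<le> real q" .
    have "X N * y - w \<le> \<bar>Re (arg1 z)\<bar>"
      using s w by auto
    moreover have "X N * y - w = real q * y * real N + (y / 2 - w)" by (simp add: X_def algebra_simps)
    ultimately have re: "real q * y * real N + (y / 2 - w) \<le> \<bar>Re (arg1 z)\<bar>" by simp
    have "norm (lam p chi1 (arg1 z)) \<le> C1 * exp (- \<bar>Re (arg1 z)\<bar>)"
      unfolding C1_def
    proof (rule c1.norm_lam_le_far)
      have "0 \<le> real q * y * real N" using y by simp
      then show "y / 2 - w \<le> \<bar>Re (arg1 z)\<bar>" using re by linarith
    qed (use w in auto)
    also have "\<dots> \<le> C1 * exp (- (real q * y * real N))"
      using C1 re w by (intro mult_left_mono) auto
    finally show ?thesis unfolding kernel_def norm_mult using C1 by (intro mult_mono l2) auto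
  qed
  define bd where "bd = (\<lambda>N. (2 * real p * C2 + 4 * real p * C2 * real q * real N) * exp (- (b2 * real N))
       + (4 * C1 * real q * (pi / real p / y) + 4 * C1 * real q * (2 * pi / y) * real N) * exp (- (real q * y * real N)))"
  have bound: "norm (contour_integral (rectpath (Complex (- X N) (- T N)) (Complex (X N) (T N))) kernel)
     \<le> bd N" for N
  proof -
    have "norm (contour_integral (rectpath (Complex (- X N) (- T N)) (Complex (X N) (T N))) kernel)
     \<le> 2 * (real p * (C2 * exp (- (b2 * real N)))) * (Re (Complex (X N) (T N)) - Re (Complex (- X N) (- T N)))
       + 2 * (C1 * exp (- (real q * y * real N)) * real q) * (Im (Complex (X N) (T N)) - Im (Complex (- X N) (- T N)))"
    proof (rule norm_contour_integral_rectpath_le)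
      show "continuous_on (path_image (rectpath (Complex (- X N) (- T N)) (Complex (X N) (T N)))) kernel"
        unfolding X_def T_def by (rule contour_integral_kernel(2))
    qed (use X0[of N] T0[of N] hor[of _ N] ver[of _ N] in auto)
    also have "\<dots> = bd N"
      by (simp add: bd_def X_def T_def add_divide_distrib algebra_simps)
    finally show ?thesis .
  qed
  show ?thesis
  proof (rule Lim_null_comparison[OF always_eventually])
    show "\<forall>N. norm (contour_integral (rectpath (Complex (- X N) (- T N)) (Complex (X N) (T N))) kernel)
     \<le> bd N"
      using bound by blast
    have "b2 > 0" using y q_pos by (simp add: b2_def)
    moreover have "real q * y > 0" using y q_pos by simp
    ultimately show "bd \<longlonglongrightarrow> 0"
      unfolding bd_def
      by (intro tendsto_add_zero linear_times_exp_neg_tendsto_0)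
  qed
qed

text \<open>The residues of \<open>kernel\<close> at n and -n taken together. Reflection by
  \<open>lam_minus\<close> brings both arguments into the right half-plane for n > 0, where
  \<open>lam\<close> is given by its series.\<close>

definition U :: "nat \<Rightarrow> complex" where
  "U n = of_real e * tau2c / two_pi_i * (chi2 n * (lam p chi1 (of_nat n * of_real y + of_real w)
     - lam p chi1 (of_nat n * of_real y - of_real w)))"

text \<open>The same for the residues at \<open>pole n\<close> and \<open>pole (- n)\<close>. The
  two reflections contribute \<open>e * e\<close>, so no sign of the parity remains.\<close>

definition V :: "nat \<Rightarrow> complex" where
  "V n = tau1 / (of_nat p * of_real y) * (cnj (chi1 n) *
     (lam q (cnj \<circ> chi2) (of_nat n * of_real (4 * pi\<^sup>2 / (real p * real q * y)) - \<i> * of_real (2 * pi * w / (real q * y)))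
     - lam q (cnj \<circ> chi2) (of_nat n * of_real (4 * pi\<^sup>2 / (real p * real q * y)) + \<i> * of_real (2 * pi * w / (real q * y)))))"

lemma UV_tendsto_0: "(\<lambda>N. (\<Sum>n=1..q*N. U n) + (\<Sum>n=1..p*N. V n)) \<longlonglongrightarrow> 0"
proof -
  define RA where "RA = (\<lambda>m::int. lam p chi1 (of_int m * of_real y + of_real w) * num2 (of_int m) / two_pi_i)"
  define RB where "RB = (\<lambda>n::int. num1 (two_pi_i * of_int n / of_nat p) / (of_nat p * of_real y)
            * ker2 (pole n))"
  have e2: "of_real e * of_real e = (1 :: complex)" using e_sq by (metis of_real_1 of_real_mult)
  \<comment> \<open>The origin and \<open>pole 0\<close> contribute nothing, since both characters
    vanish at 0. Otherwise the modular equation would acquire extra terms.\<close>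
  have A0: "RA 0 = 0" using num2_int(1)[of 0] by (simp add: RA_def)
  have B0: "RB 0 = 0" using num1_int(1)[of 0] by (simp add: RB_def)
  have A: "RA (int n) + RA (- int n) = U n" for n
  proof -
    have "lam p chi1 (- of_nat n * of_real y + of_real w) = - of_real e * lam p chi1 (of_nat n * of_real y - of_real w)"
      using c1.lam_minus[of "of_nat n * of_real y - of_real w"] parity by simp
    then show ?thesis
      unfolding RA_def U_def using num2_int[of n] by (simp add: field_simps)
  qed
  have B: "RB (int n) + RB (- int n) = V n" for n
  proof -
    have 1: "two_pi_i * pole (int n) / of_nat q =
        - (of_nat n * of_real (4 * pi\<^sup>2 / (real p * real q * y)) + \<i> * of_real (2 * pi * w / (real q * y)))"
      using p_pos q_pos y by (simp add: pole_def field_simps power2_eq_square)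
    have 2: "two_pi_i * pole (- int n) / of_nat q =
        of_nat n * of_real (4 * pi\<^sup>2 / (real p * real q * y)) - \<i> * of_real (2 * pi * w / (real q * y))"
      using p_pos q_pos y by (simp add: pole_def field_simps power2_eq_square)
    have 3: "num1 (two_pi_i * of_int (- int n) / of_nat p) = cnj (chi1 n) * tau1"
      using num1_int(2)[of n] by simp
    have 4: "num1 (two_pi_i * of_int (int n) / of_nat p) = of_real e * cnj (chi1 n) * tau1"
      using num1_int(1)[of n] by simp
    have 5: "lam q (cnj \<circ> chi2) (- w) = - of_real e * lam q (cnj \<circ> chi2) w" for w
      using c2.conj.lam_minus[of w] parity by simp
    have "RB (int n) = - (of_real e * of_real e) * (cnj (chi1 n) * tau1 / (of_nat p * of_real y) *
       lam q (cnj \<circ> chi2) (of_nat n * of_real (4 * pi\<^sup>2 / (real p * real q * y)) + \<i> * of_real (2 * pi * w / (real q * y))))"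
      unfolding RB_def c2.dual_kernel_def 1 4 5 by simp
    then show ?thesis unfolding e2 V_def RB_def c2.dual_kernel_def 2 3 by (simp add: algebra_simps)
  qed
  have eq: "(\<Sum>n=1..q*N. U n) + (\<Sum>n=1..p*N. V n) =
    contour_integral (rectpath (Complex (- (real q * real N + 1 / 2)) (- ((2 * pi * real N + pi / real p) / y)))
      (Complex (real q * real N + 1 / 2) ((2 * pi * real N + pi / real p) / y))) kernel / two_pi_i" for N
    unfolding contour_integral_kernel(1) RA_def[symmetric] RB_def[symmetric] sum_int_symmetric A0 B0 A B by simp
  show ?thesis unfolding eq
    using tendsto_divide[OF contour_integral_kernel_tendsto_0 tendsto_const[of "two_pi_i :: complex"]] by simp
qed

end

end

section \<open>Modularity of the Lambert series\<close>

text \<open>The function F of the overview before terms with d m = n are collected. The pairs with a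
  zero entry contribute nothing for characters of modulus above 1.\<close>

definition lambert :: "(nat \<Rightarrow> complex) \<Rightarrow> (nat \<Rightarrow> complex) \<Rightarrow> nat \<Rightarrow> real \<Rightarrow> complex" where
  "lambert c1 c2 k y = (\<Sum>\<^sub>\<infinity>(m,d). c2 m * c1 d * of_nat d ^ k * of_real (exp (- (real d * real m * y))))"

lemma summable_on_exp_neg:
  fixes c :: real assumes "c > 0"
  shows "(\<lambda>n::nat. exp (- (c * real n))) summable_on UNIV"
proof -
  have "summable (\<lambda>n. exp (- c) ^ n)" using assms by (intro summable_geometric) auto
  moreover have "exp (- c) ^ n = exp (- (c * real n))" for n
    by (simp add: exp_of_nat_mult [symmetric] mult.commute)
  ultimately show ?thesis by (intro norm_summable_imp_summable_on) auto
qed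

lemma summable_on_product_nonneg:
  fixes f g :: "nat \<Rightarrow> real"
  assumes "f summable_on UNIV" "g summable_on UNIV" "\<And>n. f n \<ge> 0" "\<And>n. g n \<ge> 0"
  shows "(\<lambda>(m, d). f m * g d) summable_on UNIV"
proof -
  have "(\<lambda>x. norm (case x of (m, d) \<Rightarrow> f m * g d)) summable_on UNIV \<times> UNIV"
  proof (rule Infinite_Sum.abs_summable_on_Sigma_iff[THEN iffD2], intro conjI ballI)
    fix m
    show "(\<lambda>d. norm (case (m, d) of (m, d) \<Rightarrow> f m * g d)) summable_on UNIV"
      using assms by (auto simp: abs_mult intro!: summable_on_cmult_right)
  next
    show "(\<lambda>m. norm (\<Sum>\<^sub>\<infinity>d. norm (case (m, d) of (m, d) \<Rightarrow> f m * g d))) summable_on UNIV"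
      using assms by (auto simp: abs_mult infsum_cmult_right' infsum_nonneg intro!: summable_on_cmult_left)
  qed
  hence "(\<lambda>(m, d). f m * g d) summable_on UNIV \<times> UNIV" by (rule abs_summable_summable)
  then show ?thesis by simp
qed

text \<open>Both series are iterated sums of one absolutely convergent triple series over m, d and
  the exponent j of the expansion of exp (d v). Summing over j and then d produces
  \<open>lam\<close>; summing over m and d first produces the coefficients of a power series in
  v.\<close>

lemma lambert_expansion:
  fixes v :: complex and y :: real
  assumes c1: "primitive_character p c1" and c2: "primitive_character q c2"
    and y: "y > 0" and v: "norm v < y / 2"
  obtains E where "(\<lambda>m. c2 m * lam p c1 (of_nat m * of_real y - v)) sums E"
    and "(\<lambda>j. lambert c1 c2 j y * v ^ j / fact j) sums E"
proof -
  interpret c1: primitive_character p c1 by fact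
  interpret c2: primitive_character q c2 by fact
  define g where "g = (\<lambda>((m, d), j). c2 m * c1 d * of_real (exp (- (real d * real m * y))) * ((of_nat d * v) ^ j /\<^sub>R fact j))"
  have expsum: "((\<lambda>j. (of_nat d * v) ^ j /\<^sub>R fact j) has_sum exp (of_nat d * v)) UNIV"
    and expsum': "((\<lambda>j. norm ((of_nat d * v) ^ j /\<^sub>R fact j)) has_sum exp (real d * norm v)) UNIV" for d
  proof -
    have "(\<lambda>j. norm ((of_nat d * v) ^ j /\<^sub>R fact j)) sums exp (real d * norm v)"
      using exp_converges[of "real d * norm v"] by (simp add: norm_mult norm_power)
    then show "((\<lambda>j. norm ((of_nat d * v) ^ j /\<^sub>R fact j)) has_sum exp (real d * norm v)) UNIV"
      by (intro sums_nonneg_imp_has_sum) auto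
    hence "(\<lambda>j. (of_nat d * v) ^ j /\<^sub>R fact j) summable_on UNIV"
      by (rule abs_summable_summable[OF has_sum_imp_summable])
    hence hs: "((\<lambda>j. (of_nat d * v) ^ j /\<^sub>R fact j) has_sum (\<Sum>\<^sub>\<infinity>j. (of_nat d * v) ^ j /\<^sub>R fact j)) UNIV"
      by (rule has_sum_infsum)
    have "(\<Sum>\<^sub>\<infinity>j. (of_nat d * v) ^ j /\<^sub>R fact j) = exp (of_nat d * v)"
      using has_sum_imp_sums[OF hs] exp_converges[of "of_nat d * v"] by (rule sums_unique2)
    then show "((\<lambda>j. (of_nat d * v) ^ j /\<^sub>R fact j) has_sum exp (of_nat d * v)) UNIV"
      using hs by simp
  qed
  \<comment> \<open>For positive m and d, one half of d m y absorbs d times \<open>norm v\<close>.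
    The other half is at least y (d + m) / 4, because d m \<ge> (d + m) / 2; this is the origin of y
    / 4. If m or d is 0, the left-hand side is 0.\<close>
  have bound: "norm (c2 m * c1 d) * exp (- (real d * real m * y)) * exp (real d * norm v)
      \<le> exp (- (y / 4 * real m)) * exp (- (y / 4 * real d))" for m d
  proof (cases "m = 0 \<or> d = 0")
    case False
    have dm: "(real d + real m) / 2 \<le> real d * real m"
    proof -
      have "real d * 1 \<le> real d * real m" "1 * real m \<le> real d * real m"
        using False by (auto intro!: mult_left_mono mult_right_mono)
      then show ?thesis by (simp add: field_simps)
    qed
    have "real d * norm v \<le> real d * (y / 2)" using v by (intro mult_left_mono) auto
    also have "\<dots> * 1 \<le> real d * (y / 2) * real m" using False y by (intro mult_left_mono) auto
    finally have "real d * norm v \<le> real d * real m * (y / 2)" by (simp add: mult_ac)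
    hence "- (real d * real m * y) + real d * norm v \<le> - ((real d * real m) * (y / 2))" by simp
    also have "\<dots> \<le> - (((real d + real m) / 2) * (y / 2))"
      using mult_right_mono[OF dm, of "y / 2"] y by simp
    also have "\<dots> = - (y / 4 * real m) + - (y / 4 * real d)" by (simp add: field_simps)
    finally have "exp (- (real d * real m * y)) * exp (real d * norm v) \<le> exp (- (y / 4 * real m)) * exp (- (y / 4 * real d))"
      by (simp add: exp_add [symmetric])
    moreover have "norm (c2 m * c1 d) \<le> 1"
      using mult_mono[OF c2.norm_le_1[of m] c1.norm_le_1[of d]] by (simp add: norm_mult)
    ultimately have "norm (c2 m * c1 d) * (exp (- (real d * real m * y)) * exp (real d * norm v))
      \<le> 1 * (exp (- (y / 4 * real m)) * exp (- (y / 4 * real d)))"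
      using mult_mono[of "norm (c2 m * c1 d)" 1] by simp
    then show ?thesis by (simp add: mult_ac)
  qed (auto)
  have "(\<lambda>x. norm (g x)) summable_on ((UNIV \<times> UNIV) \<times> UNIV)"
  proof (rule Infinite_Sum.abs_summable_on_Sigma_iff[THEN iffD2], intro conjI ballI)
    fix x :: "nat \<times> nat"
    show "(\<lambda>j. norm (g (x, j))) summable_on UNIV"
      using summable_on_cmult_right[OF has_sum_imp_summable[OF expsum'[of "snd x"]],
          of "norm (c2 (fst x) * c1 (snd x)) * exp (- (real (snd x) * real (fst x) * y))"]
      by (cases x) (simp add: g_def norm_mult mult_ac)
  next
    have eq: "(\<Sum>\<^sub>\<infinity>j. norm (g ((m, d), j))) = norm (c2 m * c1 d) * exp (- (real d * real m * y)) * exp (real d * norm v)" for m d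
      using infsumI[OF has_sum_cmult_right[OF expsum'[of d], of "norm (c2 m * c1 d) * exp (- (real d * real m * y))"]]
      by (simp add: g_def norm_mult mult_ac)
    show "(\<lambda>x. norm (\<Sum>\<^sub>\<infinity>j\<in>UNIV. norm (g (x, j)))) summable_on UNIV \<times> UNIV"
    proof (rule Infinite_Sum.abs_summable_on_comparison_test)
      show "(\<lambda>x. norm ((\<lambda>(m::nat, d::nat). exp (- (y / 4 * real m)) * exp (- (y / 4 * real d))) x)) summable_on UNIV \<times> UNIV"
        using summable_on_product_nonneg[OF summable_on_exp_neg summable_on_exp_neg, of "y / 4" "y / 4"] y
        by (auto simp: case_prod_unfold)
      show "norm (\<Sum>\<^sub>\<infinity>j. norm (g (x, j))) \<le> norm (case x of (m, d) \<Rightarrow> exp (- (y / 4 * real m)) * exp (- (y / 4 * real d)))" for x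
        using bound[of "fst x" "snd x"] by (cases x) (simp add: eq)
    qed
  qed
  hence sumg: "g summable_on ((UNIV \<times> UNIV) \<times> UNIV)" by (rule abs_summable_summable)
  define E where "E = infsum g ((UNIV \<times> UNIV) \<times> UNIV)"
  have hE: "(g has_sum E) ((UNIV \<times> UNIV) \<times> UNIV)" using sumg by (simp add: E_def)
  define g2 where "g2 = (\<lambda>(m, d). c2 m * c1 d * of_real (exp (- (real d * real m * y))) * exp (of_nat d * v))"
  have hg2: "(g2 has_sum E) (UNIV \<times> UNIV)"
  proof (rule has_sum_SigmaD[OF hE])
    fix x :: "nat \<times> nat"
    show "((\<lambda>j. g (x, j)) has_sum g2 x) UNIV"
      using has_sum_cmult_right[OF expsum[of "snd x"]] by (cases x) (simp add: g_def g2_def)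
  qed
  have "((\<lambda>m. c2 m * lam p c1 (of_nat m * of_real y - v)) has_sum E) UNIV"
  proof (rule has_sum_SigmaD[OF hg2])
    fix m :: nat
    show "((\<lambda>d. g2 (m, d)) has_sum c2 m * lam p c1 (of_nat m * of_real y - v)) UNIV"
    proof (cases "m = 0")
      case False
      have sm: "(\<lambda>d. g2 (m, d)) summable_on UNIV"
        using summable_on_SigmaD1[of "\<lambda>m d. g2 (m, d)" UNIV "\<lambda>_. UNIV" m] has_sum_imp_summable[OF hg2] by simp
      have "1 * y \<le> real m * y" using False y by (intro mult_right_mono) auto
      moreover have "Re v \<le> norm v" by (rule complex_Re_le_cmod)
      moreover have "Re (of_nat m * of_real y - v) = real m * y - Re v" by simp
      ultimately have "Re (of_nat m * of_real y - v) > 0" using v y by linarith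
      from sums_mult[OF c1.lam_sums[OF this], of "c2 m"]
      have "(\<lambda>d. g2 (m, d)) sums (c2 m * lam p c1 (of_nat m * of_real y - v))"
        by (simp add: g2_def algebra_simps exp_diff exp_add exp_minus exp_of_real [symmetric] divide_inverse)
      moreover have "(\<lambda>d. g2 (m, d)) sums (\<Sum>\<^sub>\<infinity>d. g2 (m, d))"
        by (rule has_sum_imp_sums[OF has_sum_infsum[OF sm]])
      ultimately have "(\<Sum>\<^sub>\<infinity>d. g2 (m, d)) = c2 m * lam p c1 (of_nat m * of_real y - v)"
        by (rule sums_unique2 [symmetric])
      then show ?thesis using has_sum_infsum[OF sm] by simp
    qed (simp add: g2_def)
  qed
  hence 1: "(\<lambda>m. c2 m * lam p c1 (of_nat m * of_real y - v)) sums E" by (rule has_sum_imp_sums)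
  have hE': "((\<lambda>(j, x). g (x, j)) has_sum E) (UNIV \<times> (UNIV \<times> UNIV))"
    using hE unfolding has_sum_swap[of g] .
  have "((\<lambda>j. lambert c1 c2 j y * v ^ j / fact j) has_sum E) UNIV"
  proof (rule has_sum_SigmaD[OF hE'])
    fix j :: nat
    have "(\<lambda>x. g (x, j)) summable_on (UNIV \<times> UNIV)"
      using summable_on_SigmaD1[of "\<lambda>j x. g (x, j)" UNIV "\<lambda>_. UNIV \<times> UNIV" j] has_sum_imp_summable[OF hE'] by simp
    moreover have "infsum (\<lambda>x. g (x, j)) (UNIV \<times> UNIV) = lambert c1 c2 j y * v ^ j / fact j"
    proof -
      have "infsum (\<lambda>x. g (x, j)) (UNIV \<times> UNIV) = (\<Sum>\<^sub>\<infinity>x. (case x of (m, d) \<Rightarrow> c2 m * c1 d * of_nat d ^ j * of_real (exp (- (real d * real m * y)))) * (v ^ j / fact j))"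
        unfolding UNIV_Times_UNIV by (intro infsum_cong) (auto simp: g_def power_mult_distrib scaleR_conv_of_real divide_inverse mult_ac)
      then show ?thesis unfolding infsum_cmult_left' lambert_def by simp
    qed
    ultimately show "((\<lambda>x. case (j, x) of (j, x) \<Rightarrow> g (x, j)) has_sum lambert c1 c2 j y * v ^ j / fact j) (UNIV \<times> UNIV)"
      using has_sum_infsum[of "\<lambda>x. g (x, j)" "UNIV \<times> UNIV"] unfolding prod.case by argo
  qed
  hence 2: "(\<lambda>j. lambert c1 c2 j y * v ^ j / fact j) sums E" by (rule has_sum_imp_sums)
  show ?thesis using that 1 2 by blast
qed

context character_pair
begin

text \<open>The contour argument controls only joint partial sums up to multiples of q and p. Once
  each series is known to converge, passing to these subsequences loses nothing.\<close>

lemma UV_sums_zero: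
  assumes "y > 0" "w > 0" "w < y / 2" "U y w sums SU" "V y w sums SV"
  shows "SU + SV = 0"
proof -
  note yw = assms(1-3)
  have z: "U y w 0 = 0" "V y w 0 = 0" using yw by (simp_all add: U_def V_def)
  have sub: "strict_mono (\<lambda>N. Suc (q * N))" "strict_mono (\<lambda>N. Suc (p * N))"
    using c1.modulus_gt_1 c2.modulus_gt_1 by (auto intro!: strict_monoI)
  have "(\<lambda>N. \<Sum>n=1..q*N. U y w n) \<longlonglongrightarrow> SU"
    unfolding sum_from_1_eq[of "U y w", OF z(1)]
    using LIMSEQ_subseq_LIMSEQ[OF assms(4)[unfolded sums_def] sub(1)] by (simp add: o_def)
  moreover have "(\<lambda>N. \<Sum>n=1..p*N. V y w n) \<longlonglongrightarrow> SV"
    unfolding sum_from_1_eq[of "V y w", OF z(2)]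
    using LIMSEQ_subseq_LIMSEQ[OF assms(5)[unfolded sums_def] sub(2)] by (simp add: o_def)
  ultimately have "(\<lambda>N. (\<Sum>n=1..q*N. U y w n) + (\<Sum>n=1..p*N. V y w n)) \<longlonglongrightarrow> SU + SV"
    by (rule tendsto_add)
  with UV_tendsto_0[OF yw] show ?thesis using LIMSEQ_unique by blast
qed

lemma gauss_sums_nonzero: "tau2 * tau2c = of_real e * of_nat q" "tau2c \<noteq> 0" "e \<noteq> 0"
proof -
  show 1: "tau2 * tau2c = of_real e * of_nat q" using c2.gauss_sum_mult_cnj parity by simp
  show "e \<noteq> 0" using e_sq by auto
  then show "tau2c \<noteq> 0" using 1 q_pos by auto
qed

text \<open>By \<open>lambert_expansion\<close> the relation between \<open>U\<close> and
  \<open>V\<close> is a power series in w that vanishes for all small positive w, so all its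
  coefficients vanish. Those of even index are zero trivially; the one of odd index k is the modular
  equation.\<close>

lemma lambert_modular:
  assumes "y > 0" "odd k"
  shows "lambert chi1 chi2 k y = (-1) ^ ((k + 1) div 2) * tau1 * tau2 * of_real ((2 * pi) ^ (k + 1) / (real p * real q ^ (k + 1) * y ^ (k + 1)))
      * lambert (cnj \<circ> chi2) (cnj \<circ> chi1) k (4 * pi\<^sup>2 / (real p * real q * y))"
proof -
  define Y where "Y = 4 * pi\<^sup>2 / (real p * real q * y)"
  \<comment> \<open>The shift by w in the first factor moves the poles by - w / y, hence the
    argument of the second factor by K w up to sign.\<close>
  define K where "K = \<i> * of_real (2 * pi / (real q * y))"
  define A where "A = of_real e * tau2c / two_pi_i"
  define D where "D = tau1 / (of_nat p * of_real y)"
  define l1 where "l1 = (\<lambda>j. lambert chi1 chi2 j y)"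
  define l2 where "l2 = (\<lambda>j. lambert (cnj \<circ> chi2) (cnj \<circ> chi1) j Y)"
  define c where "c = (\<lambda>j. (A * l1 j * ((-1) ^ j - 1) + D * l2 j * (K ^ j - (- K) ^ j)) / fact j)"
  define r where "r = min (y / 2) (Y / 2 / norm K)"
  have "Y > 0" using assms p_pos q_pos by (simp add: Y_def)
  have nK: "norm K > 0" using assms q_pos by (simp add: K_def norm_mult)
  have "r > 0" using \<open>Y > 0\<close> nK assms by (simp add: r_def)
  have pc: "primitive_character p chi1" "primitive_character q chi2"
    "primitive_character p (cnj \<circ> chi1)" "primitive_character q (cnj \<circ> chi2)"
    by unfold_locales
  \<comment> \<open>Convergence is needed for complex x, as the isolation of zeros speaks about a
    disc; the value 0 is known only for positive real x.\<close>
  have key: "\<exists>E. (\<lambda>j. c j * x ^ j) sums E \<and> (x \<in> \<real> \<longrightarrow> Re x > 0 \<longrightarrow> E = 0)" if x: "norm x < r" for x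
  proof -
    have x1: "norm x < y / 2" using x by (simp add: r_def)
    have x2: "norm (K * x) < Y / 2" using x nK by (simp add: r_def norm_mult field_simps)
    obtain E1 where E1: "(\<lambda>m. chi2 m * lam p chi1 (of_nat m * of_real y - x)) sums E1" "(\<lambda>j. l1 j * x ^ j / fact j) sums E1"
      using lambert_expansion[OF pc(1,2) assms(1) x1] unfolding l1_def by blast
    obtain E1' where E1': "(\<lambda>m. chi2 m * lam p chi1 (of_nat m * of_real y - (- x))) sums E1'" "(\<lambda>j. l1 j * (- x) ^ j / fact j) sums E1'"
      using lambert_expansion[OF pc(1,2) assms(1), of "- x"] x1 unfolding l1_def by auto
    obtain E2 where E2: "(\<lambda>m. (cnj \<circ> chi1) m * lam q (cnj \<circ> chi2) (of_nat m * of_real Y - K * x)) sums E2" "(\<lambda>j. l2 j * (K * x) ^ j / fact j) sums E2"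
      using lambert_expansion[OF pc(4,3) \<open>Y > 0\<close> x2] unfolding l2_def by blast
    obtain E2' where E2': "(\<lambda>m. (cnj \<circ> chi1) m * lam q (cnj \<circ> chi2) (of_nat m * of_real Y - (- (K * x)))) sums E2'" "(\<lambda>j. l2 j * (- (K * x)) ^ j / fact j) sums E2'"
      using lambert_expansion[OF pc(4,3) \<open>Y > 0\<close>, of "- (K * x)"] x2 unfolding l2_def by auto
    have "(\<lambda>j. A * (l1 j * (- x) ^ j / fact j - l1 j * x ^ j / fact j) + D * (l2 j * (K * x) ^ j / fact j - l2 j * (- (K * x)) ^ j / fact j))
        sums (A * (E1' - E1) + D * (E2 - E2'))" (is "?f sums _")
      by (intro sums_add sums_mult sums_diff E1 E1' E2 E2')
    also have "?f = (\<lambda>j. c j * x ^ j)"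
    proof
      fix j
      have 1: "(- x) ^ j = (- 1) ^ j * x ^ j" "(- (K * x)) ^ j = (- K) ^ j * x ^ j" "(K * x) ^ j = K ^ j * x ^ j"
        using power_minus[of x j] power_mult_distrib[of "- K" x j] power_mult_distrib[of K x j] by simp_all
      show "?f j = c j * x ^ j"
        unfolding c_def 1 by (simp add: field_simps)
    qed
    finally have s: "(\<lambda>j. c j * x ^ j) sums (A * (E1' - E1) + D * (E2 - E2'))" .
    moreover have "A * (E1' - E1) + D * (E2 - E2') = 0" if real: "x \<in> \<real>" "Re x > 0"
    proof (rule UV_sums_zero)
      define w where "w = Re x"
      have xw: "x = of_real w" using real by (simp add: w_def)
      show "y > 0" "w > 0" "w < y / 2"
        using assms real x1 complex_Re_le_cmod[of x] by (auto simp: w_def)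
      show "U y w sums (A * (E1' - E1))"
      proof -
        have "(\<lambda>m. A * (chi2 m * lam p chi1 (of_nat m * of_real y - (- x)) - chi2 m * lam p chi1 (of_nat m * of_real y - x))) sums (A * (E1' - E1))" (is "?u sums _")
          by (intro sums_mult sums_diff E1 E1')
        also have "?u = U y w"
          using \<open>y > 0\<close> \<open>w > 0\<close> \<open>w < y / 2\<close> by (simp add: U_def A_def xw fun_eq_iff right_diff_distrib)
        finally show ?thesis .
      qed
      show "V y w sums (D * (E2 - E2'))"
      proof -
        have Kx: "K * x = \<i> * of_real (2 * pi * w / (real q * y))" by (simp add: K_def xw)
        have "(\<lambda>m. D * ((cnj \<circ> chi1) m * lam q (cnj \<circ> chi2) (of_nat m * of_real Y - K * x) - (cnj \<circ> chi1) m * lam q (cnj \<circ> chi2) (of_nat m * of_real Y - (- (K * x)))))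
           sums (D * (E2 - E2'))" (is "?v sums _")
          by (intro sums_mult sums_diff E2 E2')
        also have "?v = V y w"
          using \<open>y > 0\<close> \<open>w > 0\<close> \<open>w < y / 2\<close> unfolding Kx V_def[OF \<open>y > 0\<close> \<open>w > 0\<close> \<open>w < y / 2\<close>] Y_def[symmetric] D_def
          by (simp add: fun_eq_iff right_diff_distrib)
        finally show ?thesis .
      qed
    qed
    ultimately show ?thesis by blast
  qed
  define f where "f = (\<lambda>x. suminf (\<lambda>j. c j * x ^ j))"
  have fs: "(\<lambda>j. c j * x ^ j) sums f x" if "norm x < r" for x
    using key[OF that] by (auto simp: f_def sums_iff)
  have "c k = 0"
  proof (rule ccontr)
    assume ck: "c k \<noteq> 0"
    have f0: "f 0 = 0"
    proof -
      have "f 0 = c 0" by (simp add: f_def powser_zero)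
      then show ?thesis by (simp add: c_def)
    qed
    have "k > 0" using assms by (auto elim: oddE)
    obtain s where s: "s > 0" "\<And>z. z \<in> cball 0 s - {0} \<Longrightarrow> f z \<noteq> 0"
      \<comment> \<open>A nonzero coefficient would leave a punctured disc around 0 free of zeros,
        in contradiction to the zeros at small positive reals.\<close>
      using powser_0_nonzero[of r 0 c f k] \<open>r > 0\<close> fs f0 ck \<open>k > 0\<close> by auto
    define x where "x = min s (r / 2)"
    have x: "x > 0" "x \<le> s" "x < r" using s \<open>r > 0\<close> by (auto simp: x_def)
    have "f (of_real x) \<noteq> 0" using x by (intro s(2)) auto
    moreover have "f (of_real x) = 0"
      using key[of "of_real x"] fs[of "of_real x"] x by (auto dest: sums_unique2)
    ultimately show False by simp
  qed
  hence "A * l1 k * (- 2) + D * l2 k * (2 * K ^ k) = 0"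
    using assms(2) by (simp add: c_def)
  hence 1: "A * l1 k = D * K ^ k * l2 k" by (simp add: algebra_simps)
  have A0: "A \<noteq> 0" using gauss_sums_nonzero by (simp add: A_def)
  have DA: "D / A = \<i> * of_real (2 * pi / (real p * real q * y)) * tau1 * tau2"
  proof -
    have "tau2 * (of_real e * tau2c) = of_real (e * e) * of_nat q"
      using gauss_sums_nonzero(1) by (simp add: mult_ac)
    \<comment> \<open>The product of the two Gauss sums is e q and e is its own inverse; so the
      Gauss sum of \<open>chi2\<close> enters the numerator.\<close>
    hence inv: "1 / (of_real e * tau2c) = tau2 / of_nat q"
      using gauss_sums_nonzero q_pos e_sq by (simp add: field_simps)
    have "D / A = \<i> * of_real (2 * pi / (real p * y)) * tau1 * (1 / (of_real e * tau2c))"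
      using gauss_sums_nonzero p_pos assms(1) by (simp add: D_def A_def field_simps)
    then show ?thesis unfolding inv by (simp add: mult_ac)
  qed
  have "l1 k = D / A * K ^ k * l2 k" using 1 A0 by (simp add: field_simps)
  also have "\<dots> = (\<i> * \<i> ^ k) * tau1 * tau2 * of_real ((2 * pi / (real p * real q * y)) * (2 * pi / (real q * y)) ^ k) * l2 k"
  proof -
    have "K ^ k = \<i> ^ k * of_real ((2 * pi / (real q * y)) ^ k)"
      unfolding K_def power_mult_distrib of_real_power ..
    then show ?thesis unfolding DA of_real_mult by (simp only: mult_ac)
  qed
  also have "\<i> * \<i> ^ k = (- 1) ^ ((k + 1) div 2)"
  proof -
    obtain j where j: "k = 2 * j + 1" using assms by (auto elim: oddE)
    have "\<i> * \<i> ^ k = (\<i>\<^sup>2) ^ (j + 1)" unfolding power_mult [symmetric] by (simp add: j)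
    then show ?thesis by (simp add: j)
  qed
  also have "(2 * pi / (real p * real q * y)) * (2 * pi / (real q * y)) ^ k = (2 * pi) ^ (k + 1) / (real p * real q ^ (k + 1) * y ^ (k + 1))"
    by (simp add: power_divide power_mult_distrib)
  finally show ?thesis by (simp add: l1_def l2_def Y_def)
qed

end

section \<open>The Dirichlet L-function as a line integral\<close>

lemma exp_partial_sum_le:
  fixes x :: real assumes "x \<ge> 0"
  shows "(\<Sum>j<n. x ^ j /\<^sub>R fact j) \<le> exp x"
  using sum_le_suminf[OF sums_summable[OF exp_converges[of x]], of "{..<n}"] assms
  by (simp add: exp_def)

lemma exp_minus_le_power:
  fixes x :: real assumes "x > 0"
  shows "exp (- x) \<le> fact n / x ^ n"
proof -
  have "x ^ n /\<^sub>R fact n \<le> (\<Sum>j<Suc n. x ^ j /\<^sub>R fact j)"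
    using assms by (intro member_le_sum) auto
  also have "\<dots> \<le> exp x" using assms by (intro exp_partial_sum_le) auto
  finally have "x ^ n \<le> fact n * exp x" by (simp add: field_simps)
  then show ?thesis using assms by (simp add: exp_minus field_simps)
qed

text \<open>Expanding exp (s l) and integrating term by term gives a power series in s. The
  hypothesis with R = \<open>norm s\<close> dominates all partial sums, so the series converges
  everywhere. Both the L-function and the Mellin transform are of this shape.\<close>

lemma
  fixes g l :: "'a \<Rightarrow> complex"
  assumes [measurable]: "g \<in> borel_measurable M" "l \<in> borel_measurable M"
    and int: "\<And>R. R \<ge> 0 \<Longrightarrow> integrable M (\<lambda>t. norm (g t) * exp (R * norm (l t)))"
  shows holomorphic_exp_integral: "(\<lambda>s. \<integral>t. exp (s * l t) * g t \<partial>M) holomorphic_on UNIV"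
    and integrable_exp_integral: "integrable M (\<lambda>t. exp (s * l t) * g t)"
proof -
  define a where "a = (\<lambda>j. (\<integral>t. l t ^ j * g t \<partial>M) / fact j)"
  have sums: "(\<lambda>j. a j * s ^ j) sums (\<integral>t. exp (s * l t) * g t \<partial>M) \<and> integrable M (\<lambda>t. exp (s * l t) * g t)" for s
  proof -
    define f where "f = (\<lambda>j t. ((s * l t) ^ j /\<^sub>R fact j) * g t)"
    have nf: "norm (f j t) = norm (g t) * ((norm s * norm (l t)) ^ j /\<^sub>R fact j)" for j t
      by (simp add: f_def norm_mult norm_power)
    have part: "(\<Sum>j<n. norm (f j t)) \<le> norm (g t) * exp (norm s * norm (l t))" for n t
      unfolding nf sum_distrib_left[symmetric] by (intro mult_left_mono exp_partial_sum_le) auto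
    have le: "norm (f j t) \<le> norm (g t) * exp (norm s * norm (l t))" for j t
      using member_le_sum[of j "{..<Suc j}" "\<lambda>j. norm (f j t)"] part[of t "Suc j"] by simp
    have f_int: "integrable M (f j)" for j
    proof (rule Bochner_Integration.integrable_bound[OF int[of "norm s"]])
      show "f j \<in> borel_measurable M" unfolding f_def by measurable
      show "AE t in M. norm (f j t) \<le> norm (norm (g t) * exp (norm s * norm (l t)))"
        using le by auto
    qed auto
    have fs: "(\<lambda>j. f j t) sums (exp (s * l t) * g t)" for t
      unfolding f_def by (intro sums_mult2 exp_converges)
    have AE: "AE t in M. summable (\<lambda>j. norm (f j t))"
      unfolding f_def norm_mult by (intro AE_I2 summable_mult2 summable_norm_exp)
    have sm: "summable (\<lambda>j. \<integral>t. norm (f j t) \<partial>M)"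
    proof (rule summableI_nonneg_bounded)
      show "(\<Sum>j<n. \<integral>t. norm (f j t) \<partial>M) \<le> (\<integral>t. norm (g t) * exp (norm s * norm (l t)) \<partial>M)" for n
      proof -
        have "(\<Sum>j<n. \<integral>t. norm (f j t) \<partial>M) = (\<integral>t. (\<Sum>j<n. norm (f j t)) \<partial>M)"
          using f_int by (intro Bochner_Integration.integral_sum [symmetric]) auto
        also have "\<dots> \<le> (\<integral>t. norm (g t) * exp (norm s * norm (l t)) \<partial>M)"
          using f_int part int[of "norm s"] by (intro integral_mono) auto
        finally show ?thesis .
      qed
    qed auto
    have "(\<lambda>j. integral\<^sup>L M (f j)) sums (\<integral>t. (\<Sum>j. f j t) \<partial>M)" "integrable M (\<lambda>t. \<Sum>j. f j t)"
      using sums_integral[OF f_int AE sm] integrable_suminf[OF f_int AE sm] by auto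
    moreover have "(\<Sum>j. f j t) = exp (s * l t) * g t" for t using sums_unique[OF fs[of t]] by simp
    moreover have "integral\<^sup>L M (f j) = a j * s ^ j" for j
    proof -
      have "f j = (\<lambda>t. (s ^ j / fact j) * (l t ^ j * g t))"
        by (simp add: f_def fun_eq_iff power_mult_distrib scaleR_conv_of_real divide_inverse mult_ac)
      then show ?thesis by (simp add: a_def)
    qed
    ultimately show ?thesis by simp
  qed
  show "integrable M (\<lambda>t. exp (s * l t) * g t)" using sums by blast
  show "(\<lambda>s. \<integral>t. exp (s * l t) * g t \<partial>M) holomorphic_on UNIV"
  proof -
    have "(\<lambda>s. \<integral>t. exp (s * l t) * g t \<partial>M) holomorphic_on ball 0 r" for r
      using sums by (intro power_series_holomorphic[where a = a]) auto
    then show ?thesis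
      by (meson UNIV_I analytic_at analytic_on_holomorphic holomorphic_on_open open_ball open_UNIV mem_ball_0 gt_ex
          field_differentiable_def holomorphic_on_imp_differentiable_at holomorphic_onI field_differentiable_at_within)
  qed
qed

lemma integrable_exp_neg_abs:
  fixes c :: real assumes "c > 0"
  shows "integrable lborel (\<lambda>t. exp (- (c * \<bar>t\<bar>)))"
proof -
  have "(\<lambda>x. exp (- c * x)) absolutely_integrable_on {0..}"
    using has_integral_exp_minus_to_infinity[OF assms, of 0]
    by (intro nonnegative_absolutely_integrable_1) auto
  hence 1: "integrable lborel (\<lambda>x. indicator {0..} x *\<^sub>R exp (- c * x))"
    unfolding set_integrable_def by (subst (asm) integrable_completion) auto
  hence 2: "integrable lborel (\<lambda>x. indicator {0..} (0 + (-1) * x) *\<^sub>R exp (- c * (0 + (-1) * x)))"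
    by (rule lborel_integrable_real_affine) simp
  show ?thesis
    by (rule Bochner_Integration.integrable_bound[OF Bochner_Integration.integrable_add[OF 1 2]])
       (auto simp: indicator_def)
qed

section \<open>Integrals along vertical lines as limits of segments\<close>

lemma contour_integral_vertical_tendsto:
  assumes "continuous_on UNIV (\<lambda>t. f (Complex c t))" "integrable lborel (\<lambda>t. f (Complex c t))"
  shows "(\<lambda>N. contour_integral (linepath (Complex c (- real N)) (Complex c (real N))) f)
     \<longlonglongrightarrow> \<i> * (\<integral>t. f (Complex c t) \<partial>lborel)"
proof -
  have eq: "contour_integral (linepath (Complex c (- real N)) (Complex c (real N))) f
      = \<i> * (\<integral>t. indicator {- real N..real N} t *\<^sub>R f (Complex c t) \<partial>lborel)" if "N > 0" for N
  proof -
    have "((\<lambda>t. f (Complex c t)) has_integral integral {- real N..real N} (\<lambda>t. f (Complex c t))) {- real N..real N}"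
      using assms(1) by (intro integrable_integral integrable_continuous_interval) (rule continuous_on_subset, auto)
    hence "(f has_contour_integral (\<i> * integral {- real N..real N} (\<lambda>t. f (Complex c t))))
        (linepath (Complex c (- real N)) (Complex c (real N)))"
      using that by (subst has_contour_integral_linepath_same_Re_iff[where c = c and a = "- real N" and b = "real N"]) (auto simp: algebra_simps)
    hence "contour_integral (linepath (Complex c (- real N)) (Complex c (real N))) f
        = \<i> * integral {- real N..real N} (\<lambda>t. f (Complex c t))"
      by (rule contour_integral_unique)
    also have "integral {- real N..real N} (\<lambda>t. f (Complex c t)) = (LINT t:{- real N..real N}|lborel. f (Complex c t))"
      using assms(2) by (intro set_borel_integral_eq_integral(2) [symmetric])
        (auto simp: set_integrable_def intro: integrable_mult_indicator)
    finally show ?thesis by (simp add: set_lebesgue_integral_def)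
  qed
  have "(\<lambda>N. \<i> * (\<integral>t. indicator {- real N..real N} t *\<^sub>R f (Complex c t) \<partial>lborel)) \<longlonglongrightarrow> \<i> * (\<integral>t. f (Complex c t) \<partial>lborel)"
  proof (intro tendsto_mult_left integral_dominated_convergence[where w = "\<lambda>t. norm (f (Complex c t))"])
    show "AE t in lborel. (\<lambda>N. indicator {- real N..real N} t *\<^sub>R f (Complex c t)) \<longlonglongrightarrow> f (Complex c t)"
    proof (rule AE_I2)
      fix t :: real
      obtain N0 :: nat where "\<bar>t\<bar> \<le> real N0" using real_arch_simple by blast
      hence "eventually (\<lambda>N. indicator {- real N..real N} t *\<^sub>R f (Complex c t) = f (Complex c t)) sequentially"
        by (intro eventually_sequentiallyI[of N0]) (auto simp: indicator_def)
      then show "(\<lambda>N. indicator {- real N..real N} t *\<^sub>R f (Complex c t)) \<longlonglongrightarrow> f (Complex c t)"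
        by (rule tendsto_eventually)
    qed
    show "(\<lambda>t. f (Complex c t)) \<in> borel_measurable lborel" using assms(2) by auto
    show "(\<lambda>t. indicator {- real N..real N} t *\<^sub>R f (Complex c t)) \<in> borel_measurable lborel" for N
      using assms(2) by measurable
  qed (use assms(2) in \<open>auto simp: indicator_def\<close>)
  then show ?thesis
    by (rule Lim_transform_eventually) (use eq in \<open>auto intro!: eventually_sequentiallyI[of 1]\<close>)
qed

lemma contour_integral_vertical_tendsto_reverse:
  assumes cont: "continuous_on UNIV (\<lambda>t. f (Complex c t))" and "integrable lborel (\<lambda>t. f (Complex c t))"
  shows "(\<lambda>N. contour_integral (linepath (Complex c (real N)) (Complex c (- real N))) f)
     \<longlonglongrightarrow> - (\<i> * (\<integral>t. f (Complex c t) \<partial>lborel))"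
proof -
  have "contour_integral (linepath (Complex c (real N)) (Complex c (- real N))) f
      = - contour_integral (linepath (Complex c (- real N)) (Complex c (real N))) f" for N
  proof (rule contour_integral_reverse_linepath)
    let ?S = "closed_segment (Complex c (real N)) (Complex c (- real N))"
    have "continuous_on ?S (\<lambda>z. f (Complex c (Im z)))"
      by (rule continuous_on_compose2[OF cont]) (auto intro!: continuous_intros)
    moreover have "f (Complex c (Im z)) = f z" if "z \<in> ?S" for z
      using that by (simp add: closed_segment_same_Re complex_eq_iff) (metis complex_surj)
    ultimately show "continuous_on ?S f" by (metis (no_types, lifting) continuous_on_cong)
  qed
  then show ?thesis using tendsto_minus[OF contour_integral_vertical_tendsto[OF assms]] by simp
qed

lemma norm_contour_integral_horizontal_le:
  assumes "f contour_integrable_on linepath (Complex a t) (Complex b t)" "B \<ge> 0"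
    and "\<And>x. x \<in> closed_segment a b \<Longrightarrow> norm (f (Complex x t)) \<le> B"
  shows "norm (contour_integral (linepath (Complex a t) (Complex b t)) f) \<le> B * \<bar>b - a\<bar>"
proof -
  have "norm (contour_integral (linepath (Complex a t) (Complex b t)) f) \<le> B * norm (Complex b t - Complex a t)"
  proof (rule contour_integral_bound_linepath[OF assms(1,2)])
    fix z assume "z \<in> closed_segment (Complex a t) (Complex b t)"
    hence "Im z = t" "Re z \<in> closed_segment a b" by (auto simp: closed_segment_same_Im)
    then show "norm (f z) \<le> B" using assms(3)[of "Re z"] by (metis complex_surj)
  qed
  then show ?thesis by (simp add: cmod_def)
qed

lemma norm_contour_integral_vertical_le:
  assumes "f contour_integrable_on linepath (Complex t a) (Complex t b)" "B \<ge> 0"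
    and "\<And>x. x \<in> closed_segment a b \<Longrightarrow> norm (f (Complex t x)) \<le> B"
  shows "norm (contour_integral (linepath (Complex t a) (Complex t b)) f) \<le> B * \<bar>b - a\<bar>"
proof -
  have "norm (contour_integral (linepath (Complex t a) (Complex t b)) f) \<le> B * norm (Complex t b - Complex t a)"
  proof (rule contour_integral_bound_linepath[OF assms(1,2)])
    fix z assume "z \<in> closed_segment (Complex t a) (Complex t b)"
    hence "Re z = t" "Im z \<in> closed_segment a b" by (auto simp: closed_segment_same_Re)
    then show "norm (f z) \<le> B" using assms(3)[of "Im z"] by (metis complex_surj)
  qed
  then show ?thesis by (simp add: cmod_def)
qed

abbreviation half_line :: "real \<Rightarrow> complex" where "half_line \<equiv> Complex (1 / 2)"

lemma norm_Ln_half_line_le: "norm (Ln (half_line t)) \<le> ln (2 + \<bar>t\<bar>) + pi"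
proof -
  define W where "W = half_line t"
  have "W \<noteq> 0" by (simp add: W_def complex_eq_iff)
  have "norm W \<le> \<bar>Re W\<bar> + \<bar>Im W\<bar>" by (rule cmod_le)
  hence W1: "norm W \<le> 2 + \<bar>t\<bar>" by (simp add: W_def)
  have W2: "1 / 2 \<le> norm W" using abs_Re_le_cmod[of W] by (simp add: W_def)
  have "\<bar>ln (norm W)\<bar> \<le> ln (2 + \<bar>t\<bar>)"
  proof (rule abs_leI)
    show "ln (norm W) \<le> ln (2 + \<bar>t\<bar>)" using W1 \<open>W \<noteq> 0\<close> by simp
    have "ln (1 / 2) \<le> ln (norm W)" using W2 by (subst ln_le_cancel_iff) auto
    moreover have "ln 2 \<le> ln (2 + \<bar>t\<bar>)" by simp
    moreover have "ln (1 / 2 :: real) = - ln 2" by (simp add: ln_div)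
    ultimately show "- ln (norm W) \<le> ln (2 + \<bar>t\<bar>)" by linarith
  qed
  moreover have "\<bar>Im (Ln W)\<bar> \<le> pi" using mpi_less_Im_Ln[OF \<open>W \<noteq> 0\<close>] Im_Ln_le_pi[OF \<open>W \<noteq> 0\<close>] by simp
  moreover have "norm (Ln W) \<le> \<bar>Re (Ln W)\<bar> + \<bar>Im (Ln W)\<bar>" by (rule cmod_le)
  ultimately show ?thesis using Re_Ln[OF \<open>W \<noteq> 0\<close>] by (simp add: W_def)
qed

lemma norm_powr_minus_le:
  assumes "z \<noteq> 0" "0 < d" "d \<le> norm z" "0 \<le> Re s"
  shows "norm (z powr (- s)) \<le> exp (pi * \<bar>Im s\<bar>) * d powr (- Re s)"
proof -
  have "norm (z powr (- s)) = exp (- (Re s * ln (norm z)) + Im s * Im (Ln z))"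
    using assms(1) by (simp add: powr_def Re_Ln)
  also have "\<dots> \<le> exp (- (Re s * ln d) + pi * \<bar>Im s\<bar>)"
  proof -
    have "Re s * ln d \<le> Re s * ln (norm z)" using assms by (intro mult_left_mono) auto
    moreover have "\<bar>Im (Ln z)\<bar> \<le> pi"
      using mpi_less_Im_Ln[OF assms(1)] Im_Ln_le_pi[OF assms(1)] by simp
    hence "\<bar>Im s * Im (Ln z)\<bar> \<le> pi * \<bar>Im s\<bar>"
      unfolding abs_mult by (subst mult.commute) (intro mult_right_mono, auto)
    ultimately show ?thesis by simp
  qed
  also have "\<dots> = exp (pi * \<bar>Im s\<bar>) * d powr (- Re s)"
    using assms(2) by (simp add: powr_def exp_add [symmetric] add.commute)
  finally show ?thesis .
qed

context parity_character
begin

lemma e_nz: "e \<noteq> 0" using e_sq by auto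

lemma tau_conj_nz: "tau_conj \<noteq> 0"
  using gauss_sum_mult_cnj parity e_nz q_pos by auto

lemma half_not_int: "Complex c t = of_int m \<Longrightarrow> c = 1 / 2 \<or> c = - 1 / 2 \<Longrightarrow> False"
proof -
  assume "Complex c t = of_int m" "c = 1 / 2 \<or> c = - 1 / 2"
  hence "real_of_int (2 * m) = 1 \<or> real_of_int (2 * m) = - 1"
    by (auto simp: complex_eq_iff)
  hence "2 * m = 1 \<or> 2 * m = - 1"
    by (metis of_int_eq_iff of_int_1 of_int_minus)
  then show False by presburger
qed

lemma continuous_dual_kernel_half:
  assumes "c = 1 / 2 \<or> c = - 1 / 2"
  shows "continuous_on UNIV (\<lambda>t. dual_kernel (Complex c t))"
proof -
  have "exp (- (two_pi_i * Complex c t)) \<noteq> 1" for t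
    using half_not_int[OF _ assms] by (auto simp: exp_minus_2pi_i_eq_1_iff)
  then show ?thesis unfolding dual_kernel_eq
    by (intro continuous_intros continuous_on_compose2[OF holomorphic_on_imp_continuous_on[OF holomorphic_dual_num[of UNIV]]])
       (auto simp: Complex_eq intro!: continuous_intros)
qed

lemma norm_dual_kernel_half':
  assumes "c = 1 / 2 \<or> c = - 1 / 2"
  shows "norm (dual_kernel (Complex c t)) \<le> real q * exp (- (2 * pi / real q * \<bar>t\<bar>))"
  using norm_dual_kernel_half[of "Complex c t" 1 0] norm_dual_kernel_half[of "Complex c t" "- 1" 0] assms by auto

lemma integrable_dual_kernel_exp:
  assumes "R \<ge> 0"
  shows "integrable lborel (\<lambda>t. norm (dual_kernel (half_line t)) * exp (R * norm (- Ln (half_line t))))"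
proof -
  define c where "c = pi / real q"
  have c: "c > 0" using q_pos by (simp add: c_def)
  \<comment> \<open>The logarithm lies below any line of slope d up to a constant. This d makes R d
    \<le> c, which costs at most half of the decay rate 2 pi / q = 2 c of the kernel.\<close>
  define d where "d = c / (R + 1)"
  have d: "d > 0" using c assms by (simp add: d_def)
  define K where "K = R * (2 * d - 1 - ln d + pi)"
  have ex: "R * norm (- Ln (half_line t)) \<le> K + c * \<bar>t\<bar>" for t
  proof -
    have "ln (2 + \<bar>t\<bar>) = ln ((2 + \<bar>t\<bar>) * d) - ln d" using d by (subst ln_mult) auto
    also have "ln ((2 + \<bar>t\<bar>) * d) \<le> (2 + \<bar>t\<bar>) * d - 1" using d by (intro ln_le_minus_one) auto
    finally have "norm (- Ln (half_line t)) \<le> 2 * d - 1 - ln d + pi + d * \<bar>t\<bar>"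
      using norm_Ln_half_line_le[of t] by (simp add: algebra_simps)
    hence "R * norm (- Ln (half_line t)) \<le> R * (2 * d - 1 - ln d + pi + d * \<bar>t\<bar>)"
      using assms by (intro mult_left_mono)
    also have "\<dots> = K + (R * d) * \<bar>t\<bar>" by (simp add: K_def algebra_simps)
    also have "R * d \<le> c" using assms c by (simp add: d_def field_simps)
    finally show ?thesis by (simp add: mult_right_mono)
  qed
  have "integrable lborel (\<lambda>t. real q * exp K * exp (- (c * \<bar>t\<bar>)))"
    by (intro integrable_mult_right integrable_exp_neg_abs c)
  then show ?thesis
  proof (rule Bochner_Integration.integrable_bound)
    have nz: "half_line t \<notin> \<real>\<^sub>\<le>\<^sub>0" for t by (simp add: complex_nonpos_Reals_iff)
    have "continuous_on UNIV (\<lambda>t. norm (dual_kernel (half_line t)) * exp (R * norm (- Ln (half_line t))))"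
      using nz by (intro continuous_intros continuous_dual_kernel_half) (auto simp: Complex_eq intro!: continuous_intros)
    then show "(\<lambda>t. norm (dual_kernel (half_line t)) * exp (R * norm (- Ln (half_line t)))) \<in> borel_measurable lborel"
      by (simp add: borel_measurable_continuous_onI)
    show "AE t in lborel. norm (norm (dual_kernel (half_line t)) * exp (R * norm (- Ln (half_line t))))
        \<le> norm (real q * exp K * exp (- (c * \<bar>t\<bar>)))"
    proof (rule AE_I2)
      fix t :: real
      have "norm (dual_kernel (half_line t)) * exp (R * norm (- Ln (half_line t)))
          \<le> (real q * exp (- (2 * pi / real q * \<bar>t\<bar>))) * exp (K + c * \<bar>t\<bar>)"
        using ex[of t] norm_dual_kernel_half'[of "1/2" t] by (intro mult_mono) auto
      also have "\<dots> = real q * exp K * exp (- (c * \<bar>t\<bar>))"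
        by (simp add: c_def exp_add [symmetric] mult.assoc)
      finally show "norm (norm (dual_kernel (half_line t)) * exp (R * norm (- Ln (half_line t))))
        \<le> norm (real q * exp K * exp (- (c * \<bar>t\<bar>)))" by simp
    qed
  qed
qed

lemma norm_dual_kernel_horizontal:
  fixes N :: nat
  assumes "\<bar>Im z\<bar> = real N" "N > 0"
  defines "c \<equiv> 2 * pi / real q"
  shows "norm (dual_kernel z) \<le> real q / (1 - exp (- c)) * exp (- (c * real N))"
proof -
  have c: "c > 0" using q_pos by (simp add: c_def)
  moreover have "c * 1 \<le> c * real N" using assms(2) c by (intro mult_left_mono) auto
  ultimately show ?thesis using norm_dual_kernel_far[of c z] assms(1) by (simp add: c_def)
qed

text \<open>
  \<open>dual_kernel\<close> has simple poles at the integers, with residue proportional to \<open>chi m\<close> at \<open>m\<close>, and decays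
  exponentially along vertical lines. Shifting the line to the right thus gives the Dirichlet series,
  while the line integral itself converges for all \<open>s\<close>.
\<close>

definition L_line :: "complex \<Rightarrow> complex" where
  "L_line s = - \<i> / (of_real e * tau_conj) *
     (\<integral>t. exp (s * (- Ln (half_line t))) * dual_kernel (half_line t) \<partial>lborel)"

lemma measurable_half_line:
  "(\<lambda>t. dual_kernel (half_line t)) \<in> borel_measurable lborel"
  "(\<lambda>t. - Ln (half_line t)) \<in> borel_measurable lborel"
proof -
  have nz: "half_line t \<notin> \<real>\<^sub>\<le>\<^sub>0" for t by (simp add: complex_nonpos_Reals_iff)
  have "continuous_on UNIV (\<lambda>t. - Ln (half_line t))"
    using nz by (intro continuous_intros) (auto simp: Complex_eq intro!: continuous_intros)
  then show "(\<lambda>t. - Ln (half_line t)) \<in> borel_measurable lborel"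
    by (simp only: measurable_lborel1 measurable_lborel2 borel_measurable_continuous_onI)
  show "(\<lambda>t. dual_kernel (half_line t)) \<in> borel_measurable lborel"
    using continuous_dual_kernel_half[of "1/2"] by (simp add: borel_measurable_continuous_onI)
qed

lemma holomorphic_L_line: "L_line holomorphic_on UNIV"
  unfolding L_line_def
  by (intro holomorphic_intros holomorphic_exp_integral measurable_half_line integrable_dual_kernel_exp)

lemma half_line_powr:
  "exp (s * (- Ln (half_line t))) = half_line t powr (- s)"
  by (simp add: powr_def complex_eq_iff)

lemma dual_rect_integral:
  fixes N :: nat
  assumes "N > 0" "Re s > 1"
  defines "a \<equiv> Complex (1 / 2) (- real N)" and "b \<equiv> Complex (real (q * N) + 1 / 2) (real N)"
  shows "contour_integral (rectpath a b) (\<lambda>z. z powr (- s) * dual_kernel z)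
      = of_real e * tau_conj * (\<Sum>m=1..q*N. chi m / of_nat m powr s)"
    and "continuous_on (path_image (rectpath a b)) (\<lambda>z. z powr (- s) * dual_kernel z)"
proof -
  \<comment> \<open>The left border at 1/4 keeps both the branch cut of \<open>powr\<close> and the
    pole at 0 outside; the right border stops before the integer q N + 1.\<close>
  define S where "S = box (Complex (1 / 4) (- (real N + 1))) (Complex (real (q * N) + 3 / 4) (real N + 1))"
  define P where "P = (of_nat ` {1..q * N} :: complex set)"
  have f_eq: "(\<lambda>z. z powr (- s) * dual_kernel z) = (\<lambda>z. z powr (- s) * dual_num z / (1 - exp (- (two_pi_i * z))))"
    by (simp add: dual_kernel_eq)
  have nz: "z \<notin> \<real>\<^sub>\<le>\<^sub>0" if "z \<in> S" for z
    using that by (auto simp: S_def in_box_complex_iff complex_nonpos_Reals_iff)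
  have sub: "cbox a b \<subseteq> S" by (auto simp: a_def b_def S_def in_box_complex_iff in_cbox_complex_iff)
  have num: "(\<lambda>z. z powr (- s) * dual_num z) holomorphic_on S"
    using nz by (intro holomorphic_intros holomorphic_dual_num) auto
  have den: "(\<lambda>z. 1 - exp (- (two_pi_i * z))) holomorphic_on S" by (intro holomorphic_intros)
  have Psub: "P \<subseteq> box a b"
  proof -
    have "real m < real (q * N) + 1 / 2" if "m \<le> q * N" for m
      using of_nat_mono[OF that, where 'a = real] by linarith
    then show ?thesis using assms(1) by (auto simp: P_def a_def b_def in_box_complex_iff)
  qed
  have zeros: "1 - exp (- (two_pi_i * z)) = 0 \<longleftrightarrow> z \<in> P" if "z \<in> S" for z
  proof
    assume "1 - exp (- (two_pi_i * z)) = 0"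
    then obtain m :: int where m: "z = of_int m" using exp_minus_2pi_i_eq_1_iff[of z] by auto
    hence "1 / 4 < real_of_int m" "real_of_int m < real (q * N) + 3 / 4"
      using that by (auto simp: S_def in_box_complex_iff)
    hence "m \<ge> 1" "m \<le> int (q * N)"
      using abs_of_int_less_iff[of "3/4" m "q * N"] by auto
    then show "z \<in> P" unfolding P_def m by (intro image_eqI[of _ _ "nat m"]) (auto simp: nat_le_iff)
  next
    assume "z \<in> P"
    then obtain n where "z = of_nat n" by (auto simp: P_def)
    then show "1 - exp (- (two_pi_i * z)) = 0"
      using exp_minus_2pi_i_eq_1_iff[of z] by (metis of_int_of_nat_eq right_minus_eq)
  qed
  show "continuous_on (path_image (rectpath a b)) (\<lambda>z. z powr (- s) * dual_kernel z)"
    unfolding f_eq using sub num den Psub zeros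
    by (intro continuous_on_rectpath_simple_zeros[where S = S and P = P]) (auto simp: a_def b_def)
  have ex1: "exp (- (two_pi_i * z)) = 1" if "z \<in> P" for z
    using zeros[of z] that Psub sub box_subset_cbox[of a b] by auto
  have "contour_integral (rectpath a b) (\<lambda>z. z powr (- s) * dual_num z / (1 - exp (- (two_pi_i * z))))
      = 2 * pi * \<i> * (\<Sum>z\<in>P. z powr (- s) * dual_num z / two_pi_i)"
  proof (rule contour_integral_rectpath_simple_zeros[OF _ _ sub _ _ num den _ Psub zeros])
    show "open S" "connected S" by (auto simp: S_def open_box convex_connected)
    show "Re a < Re b" "Im a < Im b" using assms(1) modulus_gt_1 by (auto simp: a_def b_def)
    show "finite P" by (simp add: P_def)
    show "((\<lambda>z. 1 - exp (- (two_pi_i * z))) has_field_derivative two_pi_i) (at z)" if "z \<in> P" for z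
      using ex1[OF that] by (auto intro!: derivative_eq_intros)
  qed auto
  also have "\<dots> = (\<Sum>z\<in>P. z powr (- s) * dual_num z)"
    by (simp add: sum_distrib_left)
  also have "\<dots> = (\<Sum>m=1..q*N. of_nat m powr (- s) * dual_num (of_nat m))"
    unfolding P_def by (subst sum.reindex) (auto simp: inj_on_def)
  also have "\<dots> = of_real e * tau_conj * (\<Sum>m=1..q*N. chi m / of_nat m powr s)"
    unfolding dual_num_int sum_distrib_left by (intro sum.cong refl) (simp add: powr_minus field_simps)
  finally show "contour_integral (rectpath a b) (\<lambda>z. z powr (- s) * dual_kernel z)
      = of_real e * tau_conj * (\<Sum>m=1..q*N. chi m / of_nat m powr s)" unfolding f_eq .
qed

text \<open>As the rectangles grow, only the left edge survives. It is traversed downwards, which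
  explains the sign in \<open>L_line\<close>; the residues at 1, ..., q N give the partial sums of
  the Dirichlet series.\<close>

lemma L_line_sums:
  assumes s: "Re s > 1"
  shows "(\<lambda>n. chi (Suc n) / of_nat (Suc n) powr s) sums L_line s"
proof -
  define f where "f = (\<lambda>z. z powr (- s) * dual_kernel z)"
  define a where "a = (\<lambda>N. Complex (1 / 2) (- real N))"
  define b where "b = (\<lambda>N. Complex (real (q * N) + 1 / 2) (real N))"
  define g where "g = (\<lambda>m. chi m / of_nat m powr s)"
  define K where "K = exp (pi * \<bar>Im s\<bar>)"
  define c where "c = 2 * pi / real q"
  define C where "C = real q / (1 - exp (- c))"
  have c: "c > 0" using q_pos by (simp add: c_def)
  have C: "C \<ge> 0" using c q_pos by (simp add: C_def)
  have K: "K > 0" by (simp add: K_def)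
  have cont: "continuous_on (path_image (rectpath (a N) (b N))) f" if "N > 0" for N
    unfolding a_def b_def f_def using dual_rect_integral(2)[OF that s] .
  note edges = contour_integrable_rectpath_edges[OF cont]
  have hor: "norm (f (Complex x t)) \<le> K * (1 / 2) powr (- Re s) * (C * exp (- (c * real N)))"
    if "x \<ge> 1 / 2" "\<bar>t\<bar> = real N" "N > 0" for x t N
  proof -
    have "1 / 2 \<le> norm (Complex x t)" using abs_Re_le_cmod[of "Complex x t"] that(1) by simp
    hence "norm (Complex x t powr (- s)) \<le> K * (1 / 2) powr (- Re s)"
      unfolding K_def using that s by (intro norm_powr_minus_le) (auto simp: complex_eq_iff)
    moreover have "norm (dual_kernel (Complex x t)) \<le> C * exp (- (c * real N))"
      unfolding C_def c_def using that by (intro norm_dual_kernel_horizontal) auto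
    ultimately show ?thesis unfolding f_def norm_mult using C K by (intro mult_mono) auto
  qed
  have hor0: "(\<lambda>N. K * (1 / 2) powr (- Re s) * (C * exp (- (c * real N))) * \<bar>(real (q * N) + 1 / 2) - 1 / 2\<bar>) \<longlonglongrightarrow> 0"
    using linear_times_exp_neg_tendsto_0[OF c, of 0 "K * (1 / 2) powr (- Re s) * C * real q"]
    by (simp add: mult_ac)
  have bottom: "(\<lambda>N. contour_integral (linepath (a N) (Complex (Re (b N)) (Im (a N)))) f) \<longlonglongrightarrow> 0"
  proof (rule Lim_null_comparison[OF eventually_sequentiallyI[of 1] hor0])
    fix N :: nat assume "1 \<le> N"
    then show "norm (contour_integral (linepath (a N) (Complex (Re (b N)) (Im (a N)))) f)
      \<le> K * (1 / 2) powr (- Re s) * (C * exp (- (c * real N))) * \<bar>(real (q * N) + 1 / 2) - 1 / 2\<bar>"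
      using edges(1)[of N] C K unfolding a_def b_def complex.sel
      by (intro norm_contour_integral_horizontal_le hor) (auto simp: closed_segment_eq_real_ivl)
  qed
  have seg: "closed_segment (real q * real N + 1 / 2) (1 / 2) = {1 / 2..real q * real N + 1 / 2}" for N
    by (subst closed_segment_commute) (simp add: closed_segment_eq_real_ivl)
  have top: "(\<lambda>N. contour_integral (linepath (b N) (Complex (Re (a N)) (Im (b N)))) f) \<longlonglongrightarrow> 0"
  proof (rule Lim_null_comparison[OF eventually_sequentiallyI[of 1] hor0])
    fix N :: nat assume "1 \<le> N"
    then show "norm (contour_integral (linepath (b N) (Complex (Re (a N)) (Im (b N)))) f)
      \<le> K * (1 / 2) powr (- Re s) * (C * exp (- (c * real N))) * \<bar>(real (q * N) + 1 / 2) - 1 / 2\<bar>"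
      using edges(3)[of N] C K unfolding a_def b_def complex.sel
      by (subst abs_minus_commute, intro norm_contour_integral_horizontal_le hor) (auto simp: seg)
  qed
  have right: "(\<lambda>N. contour_integral (linepath (Complex (Re (b N)) (Im (a N))) (b N)) f) \<longlonglongrightarrow> 0"
  proof (rule Lim_null_comparison[OF eventually_sequentiallyI[of 1]])
    fix N :: nat assume N: "1 \<le> N"
    have "norm (contour_integral (linepath (Complex (Re (b N)) (Im (a N))) (b N)) f)
      \<le> K * real N powr (- Re s) * real q * \<bar>real N - (- real N)\<bar>"
      using edges(2)[of N] N K unfolding a_def b_def complex.sel
    proof (intro norm_contour_integral_vertical_le)
      fix t
      let ?z = "Complex (real (q * N) + 1 / 2) t"
      have "1 * real N \<le> real q * real N" using modulus_gt_1 by (intro mult_right_mono) auto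
      hence "real N \<le> norm ?z" using abs_Re_le_cmod[of ?z] by simp
      moreover from this have "?z \<noteq> 0" using N by auto
      ultimately have "norm (?z powr (- s)) \<le> K * real N powr (- Re s)"
        unfolding K_def using N s by (intro norm_powr_minus_le) auto
      moreover have "norm (dual_kernel ?z) \<le> real q * exp (- (2 * pi / real q * \<bar>t\<bar>))"
        using norm_dual_kernel_half[of ?z 1 "q * N"] by simp
      hence "norm (dual_kernel ?z) \<le> real q"
        by (rule order_trans) (use q_pos in \<open>auto intro!: mult_left_le\<close>)
      ultimately show "norm (f ?z) \<le> K * real N powr (- Re s) * real q"
        unfolding f_def norm_mult using K by (intro mult_mono) auto
    qed auto
    \<comment> \<open>The edge has length 2 N and the integrand is of order N^(- Re s); here Re s >
      1 enters.\<close>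
    also have "\<dots> = 2 * K * real q * real N powr (1 - Re s)"
      using N by (simp add: powr_diff powr_minus field_simps)
    finally show "norm (contour_integral (linepath (Complex (Re (b N)) (Im (a N))) (b N)) f)
      \<le> 2 * K * real q * real N powr (1 - Re s)" .
  next
    have "(\<lambda>N. real N powr (1 - Re s)) \<longlonglongrightarrow> 0"
      using s by (intro tendsto_neg_powr filterlim_real_sequentially) auto
    then show "(\<lambda>N. 2 * K * real q * real N powr (1 - Re s)) \<longlonglongrightarrow> 0"
      by (rule tendsto_mult_right_zero)
  qed
  have fline: "f (half_line t) = exp (s * (- Ln (half_line t))) * dual_kernel (half_line t)" for t
    unfolding f_def half_line_powr ..
  have left: "(\<lambda>N. contour_integral (linepath (Complex (Re (a N)) (Im (b N))) (a N)) f)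
      \<longlonglongrightarrow> - (\<i> * (\<integral>t. f (half_line t) \<partial>lborel))"
    unfolding a_def b_def complex.sel
  proof (rule contour_integral_vertical_tendsto_reverse)
    have nz: "half_line t \<notin> \<real>\<^sub>\<le>\<^sub>0" for t by (simp add: complex_nonpos_Reals_iff)
    show "continuous_on UNIV (\<lambda>t. f (half_line t))"
      unfolding fline using nz
      by (intro continuous_intros continuous_dual_kernel_half) (auto simp: Complex_eq intro!: continuous_intros)
    show "integrable lborel (\<lambda>t. f (half_line t))"
      unfolding fline by (intro integrable_exp_integral measurable_half_line integrable_dual_kernel_exp)
  qed
  have "(\<lambda>N. contour_integral (rectpath (a N) (b N)) f)
      \<longlonglongrightarrow> 0 + 0 + 0 + - (\<i> * (\<integral>t. f (half_line t) \<partial>lborel))"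
    by (intro contour_integral_rectpath_tendsto bottom right top left eventually_sequentiallyI[of 1] cont) auto
  hence "(\<lambda>N. of_real e * tau_conj * (\<Sum>m=1..q*N. g m)) \<longlonglongrightarrow> 0 + 0 + 0 + - (\<i> * (\<integral>t. f (half_line t) \<partial>lborel))"
  proof (rule Lim_transform_eventually, intro eventually_sequentiallyI[of 1])
    fix N :: nat assume "1 \<le> N"
    then show "contour_integral (rectpath (a N) (b N)) f = of_real e * tau_conj * (\<Sum>m=1..q*N. g m)"
      unfolding a_def b_def f_def g_def by (intro dual_rect_integral(1) s) auto
  qed
  hence "(\<lambda>N. 1 / (of_real e * tau_conj) * (of_real e * tau_conj * (\<Sum>m=1..q*N. g m)))
     \<longlonglongrightarrow> 1 / (of_real e * tau_conj) * (0 + 0 + 0 + - (\<i> * (\<integral>t. f (half_line t) \<partial>lborel)))"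
    by (rule tendsto_mult_left)
  hence lim: "(\<lambda>N. \<Sum>m=1..q*N. g m) \<longlonglongrightarrow> L_line s"
    using e_nz tau_conj_nz by (simp add: L_line_def fline)
  \<comment> \<open>The contour yields partial sums only up to multiples of q; absolute convergence
    identifies their limit with the full sum.\<close>
  have "summable (\<lambda>n. g (Suc n))"
  proof (rule summable_comparison_test')
    have "summable (\<lambda>n. real n powr (- Re s))" using s by (subst summable_real_powr_iff) auto
    then show "summable (\<lambda>n. real (Suc n) powr (- Re s))" by (subst summable_Suc_iff)
    show "norm (g (Suc n)) \<le> real (Suc n) powr (- Re s)" if "n \<ge> 0" for n
    proof -
      have "norm (of_nat (Suc n) powr s :: complex) = real (Suc n) powr Re s"
        using norm_powr_real_powr[of "of_nat (Suc n)" s] by simp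
      hence "norm (g (Suc n)) = norm (chi (Suc n)) * real (Suc n) powr (- Re s)"
        by (simp add: g_def norm_divide norm_mult norm_inverse powr_minus divide_inverse del: of_nat_Suc)
      then show ?thesis using mult_right_mono[OF norm_le_1[of "Suc n"], of "real (Suc n) powr (- Re s)"] by simp
    qed
  qed
  then obtain l where l: "(\<lambda>n. g (Suc n)) sums l" by (auto simp: summable_def)
  have "(\<lambda>N. \<Sum>n<q*N. g (Suc n)) \<longlonglongrightarrow> l"
    using LIMSEQ_subseq_LIMSEQ[OF l[unfolded sums_def], of "\<lambda>N. q * N"] modulus_gt_1
    by (simp add: o_def strict_mono_def)
  hence "(\<lambda>N. \<Sum>m=1..q*N. g m) \<longlonglongrightarrow> l" by (simp add: sum.atLeast1_atMost_eq)
  with lim have "l = L_line s" using LIMSEQ_unique by blast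
  then show ?thesis using l by (simp add: g_def)
qed

text \<open>For \<open>s = - n\<close> there is no pole between the lines \<open>Re z = 1/2\<close> and \<open>Re z = - 1/2\<close>, which \<open>z \<mapsto> - z\<close> interchanges.\<close>

lemma L_line_trivial_zero:
  assumes n: "e * (- 1) ^ n = 1"
  shows "L_line (- of_nat n) = 0"
proof -
  \<comment> \<open>For s = - n the factor z^(- s) is a polynomial, so no branch cut prevents the
    line from crossing to the left half-plane.\<close>
  define f where "f = (\<lambda>z. z ^ n * dual_kernel z)"
  define a where "a = (\<lambda>N. Complex (- 1 / 2) (- real N))"
  define b where "b = (\<lambda>N. Complex (1 / 2) (real N))"
  define c where "c = 2 * pi / real q"
  define C where "C = real q / (1 - exp (- c))"
  have c: "c > 0" using q_pos by (simp add: c_def)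
  have C: "C \<ge> 0" using c q_pos by (simp add: C_def)
  have f_eq: "f = (\<lambda>z. z ^ n * dual_num z / (1 - exp (- (two_pi_i * z))))"
    by (simp add: f_def dual_kernel_eq fun_eq_iff)
  have rect: "contour_integral (rectpath (a N) (b N)) f = 0 \<and> continuous_on (path_image (rectpath (a N) (b N))) f"
    if "N > 0" for N
  proof -
    define S where "S = box (Complex (- 3 / 4) (- (real N + 1))) (Complex (3 / 4) (real N + 1))"
    have sub: "cbox (a N) (b N) \<subseteq> S" by (auto simp: a_def b_def S_def in_box_complex_iff in_cbox_complex_iff)
    have num: "(\<lambda>z. z ^ n * dual_num z) holomorphic_on S"
      by (intro holomorphic_intros holomorphic_dual_num)
    have den: "(\<lambda>z. 1 - exp (- (two_pi_i * z))) holomorphic_on S" by (intro holomorphic_intros)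
    have Psub: "{0} \<subseteq> box (a N) (b N)" using that by (auto simp: a_def b_def in_box_complex_iff)
    have zeros: "1 - exp (- (two_pi_i * z)) = 0 \<longleftrightarrow> z \<in> {0}" if "z \<in> S" for z
    proof
      assume "1 - exp (- (two_pi_i * z)) = 0"
      then obtain m :: int where m: "z = of_int m" using exp_minus_2pi_i_eq_1_iff[of z] by auto
      hence "\<bar>real_of_int m\<bar> < real 0 + 3 / 4"
        using that by (auto simp: S_def in_box_complex_iff)
      hence "m \<in> {- int 0..int 0}" by (subst (asm) abs_of_int_less_iff) auto
      then show "z \<in> {0}" using m by simp
    qed auto
    have "contour_integral (rectpath (a N) (b N)) f = 2 * pi * \<i> * (\<Sum>z\<in>{0}. z ^ n * dual_num z / two_pi_i)"
      unfolding f_eq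
    proof (rule contour_integral_rectpath_simple_zeros[OF _ _ sub _ _ num den _ Psub zeros])
      show "open S" "connected S" by (auto simp: S_def open_box convex_connected)
      show "Re (a N) < Re (b N)" "Im (a N) < Im (b N)" using that by (auto simp: a_def b_def)
      show "((\<lambda>z. 1 - exp (- (two_pi_i * z))) has_field_derivative two_pi_i) (at z)" if "z \<in> {0}" for z
        using that by (auto intro!: derivative_eq_intros)
    qed auto
    moreover have "continuous_on (path_image (rectpath (a N) (b N))) f"
      unfolding f_eq using sub num den Psub zeros
      by (intro continuous_on_rectpath_simple_zeros[where S = S and P = "{0}"]) (auto simp: a_def b_def)
    \<comment> \<open>The only candidate for a pole is 0, where the residue carries the factor
      \<open>chi 0 = 0\<close>.\<close>
    ultimately show ?thesis using dual_num_int(1)[of 0] by simp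
  qed
  hence cont: "continuous_on (path_image (rectpath (a N) (b N))) f" if "N > 0" for N using that by blast
  note edges = contour_integrable_rectpath_edges[OF cont]
  \<comment> \<open>Half of the decay rate c is spent on the growth of z^n, by comparing (c / 2 (N +
    1))^n / n! with the exponential.\<close>
  define K where "K = C * (fact n / (c / 2) ^ n * exp (c / 2))"
  have hor: "norm (f (Complex x t)) \<le> K * exp (- (c / 2 * real N))"
    if "\<bar>x\<bar> \<le> 1 / 2" "\<bar>t\<bar> = real N" "N > 0" for x t N
  proof -
    have "norm (Complex x t) \<le> \<bar>x\<bar> + \<bar>t\<bar>" using cmod_le[of "Complex x t"] by simp
    hence "norm (Complex x t) \<le> real N + 1" using that by linarith
    hence "norm (Complex x t ^ n) \<le> (real N + 1) ^ n" unfolding norm_power by (intro power_mono) auto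
    also have "\<dots> = (c / 2 * (real N + 1)) ^ n / (c / 2) ^ n" using c by (simp add: power_mult_distrib power_divide)
    also have "(c / 2 * (real N + 1)) ^ n \<le> fact n * exp (c / 2 * (real N + 1))"
    proof -
      have "0 < c / 2 * (real N + 1)" using c by simp
      from exp_minus_le_power[OF this, of n] this show ?thesis by (simp add: exp_minus field_simps)
    qed
    finally have 1: "norm (Complex x t ^ n) \<le> fact n * exp (c / 2 * (real N + 1)) / (c / 2) ^ n"
      using c by (simp add: divide_right_mono)
    have dk: "norm (dual_kernel (Complex x t)) \<le> C * exp (- (c * real N))"
      unfolding C_def c_def using that by (intro norm_dual_kernel_horizontal) auto
    have "norm (f (Complex x t)) \<le> (fact n * exp (c / 2 * (real N + 1)) / (c / 2) ^ n) * (C * exp (- (c * real N)))"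
      unfolding f_def norm_mult using 1 dk c by (intro mult_mono) auto
    also have "exp (c / 2 * (real N + 1)) = exp (c / 2 * real N) * exp (c / 2)"
      by (simp add: ring_distribs flip: exp_add)
    also have "fact n * (exp (c / 2 * real N) * exp (c / 2)) / (c / 2) ^ n * (C * exp (- (c * real N)))
        = K * (exp (c / 2 * real N) * exp (- (c * real N)))"
      by (simp add: K_def mult_ac)
    also have "exp (c / 2 * real N) * exp (- (c * real N)) = exp (- (c / 2 * real N))"
      by (simp add: exp_add [symmetric])
    finally show ?thesis .
  qed
  have K: "K \<ge> 0" using C c by (simp add: K_def)
  have hor0: "(\<lambda>N. K * exp (- (c / 2 * real N)) * 1) \<longlonglongrightarrow> 0"
    using linear_times_exp_neg_tendsto_0[of "c / 2" K 0] c by simp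
  have edge: "norm (contour_integral (linepath (Complex u t) (Complex v t)) f) \<le> K * exp (- (c / 2 * real N)) * 1"
    if "u = - 1 / 2 \<and> v = 1 / 2 \<or> u = 1 / 2 \<and> v = - 1 / 2" "\<bar>t\<bar> = real N" "N \<ge> 1"
      "f contour_integrable_on linepath (Complex u t) (Complex v t)" for u v t N
  proof -
    have "norm (contour_integral (linepath (Complex u t) (Complex v t)) f) \<le> K * exp (- (c / 2 * real N)) * \<bar>v - u\<bar>"
    proof (rule norm_contour_integral_horizontal_le[OF that(4)])
      fix x assume "x \<in> closed_segment u v"
      hence "\<bar>x\<bar> \<le> 1 / 2" using that(1) by (auto simp: closed_segment_eq_real_ivl split: if_splits)
      then show "norm (f (Complex x t)) \<le> K * exp (- (c / 2 * real N))"
        using that by (intro hor) auto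
    qed (use K in auto)
    moreover have "\<bar>v - u\<bar> = 1" using that(1) by auto
    ultimately show ?thesis by (simp only:)
  qed
  have bottom: "(\<lambda>N. contour_integral (linepath (a N) (Complex (Re (b N)) (Im (a N)))) f) \<longlonglongrightarrow> 0"
  proof (rule Lim_null_comparison[OF eventually_sequentiallyI[of 1] hor0])
    fix N :: nat assume "1 \<le> N"
    then show "norm (contour_integral (linepath (a N) (Complex (Re (b N)) (Im (a N)))) f) \<le> K * exp (- (c / 2 * real N)) * 1"
      using edges(1)[of N] unfolding a_def b_def complex.sel by (intro edge) auto
  qed
  have top: "(\<lambda>N. contour_integral (linepath (b N) (Complex (Re (a N)) (Im (b N)))) f) \<longlonglongrightarrow> 0"
  proof (rule Lim_null_comparison[OF eventually_sequentiallyI[of 1] hor0])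
    fix N :: nat assume "1 \<le> N"
    then show "norm (contour_integral (linepath (b N) (Complex (Re (a N)) (Im (b N)))) f) \<le> K * exp (- (c / 2 * real N)) * 1"
      using edges(3)[of N] unfolding a_def b_def complex.sel by (intro edge) auto
  qed
  have fline: "f (half_line t) = exp (- of_nat n * (- Ln (half_line t))) * dual_kernel (half_line t)" for t
  proof -
    have "half_line t \<noteq> 0" by (simp add: complex_eq_iff)
    then show ?thesis by (simp add: f_def exp_of_nat_mult)
  qed
  have fcont: "continuous_on UNIV (\<lambda>t. f (Complex d t))" if "d = 1 / 2 \<or> d = - 1 / 2" for d
    unfolding f_def using that
    by (intro continuous_intros continuous_dual_kernel_half) (auto simp: Complex_eq intro!: continuous_intros)
  have int1: "integrable lborel (\<lambda>t. f (half_line t))"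
    unfolding fline by (intro integrable_exp_integral measurable_half_line integrable_dual_kernel_exp)
  \<comment> \<open>The parity condition makes f odd. Hence the two vertical edges contribute
    equally instead of cancelling, and twice the line integral is 0.\<close>
  have fminus: "f (Complex (- 1 / 2) t) = - f (Complex (1 / 2) (0 + (- 1) * t))" for t
  proof -
    have "Complex (- 1 / 2) t = - Complex (1 / 2) (0 + (- 1) * t)" by (simp add: complex_eq_iff)
    hence "f (Complex (- 1 / 2) t) = - of_real (e * (- 1) ^ n) * f (Complex (1 / 2) (0 + (- 1) * t))"
      by (simp only: f_def dual_kernel_minus power_minus[of "Complex (1 / 2) (0 + (- 1) * t)"]) simp
    then show ?thesis unfolding n by simp
  qed
  have int2: "integrable lborel (\<lambda>t. f (Complex (- 1 / 2) t))"
    unfolding fminus using lborel_integrable_real_affine[OF int1, of "- 1" 0] by simp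
  have eq2: "(\<integral>t. f (Complex (- 1 / 2) t) \<partial>lborel) = - (\<integral>t. f (half_line t) \<partial>lborel)"
    unfolding fminus using lborel_integral_real_affine[of "- 1" "\<lambda>t. f (half_line t)" 0] by simp
  have right: "(\<lambda>N. contour_integral (linepath (Complex (Re (b N)) (Im (a N))) (b N)) f)
      \<longlonglongrightarrow> \<i> * (\<integral>t. f (half_line t) \<partial>lborel)"
    unfolding a_def b_def complex.sel by (intro contour_integral_vertical_tendsto fcont int1) auto
  have left: "(\<lambda>N. contour_integral (linepath (Complex (Re (a N)) (Im (b N))) (a N)) f) \<longlonglongrightarrow> - (\<i> * (\<integral>t. f (Complex (- 1 / 2) t) \<partial>lborel))"
    unfolding a_def b_def complex.sel by (intro contour_integral_vertical_tendsto_reverse fcont int2) auto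
  have "(\<lambda>N. contour_integral (rectpath (a N) (b N)) f)
      \<longlonglongrightarrow> 0 + \<i> * (\<integral>t. f (half_line t) \<partial>lborel) + 0 + - (\<i> * (\<integral>t. f (Complex (- 1 / 2) t) \<partial>lborel))"
    by (intro contour_integral_rectpath_tendsto bottom right top left eventually_sequentiallyI[of 1] cont) auto
  moreover have "(\<lambda>N. contour_integral (rectpath (a N) (b N)) f) \<longlonglongrightarrow> 0"
    by (intro tendsto_eventually eventually_sequentiallyI[of 1]) (use rect in auto)
  ultimately have "0 + \<i> * (\<integral>t. f (half_line t) \<partial>lborel) + 0 + - (\<i> * (\<integral>t. f (Complex (- 1 / 2) t) \<partial>lborel)) = 0"
    using LIMSEQ_unique by blast
  hence "(\<integral>t. f (half_line t) \<partial>lborel) = 0" unfolding eq2 by simp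
  then show ?thesis by (simp add: L_line_def fline)
qed

text \<open>The definite description asks for existence, settled by the line integral, and for
  uniqueness, which is analytic continuation from the half-plane Re s > 1.\<close>

lemma dirichlet_L_eq: "dirichlet_L chi = L_line"
  unfolding dirichlet_L_def
proof (rule the_equality)
  show "L_line holomorphic_on UNIV \<and> (\<forall>s. 1 < Re s \<longrightarrow> (\<lambda>n. chi (Suc n) / of_nat (Suc n) powr s) sums L_line s)"
    using holomorphic_L_line L_line_sums by blast
next
  fix g assume g: "g holomorphic_on UNIV \<and> (\<forall>s. 1 < Re s \<longrightarrow> (\<lambda>n. chi (Suc n) / of_nat (Suc n) powr s) sums g s)"
  show "g = L_line"
  proof
    fix z
    show "g z = L_line z"
    proof (rule analytic_continuation_open[where f = g and g = L_line and s = "{s. Re s > 1}" and s' = UNIV])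
      show "open {s. Re s > 1}" by (rule open_halfspace_Re_gt)
      have "2 \<in> {s::complex. Re s > 1}" by simp
      then show "{s::complex. Re s > 1} \<noteq> {}" by blast
      show "g s = L_line s" if "s \<in> {s. Re s > 1}" for s
        using that g L_line_sums[of s] sums_unique2 by blast
    qed (use g holomorphic_L_line in auto)
  qed
qed

end

section \<open>Divisor sums and Mellin-type integrals\<close>

text \<open>Euler's integral with y = exp t. In this variable dy / y becomes dt and y -> 1 / y
  becomes t -> - t; all Mellin integrals below are written this way, over the whole real
  line.\<close>

lemma has_bochner_integral_exp_gamma:
  fixes s c :: real
  assumes s: "s > 0" and c: "c > 0"
  shows "has_bochner_integral lborel (\<lambda>t. exp (s * t - c * exp t)) (Gamma s / c powr s)"
proof -
  define f where "f = (\<lambda>u::real. u powr (s - 1) / exp u)"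
  have range: "range exp = {0 :: real <..}"
    by (auto simp: image_iff) (metis exp_ln)
  have "(f has_integral Gamma s) {0..}"
    unfolding f_def by (rule Gamma_integral_real[OF s])
  hence 1: "(f has_integral Gamma s) {0<..}"
    by (rule has_integral_spike_set_eq[THEN iffD1, rotated 2])
       (auto intro: negligible_subset[of "{0}"] simp: f_def)
  hence "f absolutely_integrable_on {0<..}"
    by (intro nonnegative_absolutely_integrable_1) (auto simp: f_def integrable_on_def)
  hence "f absolutely_integrable_on (range exp) \<and> integral (range exp) f = Gamma s"
    unfolding range using integral_unique[OF 1] by simp
  hence "(\<lambda>t. \<bar>exp t\<bar> * f (exp t)) absolutely_integrable_on UNIV \<and> integral UNIV (\<lambda>t. \<bar>exp t\<bar> * f (exp t)) = Gamma s"
    by (subst has_absolute_integral_change_of_variables_1'[where f = f and g = exp and g' = exp and S = UNIV])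
       (auto intro!: derivative_eq_intros inj_onI)
  moreover have "(\<lambda>t. \<bar>exp t\<bar> * f (exp t)) = (\<lambda>t. exp (s * t - exp t))"
  proof
    fix t :: real
    have "\<bar>exp t\<bar> * f (exp t) = exp (t + (s - 1) * t - exp t)"
      by (simp add: f_def powr_def exp_diff exp_add)
    also have "t + (s - 1) * t = s * t" by (simp add: algebra_simps)
    finally show "\<bar>exp t\<bar> * f (exp t) = exp (s * t - exp t)" .
  qed
  ultimately have ai: "(\<lambda>t. exp (s * t - exp t)) absolutely_integrable_on UNIV"
    and ig: "integral UNIV (\<lambda>t. exp (s * t - exp t)) = Gamma s" by simp_all
  have int: "integrable lborel (\<lambda>t. exp (s * t - exp t))"
    using ai unfolding set_integrable_def by (subst (asm) integrable_completion) auto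
  hence "has_bochner_integral lborel (\<lambda>t. exp (s * t - exp t)) (Gamma s)"
    using ig integral_lborel[OF int] by (simp add: has_bochner_integral_iff)
  hence "has_bochner_integral lborel (\<lambda>t. exp (s * (ln c + 1 * t) - exp (ln c + 1 * t))) (Gamma s /\<^sub>R \<bar>1\<bar>)"
    by (subst (asm) lborel_has_bochner_integral_real_affine_iff[where c = 1 and t = "ln c"]) auto
  also have "(\<lambda>t. exp (s * (ln c + 1 * t) - exp (ln c + 1 * t))) = (\<lambda>t. exp (s * t - c * exp t) * c powr s)"
  proof
    fix t :: real
    have "exp (ln c + 1 * t) = c * exp t" using c by (simp add: exp_add)
    hence "exp (s * (ln c + 1 * t) - exp (ln c + 1 * t)) = exp (s * t - c * exp t + s * ln c)"
      by (simp only:) (simp add: algebra_simps)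
    then show "exp (s * (ln c + 1 * t) - exp (ln c + 1 * t)) = exp (s * t - c * exp t) * c powr s"
      using c by (simp only: exp_add) (simp add: powr_def)
  qed
  finally have "has_bochner_integral lborel (\<lambda>t. exp (s * t - c * exp t) * c powr s / c powr s) (Gamma s / c powr s)"
    by (intro has_bochner_integral_divide_zero) simp
  then show ?thesis using c by simp
qed

text \<open>A translation by r with exp r = \<open>sqrt (al / nu)\<close> balances the two
  exponentials and turns the exponent into - w cosh. The integrand is then even, so the whole line
  gives twice the half-line integral that defines the Bessel function.\<close>

lemma has_bochner_integral_bessel_K0:
  fixes al nu :: real
  assumes "al > 0" "nu > 0"
  shows "has_bochner_integral lborel (\<lambda>t. exp (- (al * exp (- t)) - nu * exp t)) (2 * bessel_K0 (2 * sqrt (al * nu)))"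
proof -
  define w where "w = 2 * sqrt (al * nu)"
  have w: "w > 0" using assms by (simp add: w_def)
  define g where "g = (\<lambda>t::real. exp (- w * cosh t))"
  have g_int: "integrable lborel g"
  proof (rule Bochner_Integration.integrable_bound[OF integrable_exp_neg_abs[of "w / 2"]])
    show "g \<in> borel_measurable lborel" unfolding g_def cosh_def by measurable
    show "AE t in lborel. norm (g t) \<le> norm (exp (- (w / 2 * \<bar>t\<bar>)))"
    proof (rule AE_I2)
      fix t :: real
      have "\<bar>t\<bar> \<le> exp \<bar>t\<bar>" using exp_ge_add_one_self[of "\<bar>t\<bar>"] by linarith
      also have "exp \<bar>t\<bar> \<le> 2 * cosh t" by (auto simp: cosh_def abs_if)
      finally have "w * (\<bar>t\<bar> / 2) \<le> w * cosh t" using w by (intro mult_left_mono) auto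
      then show "norm (g t) \<le> norm (exp (- (w / 2 * \<bar>t\<bar>)))" by (simp add: g_def)
    qed
  qed (use w in auto)
  have half: "set_integrable lborel A g" if "A \<in> sets lborel" for A
    unfolding set_integrable_def using g_int that by (intro integrable_mult_indicator)
  have "(LBINT t:{0..}. g t) = bessel_K0 w"
    unfolding bessel_K0_def using set_borel_integral_eq_integral(2)[OF half[of "{0..}"]] by (simp add: g_def)
  moreover have "(LBINT t:{..0}. g t) = (LBINT t:{0..}. g t)"
    by (subst set_integral_reflect) (simp add: g_def atLeast_def)
  moreover have "(LBINT t:{..0}. g t) = (LBINT t:{..<0}. g t)"
    unfolding set_lebesgue_integral_def
  proof (rule integral_cong_AE)
    show "AE x in lborel. indicator {..0} x *\<^sub>R g x = indicator {..<0} x *\<^sub>R g x"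
      using AE_lborel_singleton[of 0] by eventually_elim (auto simp: indicator_def)
  qed (use borel_measurable_integrable[OF g_int] in auto)
  moreover have "(\<integral>t. g t \<partial>lborel) = (LBINT t:{..<0}. g t) + (LBINT t:{0..}. g t)"
  proof -
    have "(LBINT t:{..<0} \<union> {0..}. g t) = (LBINT t:{..<0}. g t) + (LBINT t:{0..}. g t)"
      by (rule set_integral_Un) (auto intro!: half)
    moreover have "{..<0} \<union> {0..} = (UNIV :: real set)" by auto
    ultimately show ?thesis by (simp add: set_lebesgue_integral_def)
  qed
  ultimately have "has_bochner_integral lborel g (2 * bessel_K0 w)"
    using g_int by (simp add: has_bochner_integral_iff)
  moreover define r where "r = ln (sqrt (al / nu))"
  have er: "exp r = sqrt (al / nu)" using assms by (simp add: r_def)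
  have "(\<lambda>t. g (- r + 1 * t)) = (\<lambda>t. exp (- (al * exp (- t)) - nu * exp t))"
  proof
    fix t
    have "al * exp (- t) = sqrt (al * nu) * (exp r * exp (- t))"
      using assms by (simp add: er real_sqrt_divide real_sqrt_mult)
    moreover have "nu * exp t = sqrt (al * nu) * (exp (- r) * exp t)"
    proof -
      have "exp (- r) = sqrt (nu / al)" using er assms by (simp add: exp_minus real_sqrt_divide)
      then show ?thesis using assms by (simp add: real_sqrt_divide real_sqrt_mult)
    qed
    ultimately have "- (al * exp (- t)) - nu * exp t = - w * cosh (- r + 1 * t)"
      by (simp add: w_def cosh_def exp_add exp_diff exp_minus field_simps)
    then show "g (- r + 1 * t) = exp (- (al * exp (- t)) - nu * exp t)" by (simp add: g_def)
  qed
  ultimately show ?thesis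
    using lborel_has_bochner_integral_real_affine_iff[of 1 g "2 * bessel_K0 w" "- r"] by (simp add: w_def)
qed

text \<open>With exponent k + 2 the weight factors as m^(-k-2) d^(-2), which is summable; with k + 1
  the sum over d would be harmonic. All later majorants reduce to this one.\<close>

lemma summable_on_divisor_weights:
  "(\<lambda>(m, d). real d ^ k / (real d * real m) ^ (k + 2)) summable_on (UNIV :: (nat \<times> nat) set)"
proof -
  have 1: "(\<lambda>n. 1 / real n ^ j) summable_on UNIV" if "j \<ge> 2" for j
    using inverse_power_summable[OF that, where 'a = real]
    by (intro norm_summable_imp_summable_on) (simp add: inverse_eq_divide)
  have "(\<lambda>(m, d). (1 / real m ^ (k + 2)) * (1 / real d ^ 2)) summable_on UNIV"
    by (intro summable_on_product_nonneg 1) auto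
  also have "(\<lambda>(m, d). (1 / real m ^ (k + 2)) * (1 / real d ^ 2)) = (\<lambda>(m, d). real d ^ k / (real d * real m) ^ (k + 2))"
  proof (intro ext, clarify)
    fix m d
    show "(1 / real m ^ (k + 2)) * (1 / real d ^ 2) = real d ^ k / (real d * real m) ^ (k + 2)"
      \<comment> \<open>For a zero entry both sides are 0, since division by zero gives 0.\<close>
      by (cases "d = 0 \<or> m = 0") (auto simp: power_mult_distrib power_add field_simps power2_eq_square)
  qed
  finally show ?thesis .
qed

text \<open>Collects pairs by their product m d = n + 1; the pairs with a zero entry, which divide
  no positive number, are discarded first.\<close>

lemma sums_divisors:
  fixes G :: "nat \<times> nat \<Rightarrow> 'a :: {topological_comm_monoid_add, t3_space}"
  assumes "(G has_sum S) UNIV" and zero: "\<And>m d. m = 0 \<or> d = 0 \<Longrightarrow> G (m, d) = 0"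
  shows "(\<lambda>n. \<Sum>d | d dvd Suc n. G (Suc n div d, d)) sums S"
proof -
  define A where "A = {(m::nat, d::nat). m > 0 \<and> d > 0}"
  have "(G has_sum S) A"
  proof (subst has_sum_cong_neutral[where T = UNIV and g = G])
    show "G x = 0" if "x \<in> UNIV - A" for x
      using that zero[of "fst x" "snd x"] by (cases x) (auto simp: A_def)
  qed (use assms(1) in auto)
  also have "?this \<longleftrightarrow> ((\<lambda>(n, d). G (Suc n div d, d)) has_sum S) (Sigma UNIV (\<lambda>n. {d. d dvd Suc n}))"
  proof (rule has_sum_reindex_bij_witness[where j = "\<lambda>(m, d). (m * d - 1, d)" and i = "\<lambda>(n, d). (Suc n div d, d)"])
    fix b assume "b \<in> Sigma UNIV (\<lambda>n. {d. d dvd Suc n})"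
    then obtain n d where b: "b = (n, d)" "d dvd Suc n" by auto
    hence "d > 0" "Suc n div d * d = Suc n" by (auto intro: Nat.gr0I)
    then show "(case (case b of (n, d) \<Rightarrow> (Suc n div d, d)) of (m, d) \<Rightarrow> (m * d - 1, d)) = b"
      "(case b of (n, d) \<Rightarrow> (Suc n div d, d)) \<in> A"
      using b by (auto simp: A_def div_greater_zero_iff intro: dvd_imp_le)
  qed (auto simp: A_def Suc_diff_Suc)
  finally have "((\<lambda>n. \<Sum>d | d dvd Suc n. G (Suc n div d, d)) has_sum S) UNIV"
    by (rule has_sum_SigmaD) (auto intro!: has_sum_finite)
  then show ?thesis by (rule has_sum_imp_sums)
qed

definition divisor_power_sum :: "nat \<Rightarrow> nat \<Rightarrow> real" where
  "divisor_power_sum k n = (\<Sum>d | d dvd n. real d ^ k)"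

lemma divisor_power_sum_nonneg: "divisor_power_sum k n \<ge> 0"
  by (simp add: divisor_power_sum_def sum_nonneg)

lemma summable_divisor_power_sum:
  "summable (\<lambda>n. divisor_power_sum k (Suc n) / real (Suc n) ^ (k + 2))"
proof -
  have "(\<lambda>n. \<Sum>d | d dvd Suc n. (\<lambda>(m, d). real d ^ k / (real d * real m) ^ (k + 2)) (Suc n div d, d))
     sums infsum (\<lambda>(m, d). real d ^ k / (real d * real m) ^ (k + 2)) UNIV"
    by (rule sums_divisors[OF has_sum_infsum[OF summable_on_divisor_weights]]) auto
  moreover have "(\<Sum>d | d dvd Suc n. (\<lambda>(m, d). real d ^ k / (real d * real m) ^ (k + 2)) (Suc n div d, d))
      = divisor_power_sum k (Suc n) / real (Suc n) ^ (k + 2)" for n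
    unfolding divisor_power_sum_def sum_divide_distrib prod.case
    by (intro sum.cong refl) (simp flip: of_nat_mult del: of_nat_Suc)
  ultimately show ?thesis by (simp add: sums_iff)
qed

lemma sigma_chi_eq:
  "sigma_chi (of_nat k) c1 c2 (Suc n) = (\<Sum>d | d dvd Suc n. of_nat d ^ k * c1 d * c2 (Suc n div d))"
  unfolding sigma_chi_def
proof (intro sum.cong refl)
  fix d assume "d \<in> {d. d dvd Suc n}"
  hence "d \<noteq> 0" by (intro notI) simp
  then show "of_nat d powr of_nat k * c1 d * c2 (Suc n div d) = of_nat d ^ k * c1 d * c2 (Suc n div d)"
    by (simp add: powr_nat')
qed

lemma norm_sigma_chi_le:
  assumes "\<And>n. norm (c1 n) \<le> 1" "\<And>n. norm (c2 n) \<le> 1"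
  shows "norm (sigma_chi (of_nat k) c1 c2 (Suc n)) \<le> divisor_power_sum k (Suc n)"
  unfolding sigma_chi_eq divisor_power_sum_def
proof (rule sum_norm_le)
  fix d
  have "norm (c1 d) * norm (c2 (Suc n div d)) \<le> 1 * 1" using assms by (intro mult_mono) auto
  hence "real d ^ k * (norm (c1 d) * norm (c2 (Suc n div d))) \<le> real d ^ k * 1"
    by (intro mult_left_mono) auto
  then show "norm (of_nat d ^ k * c1 d * c2 (Suc n div d)) \<le> real d ^ k"
    by (simp add: norm_mult norm_power mult.assoc)
qed

text \<open>Of the A powers of n y gained from the exponential, k + 2 powers of n are kept for
  summability, while all A powers of y are kept; so any power decay in y is available.\<close>

lemma lambert_term_le:
  fixes y :: real
  assumes "y > 0" "k + 2 \<le> A"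
  shows "divisor_power_sum k (Suc n) * exp (- (real (Suc n) * y))
    \<le> fact A / y ^ A * (divisor_power_sum k (Suc n) / real (Suc n) ^ (k + 2))"
proof -
  have "exp (- (real (Suc n) * y)) \<le> fact A / (real (Suc n) * y) ^ A"
    using assms by (intro exp_minus_le_power) auto
  also have "\<dots> = fact A / y ^ A * (1 / real (Suc n) ^ A)" by (simp add: power_mult_distrib del: of_nat_Suc)
  also have "\<dots> \<le> fact A / y ^ A * (1 / real (Suc n) ^ (k + 2))"
    using assms by (intro mult_left_mono divide_left_mono power_increasing) auto
  finally have "divisor_power_sum k (Suc n) * exp (- (real (Suc n) * y))
      \<le> divisor_power_sum k (Suc n) * (fact A / y ^ A * (1 / real (Suc n) ^ (k + 2)))"
    by (rule mult_left_mono) (rule divisor_power_sum_nonneg)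
  then show ?thesis by (simp add: mult_ac del: of_nat_Suc)
qed

lemma summable_lambert_majorant:
  fixes y :: real
  assumes "y > 0"
  shows "summable (\<lambda>n. divisor_power_sum k (Suc n) * exp (- (real (Suc n) * y)))"
proof (rule summable_comparison_test')
  show "summable (\<lambda>n. fact (k + 2) / y ^ (k + 2) * (divisor_power_sum k (Suc n) / real (Suc n) ^ (k + 2)))"
    by (intro summable_mult summable_divisor_power_sum)
  show "norm (divisor_power_sum k (Suc n) * exp (- (real (Suc n) * y)))
      \<le> fact (k + 2) / y ^ (k + 2) * (divisor_power_sum k (Suc n) / real (Suc n) ^ (k + 2))" if "n \<ge> 0" for n
    using lambert_term_le[OF assms, of k "k + 2" n] divisor_power_sum_nonneg[of k "Suc n"] by simp
qed

text \<open>The one exchange of sum and integral behind all three transforms below: for nonnegative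
  weights a bound of order n^(-k-2) on their integrals is enough.\<close>

lemma sums_integral_divisor_weights:
  fixes w :: "nat \<Rightarrow> real \<Rightarrow> real" and a :: "nat \<Rightarrow> complex"
  assumes a: "\<And>n. norm (a n) \<le> divisor_power_sum k (Suc n)"
    and w: "\<And>n. has_bochner_integral lborel (w n) (I n)" "\<And>n t. w n t \<ge> 0"
    and I: "\<And>n. I n \<le> C / real (Suc n) ^ (k + 2)"
    and sm: "\<And>t. summable (\<lambda>n. divisor_power_sum k (Suc n) * w n t)"
  shows "(\<lambda>n. a n * of_real (I n)) sums (\<integral>t. (\<Sum>n. a n * of_real (w n t)) \<partial>lborel)"
proof -
  define f where "f = (\<lambda>n t. a n * of_real (w n t))"
  have w_int: "integrable lborel (w n)" and w_eq: "integral\<^sup>L lborel (w n) = I n" for n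
    using w(1)[of n] by (auto simp: has_bochner_integral_iff)
  have f_int: "integrable lborel (f n)" for n
    unfolding f_def using w_int[of n] by (intro integrable_mult_right integrable_of_real) auto
  have nf: "norm (f n t) \<le> divisor_power_sum k (Suc n) * w n t" for n t
    using mult_right_mono[OF a[of n] w(2)[of n t]] w(2)[of n t] by (simp add: f_def norm_mult)
  have I0: "I n \<ge> 0" for n unfolding w_eq[symmetric] by (intro integral_nonneg_AE) (auto simp: w(2))
  have AE: "AE t in lborel. summable (\<lambda>n. norm (f n t))"
    using nf sm by (intro AE_I2 summable_comparison_test'[OF sm]) auto
  have nI: "(\<integral>t. norm (f n t) \<partial>lborel) \<le> C * (divisor_power_sum k (Suc n) / real (Suc n) ^ (k + 2))" for n
  proof -
    have "(\<integral>t. norm (f n t) \<partial>lborel) \<le> (\<integral>t. divisor_power_sum k (Suc n) * w n t \<partial>lborel)"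
      using f_int w_int nf by (intro integral_mono) auto
    also have "\<dots> = divisor_power_sum k (Suc n) * I n" using w_eq by simp
    also have "\<dots> \<le> divisor_power_sum k (Suc n) * (C / real (Suc n) ^ (k + 2))"
      by (intro mult_left_mono I divisor_power_sum_nonneg)
    finally show ?thesis by (simp add: mult_ac)
  qed
  have "summable (\<lambda>n. \<integral>t. norm (f n t) \<partial>lborel)"
  proof (rule summable_comparison_test')
    show "summable (\<lambda>n. C * (divisor_power_sum k (Suc n) / real (Suc n) ^ (k + 2)))"
      by (intro summable_mult summable_divisor_power_sum)
    show "norm (\<integral>t. norm (f n t) \<partial>lborel) \<le> C * (divisor_power_sum k (Suc n) / real (Suc n) ^ (k + 2))" if "n \<ge> 0" for n
      using nI[of n] by simp
  qed
  from sums_integral[OF f_int AE this]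
  have "(\<lambda>n. integral\<^sup>L lborel (f n)) sums (\<integral>t. (\<Sum>n. f n t) \<partial>lborel)" .
  moreover have "integral\<^sup>L lborel (f n) = a n * of_real (I n)" for n
    unfolding f_def using w_eq[of n] by simp
  ultimately show ?thesis by (simp add: f_def w_eq)
qed

section \<open>Dirichlet series and integral transforms of the Lambert series\<close>

locale two_characters =
  c1: primitive_character p chi1 + c2: primitive_character q chi2
  for p q :: nat and chi1 chi2 :: "nat \<Rightarrow> complex" +
  fixes k :: nat
begin

abbreviation "sg n \<equiv> sigma_chi (of_nat k) chi1 chi2 (Suc n)"

lemma norm_sg_le: "norm (sg n) \<le> divisor_power_sum k (Suc n)"
  by (intro norm_sigma_chi_le c1.norm_le_1 c2.norm_le_1)

lemma norm_pair_le: "norm (chi2 m * chi1 d * of_nat d ^ k * of_real u) \<le> real d ^ k * u" if "u \<ge> 0"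
proof -
  have "norm (chi2 m) * norm (chi1 d) \<le> 1 * 1"
    by (intro mult_mono c1.norm_le_1 c2.norm_le_1) auto
  hence "(norm (chi2 m) * norm (chi1 d)) * (real d ^ k * u) \<le> 1 * (real d ^ k * u)"
    using that by (intro mult_right_mono) auto
  then show ?thesis using that by (simp add: norm_mult norm_power mult.assoc)
qed

lemma
  fixes u :: "real \<Rightarrow> real"
  assumes u0: "\<And>x. u x \<ge> 0" and u: "\<And>x. x \<ge> 1 \<Longrightarrow> u x \<le> C / x ^ (k + 2)"
  defines "G \<equiv> \<lambda>(m, d). chi2 m * chi1 d * of_nat d ^ k * of_real (u (real d * real m))"
  shows summable_on_weighted_pairs: "G summable_on UNIV"
    and sums_weighted_divisors: "(\<lambda>n. sg n * of_real (u (real (Suc n)))) sums infsum G UNIV"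
proof -
  have C: "C \<ge> 0" using u0[of 1] u[of 1] by simp
  have "(\<lambda>x. norm (G x)) summable_on UNIV"
  proof (rule Infinite_Sum.abs_summable_on_comparison_test)
    show "(\<lambda>x. norm (C * (case x of (m, d) \<Rightarrow> real d ^ k / (real d * real m) ^ (k + 2)))) summable_on UNIV"
    proof -
      have "(\<lambda>x. norm (C * (case x of (m, d) \<Rightarrow> real d ^ k / (real d * real m) ^ (k + 2))))
          = (\<lambda>x. C * (case x of (m, d) \<Rightarrow> real d ^ k / (real d * real m) ^ (k + 2)))"
        using C by (auto simp: fun_eq_iff)
      then show ?thesis by (simp only:) (rule summable_on_cmult_right[OF summable_on_divisor_weights])
    qed
    fix x :: "nat \<times> nat"
    obtain m d where x: "x = (m, d)" by (cases x)
    show "norm (G x) \<le> norm (C * (case x of (m, d) \<Rightarrow> real d ^ k / (real d * real m) ^ (k + 2)))"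
    proof (cases "m = 0 \<or> d = 0")
      case True
      then show ?thesis by (auto simp: x G_def)
    next
      case False
      hence "real d * real m \<ge> 1" using mult_mono[of 1 "real d" 1 "real m"] by simp
      hence "real d ^ k * u (real d * real m) \<le> real d ^ k * (C / (real d * real m) ^ (k + 2))"
        by (intro mult_left_mono u) auto
      with norm_pair_le[OF u0, of m d "real d * real m"]
      have "norm (G x) \<le> real d ^ k * (C / (real d * real m) ^ (k + 2))" by (simp only: x G_def prod.case)
      then show ?thesis using C by (simp add: x mult.commute)
    qed
  qed
  then show G: "G summable_on UNIV" by (rule abs_summable_summable)
  have "(\<lambda>n. \<Sum>d | d dvd Suc n. G (Suc n div d, d)) sums infsum G UNIV"
    by (rule sums_divisors[OF has_sum_infsum[OF G]]) (auto simp: G_def)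
  moreover have "(\<Sum>d | d dvd Suc n. G (Suc n div d, d)) = sg n * of_real (u (real (Suc n)))" for n
    unfolding sigma_chi_eq sum_distrib_right G_def prod.case
  proof (intro sum.cong refl)
    fix d assume "d \<in> {d. d dvd Suc n}"
    hence "real d * real (Suc n div d) = real (Suc n)" by (simp flip: of_nat_mult del: of_nat_Suc)
    then show "chi2 (Suc n div d) * chi1 d * of_nat d ^ k * of_real (u (real d * real (Suc n div d)))
        = of_nat d ^ k * chi1 d * chi2 (Suc n div d) * of_real (u (real (Suc n)))"
      by (simp only: mult_ac)
  qed
  ultimately show "(\<lambda>n. sg n * of_real (u (real (Suc n)))) sums infsum G UNIV" by simp
qed

lemma lambert_sums:
  fixes y :: real
  assumes "y > 0"
  shows "(\<lambda>n. sg n * of_real (exp (- (real (Suc n) * y)))) sums lambert chi1 chi2 k y"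
  unfolding lambert_def
proof (rule sums_weighted_divisors)
  fix x :: real assume "x \<ge> 1"
  hence "exp (- (x * y)) \<le> fact (k + 2) / (x * y) ^ (k + 2)"
    using assms by (intro exp_minus_le_power) auto
  also have "\<dots> = fact (k + 2) / y ^ (k + 2) / x ^ (k + 2)"
    by (simp only: power_mult_distrib divide_divide_eq_left mult.commute)
  finally show "exp (- (x * y)) \<le> fact (k + 2) / y ^ (k + 2) / x ^ (k + 2)" .
qed auto

lemma norm_lambert_le:
  fixes y :: real
  assumes "y > 0" "k + 2 \<le> A"
  shows "norm (lambert chi1 chi2 k y) \<le> fact A * (\<Sum>n. divisor_power_sum k (Suc n) / real (Suc n) ^ (k + 2)) / y ^ A"
proof -
  define T where "T = (\<lambda>n. fact A / y ^ A * (divisor_power_sum k (Suc n) / real (Suc n) ^ (k + 2)))"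
  have sT: "summable T" unfolding T_def by (intro summable_mult summable_divisor_power_sum)
  have nT: "norm (sg n * of_real (exp (- (real (Suc n) * y)))) \<le> T n" for n
  proof -
    have "norm (sg n * of_real (exp (- (real (Suc n) * y)))) = norm (sg n) * exp (- (real (Suc n) * y))"
      by (simp add: norm_mult)
    also have "\<dots> \<le> divisor_power_sum k (Suc n) * exp (- (real (Suc n) * y))"
      by (intro mult_right_mono norm_sg_le) auto
    also have "\<dots> \<le> T n" unfolding T_def by (rule lambert_term_le[OF assms])
    finally show ?thesis .
  qed
  have "norm (lambert chi1 chi2 k y) = norm (\<Sum>n. sg n * of_real (exp (- (real (Suc n) * y))))"
    using sums_unique[OF lambert_sums[OF assms(1)]] by simp
  also have "\<dots> \<le> suminf T" using nT sT by (rule norm_suminf_le)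
  also have "suminf T = fact A / y ^ A * (\<Sum>n. divisor_power_sum k (Suc n) / real (Suc n) ^ (k + 2))"
    unfolding T_def by (intro suminf_mult summable_divisor_power_sum)
  finally show ?thesis by simp
qed

lemma measurable_lambert_exp: "(\<lambda>t. lambert chi1 chi2 k (c * exp t)) \<in> borel_measurable lborel" if "c > 0"
proof -
  have "(\<lambda>t. lambert chi1 chi2 k (c * exp t)) = (\<lambda>t. \<Sum>n. sg n * of_real (exp (- (real (Suc n) * (c * exp t)))))"
    using sums_unique[OF lambert_sums] that by (auto simp: fun_eq_iff)
  moreover have "(\<lambda>t. \<Sum>n. sg n * of_real (exp (- (real (Suc n) * (c * exp t))))) \<in> borel_measurable lborel"
    by measurable
  ultimately show ?thesis by simp
qed

text \<open>With n = m d the weight d^k n^(-s) separates into m^(-s) and d^(k-s), so the double sum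
  is the product of the two Dirichlet series. The range s > k + 2 leaves room for the common
  majorant; the identity is continued from there.\<close>

lemma sums_dirichlet_product:
  fixes s :: real
  assumes s: "s > real k + 2"
    and L1: "(\<lambda>n. chi1 (Suc n) / of_nat (Suc n) powr of_real (s - real k)) sums l1"
    and L2: "(\<lambda>n. chi2 (Suc n) / of_nat (Suc n) powr of_real s) sums l2"
  shows "(\<lambda>n. sg n * of_real (1 / real (Suc n) powr s)) sums (l1 * l2)"
proof -
  define f1 where "f1 = (\<lambda>d. chi1 d * of_real (1 / real d powr (s - real k)))"
  define f2 where "f2 = (\<lambda>m. chi2 m * of_real (1 / real m powr s))"
  define G where "G = (\<lambda>(m, d). chi2 m * chi1 d * of_nat d ^ k * of_real (1 / (real d * real m) powr s))"
  have pw: "of_nat (Suc n) powr of_real r = (of_real (real (Suc n) powr r) :: complex)" for n r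
    using powr_of_real[of "real (Suc n)" r] by simp
  have G_eq: "G (m, d) = f2 m * f1 d" for m d
  proof (cases "d = 0 \<or> m = 0")
    case False
    hence "real d ^ k * (1 / (real d * real m) powr s) = (1 / real m powr s) * (1 / real d powr (s - real k))"
      by (simp add: powr_mult powr_diff powr_realpow)
    hence "of_nat d ^ k * of_real (1 / (real d * real m) powr s)
        = (of_real ((1 / real m powr s) * (1 / real d powr (s - real k))) :: complex)"
      by (metis of_real_mult of_real_of_nat_eq of_real_power)
    then show ?thesis by (simp only: G_def f1_def f2_def prod.case of_real_mult mult_ac)
  qed (auto simp: G_def f1_def f2_def)
  have s1: "(f1 has_sum l1) UNIV" and s2: "(f2 has_sum l2) UNIV"
  proof -
    have nsm: "summable (\<lambda>n. norm (c n * of_real (1 / real n powr r)))" if "r > 1" "\<And>n. norm (c n) \<le> 1" for c :: "nat \<Rightarrow> complex" and r :: real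
    proof (rule summable_comparison_test')
      show "summable (\<lambda>n. real n powr (- r))" using that by (subst summable_real_powr_iff) auto
      show "norm (norm (c n * of_real (1 / real n powr r))) \<le> real n powr (- r)" if "n \<ge> 0" for n
        using mult_right_mono[OF \<open>\<And>n. norm (c n) \<le> 1\<close>[of n], of "real n powr (- r)"]
        by (simp add: norm_mult norm_inverse powr_minus divide_inverse)
    qed
    have sm: "f sums l" if "(\<lambda>n. f (Suc n)) sums l" "f 0 = 0" for f and l :: complex
      using that sums_Suc[of f l] by simp
    have "(\<lambda>n. f1 (Suc n)) sums l1" "(\<lambda>n. f2 (Suc n)) sums l2"
      using L1 L2 unfolding f1_def f2_def pw by (simp_all add: divide_inverse)
    moreover have "f1 0 = 0" "f2 0 = 0" by (simp_all add: f1_def f2_def)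
    ultimately have "f1 sums l1" "f2 sums l2" by (simp_all add: sm)
    moreover have "summable (\<lambda>n. norm (f1 n))" "summable (\<lambda>n. norm (f2 n))"
      unfolding f1_def f2_def using s by (intro nsm c1.norm_le_1 c2.norm_le_1; linarith)+
    ultimately show "(f1 has_sum l1) UNIV" "(f2 has_sum l2) UNIV"
      by (simp_all add: norm_summable_imp_has_sum)
  qed
  have u: "1 / x powr s \<le> 1 / x ^ (k + 2)" if "x \<ge> 1" for x :: real
  proof -
    have "x powr real (k + 2) \<le> x powr s" using that s by (intro powr_mono) auto
    then show ?thesis using that by (subst (asm) powr_realpow) (auto intro!: divide_left_mono)
  qed
  have Gs: "G summable_on UNIV \<times> UNIV"
    unfolding G_def UNIV_Times_UNIV by (rule summable_on_weighted_pairs[OF _ u]) auto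
  have hG: "(G has_sum infsum G (UNIV \<times> UNIV)) (UNIV \<times> UNIV)" using Gs by (rule has_sum_infsum)
  have "((\<lambda>m. f2 m * l1) has_sum infsum G (UNIV \<times> UNIV)) UNIV"
    by (rule has_sum_SigmaD[OF hG]) (simp add: G_eq has_sum_cmult_right[OF s1])
  moreover have "((\<lambda>m. f2 m * l1) has_sum (l2 * l1)) UNIV" by (rule has_sum_cmult_left[OF s2])
  ultimately have "infsum G (UNIV \<times> UNIV) = l2 * l1" by (rule has_sum_unique)
  moreover have "(\<lambda>n. sg n * of_real (1 / real (Suc n) powr s)) sums infsum G UNIV"
    unfolding G_def by (rule sums_weighted_divisors[OF _ u]) auto
  ultimately show ?thesis by (simp add: mult.commute)
qed

lemma sums_integral_lambert:
  fixes W Y :: "real \<Rightarrow> real"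
  assumes W: "\<And>t. W t \<ge> 0" and Y: "\<And>t. Y t > 0"
    and w: "\<And>n. has_bochner_integral lborel (\<lambda>t. W t * exp (- (real (Suc n) * Y t))) (I n)"
    and I: "\<And>n. I n \<le> C / real (Suc n) ^ (k + 2)"
  shows "(\<lambda>n. sg n * of_real (I n)) sums (\<integral>t. of_real (W t) * lambert chi1 chi2 k (Y t) \<partial>lborel)"
proof -
  have "(\<lambda>n. sg n * of_real (I n)) sums (\<integral>t. (\<Sum>n. sg n * of_real (W t * exp (- (real (Suc n) * Y t)))) \<partial>lborel)"
  proof (rule sums_integral_divisor_weights[OF norm_sg_le w _ I])
    show "summable (\<lambda>n. divisor_power_sum k (Suc n) * (W t * exp (- (real (Suc n) * Y t))))" for t
      using summable_mult[OF summable_lambert_majorant[OF Y[of t], of k], of "W t"] by (simp only: mult_ac)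
  qed (use W in auto)
  also have "(\<lambda>t. \<Sum>n. sg n * of_real (W t * exp (- (real (Suc n) * Y t)))) = (\<lambda>t. of_real (W t) * lambert chi1 chi2 k (Y t))"
  proof
    fix t
    show "(\<Sum>n. sg n * of_real (W t * exp (- (real (Suc n) * Y t)))) = of_real (W t) * lambert chi1 chi2 k (Y t)"
      using sums_unique[OF sums_mult[OF lambert_sums[OF Y[of t]], of "of_real (W t)"]]
      by (simp only: of_real_mult mult_ac)
  qed
  finally show ?thesis .
qed

lemma mellin_lambert:
  fixes s :: real
  assumes s: "s \<ge> real k + 2"
  shows "(\<lambda>n. sg n * of_real (Gamma s / real (Suc n) powr s)) sums
     (\<integral>t. of_real (exp (s * t)) * lambert chi1 chi2 k (exp t) \<partial>lborel)"
proof -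
  have "s > 0" using s by linarith
  have w: "exp (s * t) * exp (- (real (Suc n) * exp t)) = exp (s * t - real (Suc n) * exp t)" for n t
    by (simp add: exp_diff exp_minus divide_inverse)
  show ?thesis
  proof (rule sums_integral_lambert)
    show "has_bochner_integral lborel (\<lambda>t. exp (s * t) * exp (- (real (Suc n) * exp t))) (Gamma s / real (Suc n) powr s)" for n
      unfolding w using \<open>s > 0\<close> by (intro has_bochner_integral_exp_gamma) auto
    show "Gamma s / real (Suc n) powr s \<le> Gamma s / real (Suc n) ^ (k + 2)" for n
    proof (rule divide_left_mono)
      have "real (Suc n) powr real (k + 2) \<le> real (Suc n) powr s" using s by (intro powr_mono) auto
      then show "real (Suc n) ^ (k + 2) \<le> real (Suc n) powr s" by (subst (asm) powr_realpow) auto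
      show "0 \<le> Gamma s" using \<open>s > 0\<close> by (simp add: less_imp_le Gamma_real_pos)
    qed auto
  qed auto
qed

lemma bessel_lambert:
  fixes al :: real
  assumes al: "al > 0"
  shows "(\<lambda>n. sg n * of_real (2 * bessel_K0 (2 * sqrt (al * real (Suc n))))) sums
     (\<integral>t. of_real (exp (- (al * exp (- t)))) * lambert chi1 chi2 k (exp t) \<partial>lborel)"
proof -
  define w where "w = (\<lambda>n t. exp (- (al * exp (- t)) - real (Suc n) * exp t))"
  have weq: "w n t = exp (- (al * exp (- t))) * exp (- (real (Suc n) * exp t))" for n t
    by (simp add: w_def exp_diff exp_minus divide_inverse)
  define C where "C = fact (k + 2) / al ^ (k + 2) * Gamma (real (k + 2))"
  have wi: "has_bochner_integral lborel (w n) (2 * bessel_K0 (2 * sqrt (al * real (Suc n))))" for n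
    unfolding w_def using al by (intro has_bochner_integral_bessel_K0) auto
  show ?thesis
  proof (rule sums_integral_lambert)
    show "has_bochner_integral lborel (\<lambda>t. exp (- (al * exp (- t))) * exp (- (real (Suc n) * exp t))) (2 * bessel_K0 (2 * sqrt (al * real (Suc n))))" for n
      unfolding weq[symmetric] by (rule wi)
    show "2 * bessel_K0 (2 * sqrt (al * real (Suc n))) \<le> C / real (Suc n) ^ (k + 2)" for n
    proof -
      have g: "has_bochner_integral lborel (\<lambda>t. exp (real (k + 2) * t - real (Suc n) * exp t)) (Gamma (real (k + 2)) / real (Suc n) powr real (k + 2))"
        by (rule has_bochner_integral_exp_gamma) auto
      have "2 * bessel_K0 (2 * sqrt (al * real (Suc n))) = (\<integral>t. w n t \<partial>lborel)"
        using wi[of n] by (simp add: has_bochner_integral_iff)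
      also have "\<dots> \<le> (\<integral>t. fact (k + 2) / al ^ (k + 2) * exp (real (k + 2) * t - real (Suc n) * exp t) \<partial>lborel)"
      proof (rule integral_mono)
        show "integrable lborel (w n)" using wi[of n] by (simp add: has_bochner_integral_iff)
        show "integrable lborel (\<lambda>t. fact (k + 2) / al ^ (k + 2) * exp (real (k + 2) * t - real (Suc n) * exp t))"
          using g by (intro integrable_mult_right) (simp add: has_bochner_integral_iff)
        fix t :: real
        \<comment> \<open>Replacing this factor by a multiple of exp ((k + 2) t) bounds the Bessel
          integral by a Gamma integral, whose value carries the required n^(-k-2).\<close>
        have "exp (- (al * exp (- t))) \<le> fact (k + 2) / (al * exp (- t)) ^ (k + 2)"
          using al by (intro exp_minus_le_power) auto
        also have "\<dots> = fact (k + 2) / al ^ (k + 2) * exp (real (k + 2) * t)"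
        proof -
          have "exp (- t) ^ (k + 2) = exp (- (real (k + 2) * t))"
            by (subst exp_of_nat_mult [symmetric]) simp
          then show ?thesis unfolding power_mult_distrib
            by (simp only: exp_minus[of "real (k + 2) * t"] divide_inverse inverse_mult_distrib inverse_inverse_eq mult.assoc)
        qed
        finally have "w n t \<le> fact (k + 2) / al ^ (k + 2) * exp (real (k + 2) * t) * exp (- (real (Suc n) * exp t))"
          unfolding weq by (intro mult_right_mono) auto
        also have "\<dots> = fact (k + 2) / al ^ (k + 2) * exp (real (k + 2) * t - real (Suc n) * exp t)"
          by (simp add: exp_diff exp_minus divide_inverse mult.assoc del: of_nat_Suc of_nat_add)
        finally show "w n t \<le> fact (k + 2) / al ^ (k + 2) * exp (real (k + 2) * t - real (Suc n) * exp t)" .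
      qed
      also have "\<dots> = C / real (Suc n) ^ (k + 2)"
        using g by (simp add: has_bochner_integral_iff C_def powr_realpow del: of_nat_Suc of_nat_add)
      finally show ?thesis .
    qed
  qed auto
qed

text \<open>Each term is a difference of two Gamma integrals. They are kept together, since the
  factor 1 - exp (- al exp t) supplies the additional power of n that separate terms would
  lack.\<close>

lemma rational_lambert:
  fixes al B :: real
  assumes al: "al > 0" and B: "B > 0"
  shows "(\<lambda>n. sg n * of_real (fact k / (B * real (Suc n)) ^ (k + 1) - fact k / (B * real (Suc n) + al) ^ (k + 1))) sums
     (\<integral>t. of_real ((1 - exp (- (al * exp t))) * exp (real (k + 1) * t)) * lambert chi1 chi2 k (B * exp t) \<partial>lborel)"
proof -
  define w where "w = (\<lambda>n t. exp (real (k + 1) * t - (B * real (Suc n)) * exp t) - exp (real (k + 1) * t - (B * real (Suc n) + al) * exp t))"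
  have weq: "w n t = (1 - exp (- (al * exp t))) * exp (real (k + 1) * t) * exp (- (real (Suc n) * (B * exp t)))" for n t
  proof -
    have "exp (real (k + 1) * t - (B * real (Suc n)) * exp t) = exp (real (k + 1) * t) * exp (- (real (Suc n) * (B * exp t)))"
      by (subst exp_add [symmetric]) (simp add: algebra_simps)
    moreover have "exp (real (k + 1) * t - (B * real (Suc n) + al) * exp t) = exp (real (k + 1) * t) * exp (- (real (Suc n) * (B * exp t))) * exp (- (al * exp t))"
      by (subst exp_add [symmetric])+ (simp add: algebra_simps)
    ultimately show ?thesis unfolding w_def by (simp add: algebra_simps)
  qed
  have G: "Gamma (real (k + 1)) = fact k" using Gamma_fact[of k, where 'a = real] by (simp add: add.commute)
  have gi: "has_bochner_integral lborel (\<lambda>t. exp (real (k + 1) * t - c * exp t)) (fact k / c ^ (k + 1))" if "c > 0" for c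
  proof -
    have "real (k + 1) > 0" by simp
    from has_bochner_integral_exp_gamma[OF this that] show ?thesis unfolding G powr_realpow[OF that] .
  qed
  have wi: "has_bochner_integral lborel (w n) (fact k / (B * real (Suc n)) ^ (k + 1) - fact k / (B * real (Suc n) + al) ^ (k + 1))" for n
    unfolding w_def using al B by (intro has_bochner_integral_diff gi) (auto intro: add_pos_pos)
  define C where "C = al * Gamma (real (k + 2)) / B ^ (k + 2)"
  show ?thesis
  proof (rule sums_integral_lambert)
    show "has_bochner_integral lborel (\<lambda>t. (1 - exp (- (al * exp t))) * exp (real (k + 1) * t) * exp (- (real (Suc n) * (B * exp t))))
        (fact k / (B * real (Suc n)) ^ (k + 1) - fact k / (B * real (Suc n) + al) ^ (k + 1))" for n
      unfolding weq[symmetric] by (rule wi)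
    show "fact k / (B * real (Suc n)) ^ (k + 1) - fact k / (B * real (Suc n) + al) ^ (k + 1) \<le> C / real (Suc n) ^ (k + 2)" for n
    proof -
      have g: "has_bochner_integral lborel (\<lambda>t. exp (real (k + 2) * t - (B * real (Suc n)) * exp t)) (Gamma (real (k + 2)) / (B * real (Suc n)) powr real (k + 2))"
        using B by (intro has_bochner_integral_exp_gamma) auto
      have "fact k / (B * real (Suc n)) ^ (k + 1) - fact k / (B * real (Suc n) + al) ^ (k + 1) = (\<integral>t. w n t \<partial>lborel)"
        using wi[of n] by (simp only: has_bochner_integral_iff)
      also have "\<dots> \<le> (\<integral>t. al * exp (real (k + 2) * t - (B * real (Suc n)) * exp t) \<partial>lborel)"
      proof (rule integral_mono)
        show "integrable lborel (w n)" using wi[of n] by (simp only: has_bochner_integral_iff)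
        show "integrable lborel (\<lambda>t. al * exp (real (k + 2) * t - (B * real (Suc n)) * exp t))"
          using g by (intro integrable_mult_right) (simp only: has_bochner_integral_iff)
        fix t :: real
        \<comment> \<open>This raises the exponent from k + 1 to k + 2.\<close>
        have "1 - exp (- (al * exp t)) \<le> al * exp t"
          using exp_ge_add_one_self[of "- (al * exp t)"] by linarith
        hence "w n t \<le> al * exp t * exp (real (k + 1) * t) * exp (- (real (Suc n) * (B * exp t)))"
          unfolding weq by (intro mult_right_mono) auto
        also have "\<dots> = al * exp (t + real (k + 1) * t + - (real (Suc n) * (B * exp t)))"
          by (simp only: exp_add mult.assoc)
        also have "t + real (k + 1) * t + - (real (Suc n) * (B * exp t)) = real (k + 2) * t - (B * real (Suc n)) * exp t"
          by (simp add: algebra_simps)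
        finally show "w n t \<le> al * exp (real (k + 2) * t - (B * real (Suc n)) * exp t)" .
      qed
      also have "\<dots> = C / real (Suc n) ^ (k + 2)"
      proof -
        have "(\<integral>t. al * exp (real (k + 2) * t - (B * real (Suc n)) * exp t) \<partial>lborel)
            = al * (Gamma (real (k + 2)) / (B * real (Suc n)) powr real (k + 2))"
          using g by (simp only: has_bochner_integral_iff integral_mult_right_zero)
        also have "(B * real (Suc n)) powr real (k + 2) = B ^ (k + 2) * real (Suc n) ^ (k + 2)"
          using B by (subst powr_realpow) (auto simp only: power_mult_distrib intro!: mult_pos_pos)
        finally show ?thesis by (simp only: C_def times_divide_eq_right divide_divide_eq_left)
      qed
      finally show ?thesis .
    qed
    show "0 \<le> (1 - exp (- (al * exp t))) * exp (real (k + 1) * t)" for t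
      using al by (intro mult_nonneg_nonneg) auto
  qed (use B in auto)
qed

end

section \<open>The summation formula\<close>

lemma entire_eq_on_ray:
  fixes f g :: "complex \<Rightarrow> complex"
  assumes "f holomorphic_on UNIV" "g holomorphic_on UNIV"
    and eq: "\<And>s::real. s > c \<Longrightarrow> f (of_real s) = g (of_real s)"
  shows "f z = g z"
proof -
  define U where "U = (of_real ` {c<..} :: complex set)"
  have "f z - g z = 0"
  proof (rule analytic_continuation[where f = "\<lambda>z. f z - g z" and S = UNIV and U = U and \<xi> = "of_real (c + 1)"])
    show "of_real (c + 1) islimpt U"
      unfolding islimpt_approachable
    proof (intro allI impI)
      fix r :: real assume "r > 0"
      have "of_real (c + 1 + r / 2) \<in> U" using \<open>r > 0\<close> unfolding U_def by (intro imageI) auto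
      moreover have "of_real (c + 1 + r / 2) \<noteq> (of_real (c + 1) :: complex)" using \<open>r > 0\<close> by (simp only: of_real_eq_iff)
      moreover have "dist (of_real (c + 1 + r / 2)) (of_real (c + 1) :: complex) < r"
        using \<open>r > 0\<close> by (simp only: dist_of_real) (simp add: dist_real_def)
      ultimately show "\<exists>x'\<in>U. x' \<noteq> of_real (c + 1) \<and> dist x' (of_real (c + 1)) < r" by blast
    qed
    show "f z - g z = 0" if "z \<in> U" for z using that eq by (auto simp: U_def)
  qed (use assms in \<open>auto intro!: holomorphic_intros\<close>)
  then show ?thesis by simp
qed

locale character_pair_weight = character_pair +
  fixes k :: nat
  assumes odd_k: "odd k"
begin

sublocale two_characters p q chi1 chi2 k by unfold_locales
sublocale dual: two_characters q p "cnj \<circ> chi2" "cnj \<circ> chi1" k by unfold_locales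

text \<open>The modular equation sends y to B / y.\<close>

definition B :: real where "B = 4 * pi\<^sup>2 / (real p * real q)"

definition kap :: complex where
  "kap = (-1) ^ ((k + 1) div 2) * tau1 * tau2 * of_real ((2 * pi) ^ (k + 1) / (real p * real q ^ (k + 1)))"

abbreviation phi :: "real \<Rightarrow> complex" where "phi t \<equiv> lambert chi1 chi2 k (exp t)"

lemma B_pos: "B > 0" using p_pos q_pos by (simp add: B_def)

lemma phi_modular:
  "phi t = kap * (of_real (exp (- (real (k + 1) * t))) * lambert (cnj \<circ> chi2) (cnj \<circ> chi1) k (B * exp (- t)))"
proof -
  have e: "exp t ^ (k + 1) = exp (real (k + 1) * t)" by (rule exp_of_nat_mult [symmetric])
  have 1: "(2 * pi) ^ (k + 1) / (real p * real q ^ (k + 1) * exp t ^ (k + 1))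
      = (2 * pi) ^ (k + 1) / (real p * real q ^ (k + 1)) * exp (- (real (k + 1) * t))"
    unfolding e exp_minus by (simp only: divide_inverse inverse_mult_distrib mult.assoc)
  have 2: "4 * pi\<^sup>2 / (real p * real q * exp t) = B * exp (- t)"
    unfolding B_def exp_minus by (simp only: divide_inverse inverse_mult_distrib mult.assoc)
  show ?thesis
    using lambert_modular[OF exp_gt_zero odd_k, of t] unfolding 1 2 kap_def of_real_mult by (simp only: mult.assoc)
qed

text \<open>For t \<ge> 0 this is the termwise estimate; for t < 0 the modular equation carries the
  behaviour of the series near y = 0 over to large arguments of the dual series.\<close>

lemma phi_bound: "\<exists>C. \<forall>t. norm (phi t) \<le> C * exp (- (real R * \<bar>t\<bar>))"
proof -
  define Z where "Z = (\<Sum>n. divisor_power_sum k (Suc n) / real (Suc n) ^ (k + 2))"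
  \<comment> \<open>For t < 0 the weight factor of the modular equation costs k + 1 powers, so R + 1
    are left; k + 2 is the minimum required for summability.\<close>
  define A where "A = R + k + 2"
  define C1 where "C1 = fact A * Z"
  define C2 where "C2 = norm kap * (fact A * Z / B ^ A)"
  have Z: "Z \<ge> 0" unfolding Z_def
    by (intro suminf_nonneg summable_divisor_power_sum divide_nonneg_nonneg divisor_power_sum_nonneg) auto
  have C1: "C1 \<ge> 0" and C2: "C2 \<ge> 0" using Z B_pos by (auto simp: C1_def C2_def)
  have "norm (phi t) \<le> (C1 + C2) * exp (- (real R * \<bar>t\<bar>))" for t
  proof (cases "t \<ge> 0")
    case True
    have "norm (phi t) \<le> fact A * Z / exp t ^ A"
      unfolding Z_def by (rule norm_lambert_le) (auto simp: A_def)
    also have "\<dots> = C1 * exp (- (real A * t))"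
      by (simp add: C1_def exp_of_nat_mult [symmetric] exp_minus divide_inverse)
    also have "\<dots> \<le> C1 * exp (- (real R * \<bar>t\<bar>))"
      using True C1 by (intro mult_left_mono) (auto simp: A_def mult_right_mono)
    also have "\<dots> \<le> (C1 + C2) * exp (- (real R * \<bar>t\<bar>))" using C2 by (intro mult_right_mono) auto
    finally show ?thesis .
  next
    case False
    have "norm (lambert (cnj \<circ> chi2) (cnj \<circ> chi1) k (B * exp (- t))) \<le> fact A * Z / (B * exp (- t)) ^ A"
      unfolding Z_def using B_pos by (intro dual.norm_lambert_le) (auto simp: A_def)
    also have "\<dots> = fact A * Z / B ^ A * exp (real A * t)"
    proof -
      have "exp (- t) ^ A = exp (- (real A * t))" by (subst exp_of_nat_mult [symmetric]) simp
      then show ?thesis unfolding power_mult_distrib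
        by (simp only: exp_minus[of "real A * t"] divide_inverse inverse_mult_distrib inverse_inverse_eq mult.assoc)
    qed
    finally have le: "norm (lambert (cnj \<circ> chi2) (cnj \<circ> chi1) k (B * exp (- t))) \<le> fact A * Z / B ^ A * exp (real A * t)" .
    have "norm (phi t) \<le> norm kap * (exp (- (real (k + 1) * t)) * (fact A * Z / B ^ A * exp (real A * t)))"
      unfolding phi_modular norm_mult norm_of_real abs_exp_cancel
      by (intro mult_left_mono le norm_ge_zero exp_ge_zero)
    also have "\<dots> = C2 * exp (- (real (k + 1) * t) + real A * t)"
      unfolding exp_add C2_def by (simp only: mult_ac)
    also have "- (real (k + 1) * t) + real A * t = (real R + 1) * t" by (simp add: A_def algebra_simps)
    also have "C2 * exp ((real R + 1) * t) \<le> C2 * exp (- (real R * \<bar>t\<bar>))"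
      using False C2 by (intro mult_left_mono) (auto simp: algebra_simps)
    also have "\<dots> \<le> (C1 + C2) * exp (- (real R * \<bar>t\<bar>))" using C1 by (intro mult_right_mono) auto
    finally show ?thesis .
  qed
  then show ?thesis by blast
qed

lemma measurable_phi: "phi \<in> borel_measurable lborel"
  using measurable_lambert_exp[of 1] by simp

lemma integrable_phi_exp:
  assumes "R \<ge> 0"
  shows "integrable lborel (\<lambda>t. norm (phi t) * exp (R * norm (of_real t :: complex)))"
proof -
  obtain n :: nat where n: "R + 1 \<le> real n" using real_arch_simple by blast
  obtain C where C: "\<And>t. norm (phi t) \<le> C * exp (- (real n * \<bar>t\<bar>))" using phi_bound[of n] by blast
  have C0: "C \<ge> 0" using order_trans[OF norm_ge_zero C[of 0]] by simp
  have "integrable lborel (\<lambda>t. C * exp (- (1 * \<bar>t\<bar>)))"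
    by (intro integrable_mult_right integrable_exp_neg_abs) auto
  then show ?thesis
  proof (rule Bochner_Integration.integrable_bound)
    show "(\<lambda>t. norm (phi t) * exp (R * norm (of_real t :: complex))) \<in> borel_measurable lborel"
      using measurable_phi by measurable
    show "AE t in lborel. norm (norm (phi t) * exp (R * norm (of_real t :: complex))) \<le> norm (C * exp (- (1 * \<bar>t\<bar>)))"
    proof (rule AE_I2)
      fix t :: real
      have "norm (phi t) * exp (R * \<bar>t\<bar>) \<le> C * exp (- (real n * \<bar>t\<bar>)) * exp (R * \<bar>t\<bar>)"
        by (intro mult_right_mono C) auto
      also have "\<dots> = C * exp (- ((real n - R) * \<bar>t\<bar>))"
        by (simp add: exp_add [symmetric] algebra_simps)
      also have "\<dots> \<le> C * exp (- (1 * \<bar>t\<bar>))"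
      proof -
        have "1 * \<bar>t\<bar> \<le> (real n - R) * \<bar>t\<bar>" using n by (intro mult_right_mono) auto
        then show ?thesis using C0 by (intro mult_left_mono) auto
      qed
      finally show "norm (norm (phi t) * exp (R * norm (of_real t :: complex))) \<le> norm (C * exp (- (1 * \<bar>t\<bar>)))"
        using C0 by simp
    qed
  qed
qed

definition mellin :: "complex \<Rightarrow> complex" where
  "mellin s = (\<integral>t. exp (s * of_real t) * phi t \<partial>lborel)"

lemma holomorphic_mellin: "mellin holomorphic_on UNIV"
  unfolding mellin_def
  by (intro holomorphic_exp_integral measurable_phi integrable_phi_exp) auto

lemma integrable_phi: "integrable lborel phi"
proof -
  have "integrable lborel (\<lambda>t. exp (0 * of_real t) * phi t)"
    by (intro integrable_exp_integral measurable_phi integrable_phi_exp) auto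
  then show ?thesis by simp
qed

text \<open>Written with the reciprocal Gamma function, both sides are entire. The identity then
  extends from the ray of convergence to s = 0, where Gamma itself has a pole.\<close>

lemma mellin_eq: "rGamma s * mellin s = c1.L_line (s - of_nat k) * c2.L_line s"
proof (rule entire_eq_on_ray[where c = "real k + 2" and f = "\<lambda>s. rGamma s * mellin s"
      and g = "\<lambda>s. c1.L_line (s - of_nat k) * c2.L_line s"])
  show "(\<lambda>s. rGamma s * mellin s) holomorphic_on UNIV"
    by (intro holomorphic_intros holomorphic_mellin)
  show "(\<lambda>s. c1.L_line (s - of_nat k) * c2.L_line s) holomorphic_on UNIV"
    by (intro holomorphic_intros c2.holomorphic_L_line
        holomorphic_on_compose_gen[OF _ c1.holomorphic_L_line, unfolded o_def]) auto
  fix s :: real assume s: "s > real k + 2"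
  have G0: "Gamma s > 0" using s by (intro Gamma_real_pos) linarith
  have "(\<lambda>n. chi1 (Suc n) / of_nat (Suc n) powr of_real (s - real k)) sums c1.L_line (of_real (s - real k))"
    using s by (intro c1.L_line_sums) simp
  moreover have "(\<lambda>n. chi2 (Suc n) / of_nat (Suc n) powr of_real s) sums c2.L_line (of_real s)"
    using s by (intro c2.L_line_sums) simp
  ultimately have "(\<lambda>n. sg n * of_real (1 / real (Suc n) powr s)) sums (c1.L_line (of_real (s - real k)) * c2.L_line (of_real s))"
    by (rule sums_dirichlet_product[OF s])
  hence "(\<lambda>n. of_real (Gamma s) * (sg n * of_real (1 / real (Suc n) powr s)))
      sums (of_real (Gamma s) * (c1.L_line (of_real (s - real k)) * c2.L_line (of_real s)))"
    by (rule sums_mult)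
  also have "(\<lambda>n. of_real (Gamma s) * (sg n * of_real (1 / real (Suc n) powr s)))
      = (\<lambda>n. sg n * of_real (Gamma s / real (Suc n) powr s))"
    by (auto simp: fun_eq_iff)
  finally have "(\<lambda>n. sg n * of_real (Gamma s / real (Suc n) powr s))
      sums (of_real (Gamma s) * (c1.L_line (of_real (s - real k)) * c2.L_line (of_real s)))" .
  moreover have "(\<lambda>n. sg n * of_real (Gamma s / real (Suc n) powr s)) sums mellin (of_real s)"
    using mellin_lambert[of s] s by (simp add: mellin_def exp_of_real flip: of_real_mult)
  ultimately have "mellin (of_real s) = of_real (Gamma s) * (c1.L_line (of_real (s - real k)) * c2.L_line (of_real s))"
    by (rule sums_unique2 [symmetric])
  moreover have "rGamma (of_real s :: complex) * of_real (Gamma s) = 1"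
    using G0 by (simp add: rGamma_inverse_Gamma Gamma_complex_of_real)
  ultimately show "rGamma (of_real s) * mellin (of_real s) = c1.L_line (of_real s - of_nat k) * c2.L_line (of_real s)"
    by (simp flip: mult.assoc)
qed

text \<open>The reciprocal Gamma function has a simple zero at 0 with derivative 1, so
  differentiating \<open>mellin_eq\<close> there isolates \<open>mellin 0\<close>.\<close>

lemma mellin_0:
  "mellin 0 = deriv c1.L_line (- of_nat k) * c2.L_line 0 + c1.L_line (- of_nat k) * deriv c2.L_line 0"
proof -
  have rG: "(rGamma has_field_derivative 1) (at (0 :: complex))"
    using has_field_derivative_rGamma_nonpos_int[of 0 UNIV] by simp
  have hd: "(f has_field_derivative deriv f z) (at z)" if "f holomorphic_on UNIV" for f :: "complex \<Rightarrow> complex" and z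
    using that by (intro holomorphic_derivI[of _ UNIV]) auto
  have "((\<lambda>s. rGamma s * mellin s) has_field_derivative (1 * mellin 0 + deriv mellin 0 * rGamma 0)) (at 0)"
    by (intro DERIV_mult rG hd holomorphic_mellin)
  hence 1: "((\<lambda>s. rGamma s * mellin s) has_field_derivative mellin 0) (at 0)" by simp
  have "((\<lambda>s. c1.L_line (s - of_nat k)) has_field_derivative deriv c1.L_line (0 - of_nat k) * 1) (at 0)"
    by (rule DERIV_chain2[OF hd[OF c1.holomorphic_L_line]]) (auto intro!: derivative_eq_intros)
  hence "((\<lambda>s. c1.L_line (s - of_nat k) * c2.L_line s) has_field_derivative
      (deriv c1.L_line (0 - of_nat k) * 1 * c2.L_line 0 + deriv c2.L_line 0 * c1.L_line (0 - of_nat k))) (at 0)"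
    by (rule DERIV_mult[OF _ hd[OF c2.holomorphic_L_line]])
  moreover have "(\<lambda>s. c1.L_line (s - of_nat k) * c2.L_line s) = (\<lambda>s. rGamma s * mellin s)"
    by (simp add: mellin_eq fun_eq_iff)
  ultimately have "mellin 0 = deriv c1.L_line (0 - of_nat k) * 1 * c2.L_line 0 + deriv c2.L_line 0 * c1.L_line (0 - of_nat k)"
    using 1 DERIV_unique by metis
  then show ?thesis by (simp add: mult.commute)
qed

lemma bessel_series:
  fixes al :: real
  assumes al: "al > 0"
  shows "(\<lambda>n. sg n * of_real (bessel_K0 (2 * sqrt (al * real (Suc n))))) sums
    (1 / 2 * mellin 0 - 1 / 2 * kap * (\<Sum>n. dual.sg n *
        of_real (fact k / (B * real (Suc n)) ^ (k + 1) - fact k / (B * real (Suc n) + al) ^ (k + 1))))"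
proof -
  define h where "h = (\<lambda>t. of_real ((1 - exp (- (al * exp t))) * exp (real (k + 1) * t)) * lambert (cnj \<circ> chi2) (cnj \<circ> chi1) k (B * exp t))"
  define Q where "Q = (\<Sum>n. dual.sg n * of_real (fact k / (B * real (Suc n)) ^ (k + 1) - fact k / (B * real (Suc n) + al) ^ (k + 1)))"
  have Q: "Q = (\<integral>t. h t \<partial>lborel)"
    unfolding Q_def h_def using dual.rational_lambert[OF al B_pos] by (simp only: sums_iff)
  \<comment> \<open>After t -> - t the weight factor of the modular equation becomes exp ((k + 1)
    t), the kernel of the Gamma integrals in \<open>rational_lambert\<close>.\<close>
  have ph: "of_real (1 - exp (- (al * exp (- t)))) * phi t = kap * h (0 + (-1) * t)" for t
    unfolding phi_modular h_def by (simp add: mult_ac)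
  have i1: "integrable lborel (\<lambda>t. of_real (exp (- (al * exp (- t)))) * phi t)"
  proof (rule Bochner_Integration.integrable_bound[OF integrable_phi])
    show "(\<lambda>t. of_real (exp (- (al * exp (- t)))) * phi t) \<in> borel_measurable lborel"
      using measurable_phi by measurable
    show "AE t in lborel. norm (of_real (exp (- (al * exp (- t)))) * phi t) \<le> norm (phi t)"
      using al by (auto simp: norm_mult intro!: mult_left_le_one_le)
  qed
  have "(\<integral>t. of_real (1 - exp (- (al * exp (- t)))) * phi t \<partial>lborel) = kap * Q"
    unfolding ph Q using lborel_integral_real_affine[of "-1" h 0] by simp
  moreover have "(\<integral>t. of_real (1 - exp (- (al * exp (- t)))) * phi t \<partial>lborel)
      = (\<integral>t. phi t \<partial>lborel) - (\<integral>t. of_real (exp (- (al * exp (- t)))) * phi t \<partial>lborel)"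
    using Bochner_Integration.integral_diff[OF integrable_phi i1] by (simp add: left_diff_distrib)
  moreover have "mellin 0 = (\<integral>t. phi t \<partial>lborel)" by (simp add: mellin_def)
  ultimately have I: "(\<integral>t. of_real (exp (- (al * exp (- t)))) * phi t \<partial>lborel) = mellin 0 - kap * Q"
    by (simp add: algebra_simps)
  have "(\<lambda>n. 1 / 2 * (sg n * of_real (2 * bessel_K0 (2 * sqrt (al * real (Suc n)))))) sums (1 / 2 * (mellin 0 - kap * Q))"
    using bessel_lambert[OF al] unfolding I by (rule sums_mult)
  then show ?thesis by (simp add: Q_def right_diff_distrib mult.assoc)
qed

end

text \<open>The only character modulo 1 is the constant 1, which is principal and not odd. This is
  why only the even case has to exclude principal characters explicitly.\<close>

lemma primitive_char_modulus_gt_1: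
  assumes "primitive_char q chi" and "\<not> principal_char q chi \<or> odd_char q chi"
  shows "q > 1"
proof (rule ccontr)
  assume "\<not> q > 1"
  have d: "q > 0" "\<And>m n. chi (m * n) = chi m * chi n" "\<And>n. chi (n + q) = chi n" "\<And>n. chi n = 0 \<longleftrightarrow> \<not> coprime n q"
    using assms(1) by (auto simp: primitive_char_def dirichlet_char_def)
  have q: "q = 1" using \<open>\<not> q > 1\<close> d(1) by simp
  have "chi 0 = 1" using d(2)[of 0 0] d(4)[of 0] q by simp
  hence "chi n = 1" for n using d(3) q by (induction n) auto
  then show False using assms(2) by (auto simp: principal_char_def odd_char_def)
qed

theorem theorem2p11:
  fixes k p q :: nat and chi1 chi2 :: "nat \<Rightarrow> complex" and a x :: real
  assumes "odd k" and "k \<ge> 1"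
    and "primitive_char p chi1" and "primitive_char q chi2"
    and "(even_char p chi1 \<and> even_char q chi2 \<and> \<not> principal_char p chi1 \<and> \<not> principal_char q chi2)
         \<or> (odd_char p chi1 \<and> odd_char q chi2)"
    and "a > 0" and "x > 0"
  shows "(\<lambda>n. sigma_chi (of_nat k) chi1 chi2 (Suc n)
                * of_real (bessel_K0 (a * sqrt (real (Suc n) * x))))
     sums
      ((1/2) * (if even_char p chi1
                 then dirichlet_L chi1 (- of_nat k) * deriv (dirichlet_L chi2) 0
                 else deriv (dirichlet_L chi1) (- of_nat k) * dirichlet_L chi2 0)
       + ((-1) ^ ((k - 1) div 2) * of_nat (fact k) * of_nat p ^ k
          / (2 * (2 * of_real pi) ^ (k + 1)))
         * gauss_sum p chi1 * gauss_sum q chi2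
         * (\<Sum>n. sigma_chi (of_nat k) (cnj \<circ> chi2) (cnj \<circ> chi1) (Suc n)
              * (1 / of_nat (Suc n) ^ (k + 1)
                 - 1 / of_real (real (Suc n) + a\<^sup>2 * real p * real q * x / (16 * pi\<^sup>2)) ^ (k + 1))))"
proof -
  define e :: real where "e = (if even_char p chi1 then 1 else - 1)"
  have "p > 1" "q > 1" using assms(3-5) primitive_char_modulus_gt_1[of p chi1] primitive_char_modulus_gt_1[of q chi2] by auto
  moreover have "chi1 (p - 1) = of_real e" "chi2 (q - 1) = of_real e"
    using assms(5) by (auto simp: e_def even_char_def odd_char_def)
  ultimately interpret character_pair_weight p q chi1 chi2 e k
    using assms by unfold_locales (auto simp: e_def)
  \<comment> \<open>Chosen so that 2 sqrt (al n) is the Bessel argument a sqrt (n x).\<close>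
  define al where "al = a\<^sup>2 * x / 4"
  have al: "al > 0" using assms by (simp add: al_def)
  have sq: "2 * sqrt (al * real (Suc n)) = a * sqrt (real (Suc n) * x)" for n
  proof -
    have "al * real (Suc n) = (a / 2)\<^sup>2 * (real (Suc n) * x)" by (simp add: al_def power_divide)
    then show ?thesis using assms by (simp add: real_sqrt_mult del: of_nat_Suc)
  qed
  have alB: "al / B = a\<^sup>2 * real p * real q * x / (16 * pi\<^sup>2)"
    using p_pos q_pos by (simp add: al_def B_def field_simps)
  have c: "mellin 0 = (if even_char p chi1
                 then dirichlet_L chi1 (- of_nat k) * deriv (dirichlet_L chi2) 0
                 else deriv (dirichlet_L chi1) (- of_nat k) * dirichlet_L chi2 0)"
  \<comment> \<open>For even characters L(0) of \<open>chi2\<close> is a trivial zero; for odd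
    characters L(- k) of \<open>chi1\<close> is one, because k is odd. One term of
    \<open>mellin_0\<close> remains in each case.\<close>
  proof (cases "even_char p chi1")
    case True
    have "c2.L_line 0 = 0" using c2.L_line_trivial_zero[of 0] True by (simp add: e_def)
    then show ?thesis using True by (simp add: mellin_0 c1.dirichlet_L_eq c2.dirichlet_L_eq)
  next
    case False
    have "c1.L_line (- of_nat k) = 0" using False odd_k by (intro c1.L_line_trivial_zero) (simp add: e_def)
    then show ?thesis using False by (simp add: mellin_0 c1.dirichlet_L_eq c2.dirichlet_L_eq)
  qed
  define D :: "nat \<Rightarrow> complex" where "D = (\<lambda>n. dual.sg n * (1 / of_nat (Suc n) ^ (k + 1)
                 - 1 / of_real (real (Suc n) + a\<^sup>2 * real p * real q * x / (16 * pi\<^sup>2)) ^ (k + 1)))"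
  define E :: "nat \<Rightarrow> complex" where "E = (\<lambda>n. dual.sg n *
        of_real (fact k / (B * real (Suc n)) ^ (k + 1) - fact k / (B * real (Suc n) + al) ^ (k + 1)))"
  have ED: "E = (\<lambda>n. of_real (fact k / B ^ (k + 1)) * D n)"
  proof
    fix n
    have "B * real (Suc n) + al = B * (real (Suc n) + al / B)" using B_pos by (simp add: field_simps)
    hence "fact k / (B * real (Suc n)) ^ (k + 1) - fact k / (B * real (Suc n) + al) ^ (k + 1)
        = fact k / B ^ (k + 1) * (1 / real (Suc n) ^ (k + 1) - 1 / (real (Suc n) + al / B) ^ (k + 1))"
      by (simp only: power_mult_distrib right_diff_distrib times_divide_times_eq mult_1_right)
    then show "E n = of_real (fact k / B ^ (k + 1)) * D n"
      unfolding E_def D_def alB[symmetric] by (simp del: of_nat_Suc power_Suc)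
  qed
  have "summable E"
    using dual.rational_lambert[OF al B_pos] unfolding E_def by (rule sums_summable)
  \<comment> \<open>The right-hand side of the theorem contains an infinite sum as a value, so its
    convergence is established before the constant is taken out.\<close>
  hence "summable D" using B_pos unfolding ED by (simp add: summable_cmult_iff)
  hence sumE: "suminf E = of_real (fact k / B ^ (k + 1)) * suminf D"
    unfolding ED by (rule suminf_mult)
  \<comment> \<open>The minus sign lowers the exponent of -1 from (k + 1) / 2 to (k - 1) / 2. In
    B^(k+1) = (2 pi)^(2k+2) / (p q)^(k+1) the power of q cancels, p^k is left over, and so is one
    factor (2 pi)^(k+1) in the denominator.\<close>
  have coef: "- (1 / 2 * kap * of_real (fact k / B ^ (k + 1)))
      = ((-1) ^ ((k - 1) div 2) * of_nat (fact k) * of_nat p ^ k / (2 * (2 * of_real pi) ^ (k + 1))) * tau1 * tau2"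
  proof -
    obtain j where j: "k = 2 * j + 1" using odd_k by (auto elim: oddE)
    have sgn: "- ((-1) ^ ((k + 1) div 2)) = ((-1) ^ ((k - 1) div 2) :: complex)" by (simp add: j)
    have "(2 * pi) ^ (k + 1) / (real p * real q ^ (k + 1)) * (fact k / B ^ (k + 1))
        = fact k * real p ^ k / (2 * pi) ^ (k + 1)"
    proof -
      have "B = (2 * pi) * (2 * pi) / (real p * real q)" by (simp add: B_def power2_eq_square)
      hence "B ^ (k + 1) = (2 * pi) ^ (k + 1) * (2 * pi) ^ (k + 1) / (real p ^ (k + 1) * real q ^ (k + 1))"
        by (simp only: power_divide power_mult_distrib)
      moreover have "T / (P * Q) * (f / (T * T / (P * P' * Q))) = f * P' / T" if "T \<noteq> 0" "P \<noteq> 0" "Q \<noteq> 0" for T P P' Q f :: real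
        using that by (simp add: field_simps)
      ultimately show ?thesis using p_pos q_pos by simp
    qed
    hence r: "of_real ((2 * pi) ^ (k + 1) / (real p * real q ^ (k + 1))) * of_real (fact k / B ^ (k + 1))
        = (of_nat (fact k) * of_nat p ^ k / (2 * of_real pi) ^ (k + 1) :: complex)"
      unfolding of_real_mult [symmetric] by simp
    have "- (1 / 2 * kap * of_real (fact k / B ^ (k + 1)))
       = (- ((-1) ^ ((k + 1) div 2))) * (of_real ((2 * pi) ^ (k + 1) / (real p * real q ^ (k + 1))) * of_real (fact k / B ^ (k + 1))) * tau1 * tau2 / 2"
      unfolding kap_def by (simp only: mult_ac times_divide_eq_right mult_minus_left mult_minus_right mult_1_left mult_1_right minus_divide_left times_divide_eq_left)
    also have "\<dots> = ((-1) ^ ((k - 1) div 2) * of_nat (fact k) * of_nat p ^ k / (2 * (2 * of_real pi) ^ (k + 1))) * tau1 * tau2"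
      unfolding sgn r by (simp add: mult_ac)
    finally show ?thesis .
  qed
  have "1 / 2 * mellin 0 - 1 / 2 * kap * suminf E = 1 / 2 * mellin 0 + - (1 / 2 * kap * of_real (fact k / B ^ (k + 1))) * suminf D"
    unfolding sumE by (simp add: mult_ac)
  then show ?thesis
    using bessel_series[OF al] unfolding sq E_def[symmetric] D_def[symmetric] c[symmetric] coef by (simp only:)
qed

end
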